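(* For each triple $(x_1,x_2,x_3)$ in the list $(1,5,0),(2,0,1),(3,1,2),(4,2,3),(5,3,4),(0,4,5)$, let $\rho_{(x_1,x_2,x_3)}:\Gamma\to\mathrm{GL}_3(\mathbb{C})$ be the representation with $\rho(T)=\mathrm{diag}(\lambda_1,\lambda_2,\lambda_3)$, $\lambda_j=e^{2\pi ix_j/6}$, and $\rho(S)=\begin{pmatrix}-\sigma&0&1\\0&-\sigma&1\\0&0&\sigma\end{pmatrix}$, $\sigma=\lambda_3^3$; it is an extension $0\to\rho_0\to\rho\to\chi^{2x_3}\to0$ with $\rho_0\simeq\chi^{2x_1}\oplus\chi^{2x_2}$ completely reducible. (i) If $(x_1,x_2,x_3)\neq(1,5,0)$, then $\rho_{(x_1,x_2,x_3)}$ is $M$-split and its generating weights are $(2x_1,2x_2,2x_3)$. (ii) $\rho_{(1,5,0)}$ is not $M$-split and its generating weights are $(2,4,6)$.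
   Context: $\Gamma=\mathrm{PSL}_2(\mathbb{Z})$, $S,T$ the images of $\begin{pmatrix}0&-1\\1&0\end{pmatrix}$, $\begin{pmatrix}1&1\\0&1\end{pmatrix}$; representations of $\Gamma$ are viewed as representations of $\mathrm{SL}_2(\mathbb{Z})$ trivial on $-I$. $\chi^m$ is the character with $\chi^m(T)=e^{2\pi im/12}$. For a finite-dimensional representation $\rho$ on $V$, let $L$ be the unique endomorphism with $e^{2\pi iL}=\rho(T)$ whose eigenvalues have real parts in $[0,1)$; a holomorphic vector-valued modular form of weight $k$ for $\rho$ is a holomorphic $F:\mathbb{H}\to V$ with $F(\gamma\tau)=(c\tau+d)^k\rho(\gamma)F(\tau)$ for all $\gamma\in\mathrm{SL}_2(\mathbb{Z})$ and $e^{-2\pi i\tau L}F(\tau)$ holomorphic at $q=e^{2\pi i\tau}=0$. $M(\rho)=\bigoplus_kM_k(\rho)$ is free of rank $\dim\rho$ over $R=\mathbb{C}[E_4,E_6]$, and the generating weights are the weights of a homogeneous $R$-basis. For an exact sequence $0\to\rho_0\to\rho\to\rho_1\to0$, $\rho$ is $M$-split if the induced map $M(\rho)\to M(\rho_1)$ is surjective. *)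

theory Defs
  imports
    "HOL-Analysis.Analysis"
    "HOL-Algebra.Group"
    "HOL-Library.FuncSet"
    "HOL-Library.Multiset"
begin

section \<open>The modular group and its representations\<close>

definition SL2Z :: "(int^2^2) monoid" where
  "SL2Z = \<lparr>carrier = {A. det A = 1}, mult = (**), one = mat 1\<rparr>"

definition GL :: "(complex^'n^'n) monoid" where
  "GL = \<lparr>carrier = {A. invertible A}, mult = (**), one = mat 1\<rparr>"

definition S_mat :: "int^2^2" where
  "S_mat = vector [vector [0, -1], vector [1, 0]]"

definition T_mat :: "int^2^2" where
  "T_mat = vector [vector [1, 1], vector [0, 1]]"

text \<open>Representations act on column vectors. Only the values on \<^term>\<open>carrier SL2Z\<close> matter;
  where a representation is asserted to be unique, its values elsewhere are fixed by
  \<^const>\<open>extensional\<close>.\<close>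

definition representation :: "(int^2^2 \<Rightarrow> complex^'n^'n) \<Rightarrow> bool" where
  "representation \<rho> \<longleftrightarrow> \<rho> \<in> hom SL2Z GL"

definition PSL2Z_representation :: "(int^2^2 \<Rightarrow> complex^'n^'n) \<Rightarrow> bool" where
  "PSL2Z_representation \<rho> \<longleftrightarrow> representation \<rho> \<and> \<rho> (- mat 1) = mat 1"

text \<open>The power \<open>\<chi>\<^sup>m\<close> of the basic character of \<open>SL\<^sub>2(\<int>)\<close>, as a one-dimensional
  representation.\<close>

definition chi :: "int \<Rightarrow> int^2^2 \<Rightarrow> complex^1^1" where
  "chi m = (THE \<psi>. representation \<psi> \<and> \<psi> \<in> extensional (carrier SL2Z) \<and>
      \<psi> T_mat = mat (exp (2 * pi * \<i> * of_int m / 12)))"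

definition rep_sum ::
  "(int^2^2 \<Rightarrow> complex^'a^'a) \<Rightarrow> (int^2^2 \<Rightarrow> complex^'b^'b) \<Rightarrow> int^2^2 \<Rightarrow> complex^('a + 'b)^('a + 'b)"
where
  "rep_sum \<rho> \<rho>' g = (\<chi> i j. case (i, j) of
      (Inl a, Inl b) \<Rightarrow> \<rho> g $ a $ b
    | (Inr a, Inr b) \<Rightarrow> \<rho>' g $ a $ b
    | _ \<Rightarrow> 0)"

definition intertwines ::
  "(complex^'n^'m) \<Rightarrow> (int^2^2 \<Rightarrow> complex^'n^'n) \<Rightarrow> (int^2^2 \<Rightarrow> complex^'m^'m) \<Rightarrow> bool"
where
  "intertwines P \<rho> \<rho>' \<longleftrightarrow> (\<forall>g\<in>carrier SL2Z. P ** \<rho> g = \<rho>' g ** P)"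

definition rep_iso ::
  "(int^2^2 \<Rightarrow> complex^'n^'n) \<Rightarrow> (int^2^2 \<Rightarrow> complex^'m^'m) \<Rightarrow> bool"
where
  "rep_iso \<rho> \<rho>' \<longleftrightarrow> (\<exists>P. intertwines P \<rho> \<rho>' \<and> bij ((*v) P))"

definition invariant_subspace :: "(int^2^2 \<Rightarrow> complex^'n^'n) \<Rightarrow> (complex^'n) set \<Rightarrow> bool" where
  "invariant_subspace \<rho> W \<longleftrightarrow>
     vec.subspace W \<and> (\<forall>g\<in>carrier SL2Z. \<forall>v\<in>W. \<rho> g *v v \<in> W)"

definition completely_reducible :: "(int^2^2 \<Rightarrow> complex^'n^'n) \<Rightarrow> bool" where
  "completely_reducible \<rho> \<longleftrightarrow>
     (\<forall>W. invariant_subspace \<rho> W \<longrightarrow>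
        (\<exists>W'. invariant_subspace \<rho> W' \<and> W \<inter> W' = {0} \<and> {w + w' | w w'. w \<in> W \<and> w' \<in> W'} = UNIV))"

text \<open>\<open>0 \<rightarrow> \<rho>\<^sub>0 \<rightarrow> \<rho> \<rightarrow> \<rho>\<^sub>1 \<rightarrow> 0\<close> is exact, with maps given by the matrices \<open>\<iota>\<close> and \<open>p\<close>.\<close>

definition exact_sequence ::
  "(int^2^2 \<Rightarrow> complex^'a^'a) \<Rightarrow> complex^'a^'n \<Rightarrow> (int^2^2 \<Rightarrow> complex^'n^'n) \<Rightarrow>
   complex^'n^'b \<Rightarrow> (int^2^2 \<Rightarrow> complex^'b^'b) \<Rightarrow> bool"
where
  "exact_sequence \<rho>0 \<iota> \<rho> p \<rho>1 \<longleftrightarrow>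
     representation \<rho>0 \<and> representation \<rho> \<and> representation \<rho>1 \<and>
     intertwines \<iota> \<rho>0 \<rho> \<and> intertwines p \<rho> \<rho>1 \<and>
     inj ((*v) \<iota>) \<and> surj ((*v) p) \<and> range ((*v) \<iota>) = {v. p *v v = 0}"

section \<open>Vector-valued modular forms\<close>

definition cscale :: "complex \<Rightarrow> complex^'n^'n \<Rightarrow> complex^'n^'n" where
  "cscale c A = (\<chi> i j. c * A $ i $ j)"

definition matrix_exp :: "complex^'n^'n \<Rightarrow> complex^'n^'n" where
  "matrix_exp A = (\<Sum>k. (1 / fact k) *\<^sub>R (((**) A) ^^ k) (mat 1))"

definition exponent :: "complex^'n^'n \<Rightarrow> complex^'n^'n" where
  "exponent M = (THE L. matrix_exp (cscale (2 * pi * \<i>) L) = M \<and>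
      (\<forall>e v. v \<noteq> 0 \<and> L *v v = e *s v \<longrightarrow> 0 \<le> Re e \<and> Re e < 1))"

definition uhp :: "complex set" where
  "uhp = {\<tau>. Im \<tau> > 0}"

text \<open>Functions on the upper half-plane are total functions that vanish off it, so that
  equality of functions is equality on the half-plane. The quotient
  \<open>exp (- 2 \<pi> \<i> \<tau> L) F \<tau>\<close> has period 1; it is holomorphic at \<open>q = 0\<close> if, as a function of
  \<open>q\<close> in the punctured unit disc, it extends holomorphically to the disc.\<close>

definition vvmf :: "(int^2^2 \<Rightarrow> complex^'n^'n) \<Rightarrow> int \<Rightarrow> (complex \<Rightarrow> complex^'n) set" where
  "vvmf \<rho> k = {F.
     (\<forall>\<tau>. \<tau> \<notin> uhp \<longrightarrow> F \<tau> = 0) \<and>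
     (\<forall>i. (\<lambda>\<tau>. F \<tau> $ i) holomorphic_on uhp) \<and>
     (\<forall>\<gamma>\<in>carrier SL2Z. \<forall>\<tau>\<in>uhp.
        F ((of_int (\<gamma>$1$1) * \<tau> + of_int (\<gamma>$1$2)) / (of_int (\<gamma>$2$1) * \<tau> + of_int (\<gamma>$2$2))) =
        ((of_int (\<gamma>$2$1) * \<tau> + of_int (\<gamma>$2$2)) powi k) *s (\<rho> \<gamma> *v F \<tau>)) \<and>
     (\<exists>f. (\<forall>i. (\<lambda>q. f q $ i) holomorphic_on ball 0 1) \<and>
        (\<forall>\<tau>\<in>uhp. matrix_exp (cscale (- (2 * pi * \<i> * \<tau>)) (exponent (\<rho> T_mat))) *v F \<tau> =
                f (exp (2 * pi * \<i> * \<tau>))))}"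

text \<open>The direct sum of the spaces of all integral weights: families of forms, indexed by the
  weight, with finitely many nonzero members.\<close>

definition vvmf_module ::
  "(int^2^2 \<Rightarrow> complex^'n^'n) \<Rightarrow> (int \<Rightarrow> complex \<Rightarrow> complex^'n) set"
where
  "vvmf_module \<rho> = {F. (\<forall>k. F k \<in> vvmf \<rho> k) \<and> finite {k. F k \<noteq> (\<lambda>\<tau>. 0)}}"

definition M_split ::
  "(int^2^2 \<Rightarrow> complex^'n^'n) \<Rightarrow> complex^'n^'b \<Rightarrow> (int^2^2 \<Rightarrow> complex^'b^'b) \<Rightarrow> bool"
where
  "M_split \<rho> p \<rho>1 \<longleftrightarrow>
     (\<forall>G\<in>vvmf_module \<rho>1. \<exists>F\<in>vvmf_module \<rho>. (\<lambda>k \<tau>. p *v F k \<tau>) = G)"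

section \<open>The module structure over \<open>R = \<complex>[E\<^sub>4, E\<^sub>6]\<close>\<close>

definition E4 :: "complex \<Rightarrow> complex" where
  "E4 \<tau> = 1 + 240 * (\<Sum>n. of_nat (\<Sum>d | d dvd Suc n. d ^ 3) * exp (2 * pi * \<i> * \<tau>) ^ Suc n)"

definition E6 :: "complex \<Rightarrow> complex" where
  "E6 \<tau> = 1 - 504 * (\<Sum>n. of_nat (\<Sum>d | d dvd Suc n. d ^ 5) * exp (2 * pi * \<i> * \<tau>) ^ Suc n)"

text \<open>The homogeneous part of \<open>R\<close> of weight \<open>k\<close>: the span of the monomials
  \<open>E\<^sub>4\<^sup>a E\<^sub>6\<^sup>b\<close> with \<open>4 a + 6 b = k\<close>, as functions on the upper half-plane.\<close>

definition R_part :: "int \<Rightarrow> (complex \<Rightarrow> complex) set" where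
  "R_part k = {f. \<exists>c :: nat \<Rightarrow> nat \<Rightarrow> complex. f = (\<lambda>\<tau>. if \<tau> \<in> uhp
       then \<Sum>(a, b) | 4 * int a + 6 * int b = k. c a b * E4 \<tau> ^ a * E6 \<tau> ^ b else 0)}"

definition R :: "(int \<Rightarrow> complex \<Rightarrow> complex) set" where
  "R = {r. (\<forall>k. r k \<in> R_part k) \<and> finite {k. r k \<noteq> (\<lambda>\<tau>. 0)}}"

definition R_act ::
  "(int \<Rightarrow> complex \<Rightarrow> complex) \<Rightarrow> (int \<Rightarrow> complex \<Rightarrow> complex^'n) \<Rightarrow> int \<Rightarrow> complex \<Rightarrow> complex^'n"
where
  "R_act r F k \<tau> = (\<Sum>j | r j \<noteq> (\<lambda>\<tau>. 0). r j \<tau> *s F (k - j) \<tau>)"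

definition homogeneous :: "int \<Rightarrow> (complex \<Rightarrow> complex^'n) \<Rightarrow> int \<Rightarrow> complex \<Rightarrow> complex^'n" where
  "homogeneous k F = (\<lambda>j. if j = k then F else (\<lambda>\<tau>. 0))"

definition R_combination ::
  "int list \<Rightarrow> (nat \<Rightarrow> complex \<Rightarrow> complex^'n) \<Rightarrow> (nat \<Rightarrow> int \<Rightarrow> complex \<Rightarrow> complex) \<Rightarrow>
   int \<Rightarrow> complex \<Rightarrow> complex^'n"
where
  "R_combination ks B r = (\<lambda>k \<tau>. \<Sum>i<length ks. R_act (r i) (homogeneous (ks ! i) (B i)) k \<tau>)"

text \<open>\<open>B 0, B 1, \<dots>\<close>, of weights \<open>ks ! 0, ks ! 1, \<dots>\<close>, form a homogeneous \<open>R\<close>-basis.\<close>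

definition homogeneous_basis ::
  "(int^2^2 \<Rightarrow> complex^'n^'n) \<Rightarrow> int list \<Rightarrow> (nat \<Rightarrow> complex \<Rightarrow> complex^'n) \<Rightarrow> bool"
where
  "homogeneous_basis \<rho> ks B \<longleftrightarrow>
     (\<forall>i<length ks. B i \<in> vvmf \<rho> (ks ! i)) \<and>
     (\<forall>F\<in>vvmf_module \<rho>. \<exists>r. (\<forall>i<length ks. r i \<in> R) \<and> F = R_combination ks B r) \<and>
     (\<forall>r. (\<forall>i<length ks. r i \<in> R) \<and> R_combination ks B r = (\<lambda>k \<tau>. 0) \<longrightarrow>
        (\<forall>i<length ks. r i = (\<lambda>k \<tau>. 0)))"

definition has_generating_weights :: "(int^2^2 \<Rightarrow> complex^'n^'n) \<Rightarrow> int multiset \<Rightarrow> bool" where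
  "has_generating_weights \<rho> W \<longleftrightarrow> (\<exists>ks B. homogeneous_basis \<rho> ks B \<and> mset ks = W)"

section \<open>The three-dimensional representations\<close>

definition lam :: "int \<Rightarrow> complex" where
  "lam x = exp (2 * pi * \<i> * of_int x / 6)"

definition is_rho :: "int \<Rightarrow> int \<Rightarrow> int \<Rightarrow> (int^2^2 \<Rightarrow> complex^3^3) \<Rightarrow> bool" where
  "is_rho x1 x2 x3 \<rho> \<longleftrightarrow>
     PSL2Z_representation \<rho> \<and> \<rho> \<in> extensional (carrier SL2Z) \<and>
     \<rho> T_mat = vector [vector [lam x1, 0, 0], vector [0, lam x2, 0], vector [0, 0, lam x3]] \<and>
     (let \<sigma> = lam x3 ^ 3 in
        \<rho> S_mat = vector [vector [- \<sigma>, 0, 1], vector [0, - \<sigma>, 1], vector [0, 0, \<sigma>]])"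

definition is_extension ::
  "int \<Rightarrow> int \<Rightarrow> int \<Rightarrow> (int^2^2 \<Rightarrow> complex^2^2) \<Rightarrow> complex^2^3 \<Rightarrow>
   (int^2^2 \<Rightarrow> complex^3^3) \<Rightarrow> complex^3^1 \<Rightarrow> bool"
where
  "is_extension x1 x2 x3 \<rho>0 \<iota> \<rho> p \<longleftrightarrow>
     exact_sequence \<rho>0 \<iota> \<rho> p (chi (2 * x3)) \<and>
     rep_iso \<rho>0 (rep_sum (chi (2 * x1)) (chi (2 * x2))) \<and> completely_reducible \<rho>0"

end

(*
  Dividing a form F = (f1, f2, f3) for rho by f3 turns the first two coordinates into functions g
  with g(tau + 1) = exp (+- 2 pi i / 6) g(tau) and, after normalisation, g(-1/tau) = 1 - g(tau).
  Such functions are Eichler integrals of forms of weight 2 for chi^2 and chi^-2: of eta^4, with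
  leading exponent 1/6, and of E4 / eta^4, with leading exponent -1/6. Multiplying (g1, g2, 1) by
  eta^(4 x3) gives a form of weight 2 x3 that lifts the generator of M(chi^(2 x3)), unless x3 = 0,
  when the pole of g2 at the cusp survives. The same functions define rho, so that no presentation
  of the modular group is needed. For x3 = 0 the pole is cancelled after multiplication by E4 or E6,
  by a multiple of E6 / eta^4 or E4^2 / eta^4, which produces the generators of weights 4 and 6.

  The scalar theory rests on E4 and E6 being modular (lattice sums and Lipschitz' formula), on
  Delta = (E4^3 - E6^2) / 1728 having no zero (an estimate for Im tau >= sqrt 3 / 2), whence a sixth
  root eta^4, and on the maximum principle in weight 0.
*)
theory Submission
  imports Defs "HOL-Complex_Analysis.Complex_Analysis"
begin

text \<open>The second integrand must have a pole: forms of weight 2 for chi^-2 that are holomorphic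
  at the cusp have leading exponent at least 5/6 and vanish, so E4 / eta^4 takes their place.
  Neither exponent 1/6 nor -1/6 is an integer, hence a primitive exists as a series of the same
  kind, with no constant of integration. The constant in its behaviour under S is then an invariant:
  were it 0, the primitive would be a nonzero form of weight 0, which the vanishing theorems
  exclude. The same argument shows that for x3 = 0 no other lift of 1 exists in weight 0, so the
  surviving pole is a true obstruction. In that case the image of M(rho) in R is the ideal generated
  by E4 and E6. Its generators lift to forms B4 and B6, and the syzygy E6 * E4 - E4 * E6 = 0 lifts
  to E6 * B4 - E4 * B6, a nonzero multiple of (0, eta^20, 0) because E4^3 - E6^2 = 1728 eta^24. The
  form of weight 10 contributed by the subrepresentation is therefore a combination of B4 and B6:
  the weights 0 and 10 of the split pattern give way to 4 and 6.\<close>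

no_notation fps_nth (infixl "$" 75)

section \<open>The nome and the upper half-plane\<close>

definition nome :: "complex \<Rightarrow> complex" where
  "nome \<tau> = exp (2 * pi * \<i> * \<tau>)"

lemma norm_nome: "norm (nome \<tau>) = exp (- 2 * pi * Im \<tau>)"
  by (simp add: nome_def)

lemma norm_nome_less: "\<tau> \<in> uhp \<Longrightarrow> norm (nome \<tau>) < 1"
  by (simp add: norm_nome uhp_def)

lemma nome_nonzero [simp]: "nome \<tau> \<noteq> 0"
  by (simp add: nome_def)

lemma nome_power: "nome \<tau> ^ n = nome (of_nat n * \<tau>)"
  by (simp add: nome_def exp_of_nat_mult [symmetric] algebra_simps)

lemma has_field_derivative_nome [derivative_intros]:
  "(nome has_field_derivative 2 * pi * \<i> * nome \<tau>) (at \<tau> within A)"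
  unfolding nome_def [abs_def] by (auto intro!: derivative_eq_intros)

lemmas has_field_derivative_nome' [derivative_intros] =
  has_field_derivative_nome [THEN DERIV_chain2]

lemma open_uhp: "open uhp"
  unfolding uhp_def by (simp add: open_halfspace_Im_gt)

lemma uhp_minus_inverse: "\<tau> \<in> uhp \<Longrightarrow> - 1 / \<tau> \<in> uhp"
  by (auto simp: uhp_def Im_divide sum_power2_gt_zero_iff)

lemma uhp_nonzero: "\<tau> \<in> uhp \<Longrightarrow> \<tau> \<noteq> 0"
  by (auto simp: uhp_def)

lemma uhp_not_Ints: "\<tau> \<in> uhp \<Longrightarrow> \<tau> \<notin> \<int>"
  by (auto simp: uhp_def elim!: Ints_cases)

lemma uhp_of_nat_mult: "\<tau> \<in> uhp \<Longrightarrow> m > 0 \<Longrightarrow> of_nat m * \<tau> \<in> uhp"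
  by (auto simp: uhp_def)

subsection \<open>The polylogarithm series and the cotangent\<close>

text \<open>The polylogarithm of order \<open>- n\<close>. For \<open>n = 0\<close> the term
  \<open>r = 0\<close> counts as 1, so the value is 1 / (1 - q) rather than q / (1 - q).\<close>

definition polylog_neg :: "nat \<Rightarrow> complex \<Rightarrow> complex" where
  "polylog_neg n q = (\<Sum>r. of_nat r ^ n * q ^ r)"

text \<open>The operator q d/dq raises the exponent of r by one; \<open>diffs\<close> shifts the
  index, hence \<open>Suc r\<close> on the right.\<close>

lemma diffs_powers: "diffs (\<lambda>r. of_nat r ^ n :: complex) r * q ^ r * q = of_nat (Suc r) ^ Suc n * q ^ Suc r"
  by (simp add: diffs_def algebra_simps)

lemma summable_polylog_neg: "norm q < 1 \<Longrightarrow> summable (\<lambda>r. of_nat r ^ n * q ^ r :: complex)"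
proof (induction n arbitrary: q)
  case 0
  then show ?case by (simp add: summable_geometric)
next
  case (Suc n)
  have "summable (\<lambda>r. diffs (\<lambda>r. of_nat r ^ n :: complex) r * q ^ r)"
    by (rule termdiff_converges[where K = 1]) (use Suc in auto)
  then have "summable (\<lambda>r. diffs (\<lambda>r. of_nat r ^ n :: complex) r * q ^ r * q)"
    by (rule summable_mult2)
  then show ?case
    unfolding diffs_powers by (subst (asm) summable_Suc_iff)
qed

lemma has_field_derivative_polylog_neg_nome:
  assumes "\<tau> \<in> uhp"
  shows "((\<lambda>\<tau>. polylog_neg n (nome \<tau>)) has_field_derivative
          2 * pi * \<i> * polylog_neg (Suc n) (nome \<tau>)) (at \<tau>)"
proof -
  let ?q = "nome \<tau>"
  let ?D = "\<lambda>r. diffs (\<lambda>r. of_nat r ^ n :: complex) r * ?q ^ r"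
  have q: "norm ?q < 1" using assms by (rule norm_nome_less)
  have sm: "summable ?D"
    by (rule termdiff_converges[where K = 1]) (use q summable_polylog_neg in auto)
  have "(polylog_neg n has_field_derivative (\<Sum>r. ?D r)) (at ?q)"
    unfolding polylog_neg_def [abs_def]
    by (rule termdiffs_strong'[where K = 1]) (use q summable_polylog_neg in auto)
  then have "((\<lambda>\<tau>. polylog_neg n (nome \<tau>)) has_field_derivative
      (\<Sum>r. ?D r) * (2 * pi * \<i> * ?q)) (at \<tau>)"
    by (rule DERIV_chain2) (rule has_field_derivative_nome)
  moreover have "(\<Sum>r. ?D r) * ?q = polylog_neg (Suc n) ?q"
  proof -
    have "(\<Sum>r. ?D r) * ?q = (\<Sum>r. of_nat (Suc r) ^ Suc n * ?q ^ Suc r)"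
      by (subst suminf_mult2 [OF sm]) (simp only: diffs_powers)
    also have "\<dots> = polylog_neg (Suc n) ?q"
      unfolding polylog_neg_def
      using suminf_split_head [OF summable_polylog_neg [OF q, of "Suc n"]] by simp
    finally show ?thesis .
  qed
  ultimately show ?thesis by (metis mult.commute mult.assoc)
qed

text \<open>The n-th derivative of pi cot (pi z), written through the reflection formula of the
  digamma function. In this form it is a series over the integers by the definition of
  \<open>Polygamma\<close>.\<close>

definition cot_deriv :: "nat \<Rightarrow> complex \<Rightarrow> complex" where
  "cot_deriv n z = (-1) ^ n * Polygamma n (1 - z) - Polygamma n z"

lemma one_minus_not_Ints: "(z::complex) \<notin> \<int> \<Longrightarrow> 1 - z \<notin> \<int>"
  by (metis Ints_1 Ints_diff diff_diff_eq2 add_diff_cancel_left')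

lemma has_field_derivative_cot_deriv:
  fixes z :: complex
  assumes "z \<notin> \<int>"
  shows "(cot_deriv n has_field_derivative cot_deriv (Suc n) z) (at z)"
proof -
  have "z \<notin> \<int>\<^sub>\<le>\<^sub>0" "1 - z \<notin> \<int>\<^sub>\<le>\<^sub>0"
    using assms one_minus_not_Ints[OF assms] nonpos_Ints_subset_Ints by blast+
  then show ?thesis
    unfolding cot_deriv_def [abs_def]
    by (auto intro!: derivative_eq_intros)
qed

lemma sin_pi_nonzero: "(z::complex) \<notin> \<int> \<Longrightarrow> sin (of_real pi * z) \<noteq> 0"
  by (subst sin_eq_0) (auto simp: mult_ac)

text \<open>The derivative of Gamma(z) Gamma(1 - z) = pi / sin (pi z) is computed on both sides and
  compared.\<close>

lemma cot_deriv_0: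
  fixes z :: complex
  assumes "z \<notin> \<int>"
  shows "cot_deriv 0 z = pi * cot (pi * z)"
proof -
  let ?P = "\<lambda>z::complex. Gamma z * Gamma (1 - z)"
  have 1: "z \<notin> \<int>\<^sub>\<le>\<^sub>0" "1 - z \<notin> \<int>\<^sub>\<le>\<^sub>0"
    using assms one_minus_not_Ints[OF assms] nonpos_Ints_subset_Ints by blast+
  have s: "sin (of_real pi * z) \<noteq> 0" using assms by (rule sin_pi_nonzero)
  have "(?P has_field_derivative - ?P z * cot_deriv 0 z) (at z)"
    using 1 by (auto intro!: derivative_eq_intros simp: cot_deriv_def algebra_simps)
  moreover have "(?P has_field_derivative - pi * pi * cos (pi * z) / (sin (pi * z))\<^sup>2) (at z)"
    unfolding Gamma_reflection_complex
    using s by (auto intro!: derivative_eq_intros simp: power2_eq_square)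
  ultimately have "?P z * cot_deriv 0 z = pi * pi * cos (pi * z) / (sin (pi * z))\<^sup>2"
    using DERIV_unique by fastforce
  then show ?thesis
    unfolding Gamma_reflection_complex using s by (simp add: cot_def field_simps power2_eq_square)
qed

text \<open>Euler's formulas give cot (pi \<tau>) = i (q + 1) / (q - 1), which leaves a geometric
  series in q. This is the Fourier side of Lipschitz' formula; the constant pi i disappears with the
  first derivative.\<close>

lemma cot_deriv_0_uhp:
  assumes "\<tau> \<in> uhp"
  shows "cot_deriv 0 \<tau> = pi * \<i> - 2 * pi * \<i> * polylog_neg 0 (nome \<tau>)"
proof -
  let ?q = "nome \<tau>" and ?w = "exp (\<i> * (of_real pi * \<tau>))"
  have q: "norm ?q < 1" using assms by (rule norm_nome_less)
  then have q1: "?q \<noteq> 1" by auto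
  have w: "?q = ?w * ?w" "?w \<noteq> 0"
    by (simp_all add: nome_def exp_add [symmetric] mult_ac)
  have quot: "(a / 2) / (b / (2 * \<i>)) = \<i> * a / b" for a b :: complex
    by (cases "b = 0") (simp_all add: field_simps)
  have "cot (pi * \<tau>) = ((?w + 1 / ?w) / 2) / ((?w - 1 / ?w) / (2 * \<i>))"
    by (simp add: cot_def cos_exp_eq sin_exp_eq exp_minus inverse_eq_divide)
  also have "((?w + 1 / ?w) / 2) / ((?w - 1 / ?w) / (2 * \<i>)) = \<i> * (?w + 1 / ?w) / (?w - 1 / ?w)"
    by (rule quot)
  also have "\<dots> = \<i> * (?q + 1) / (?q - 1)"
    using w q1 by (auto simp: field_simps)
  also have "\<dots> = \<i> * (1 - 2 / (1 - ?q))"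
    using q1 by (simp add: field_simps)
  finally have *: "cot (pi * \<tau>) = \<i> * (1 - 2 / (1 - ?q))" .
  have "polylog_neg 0 ?q = 1 / (1 - ?q)"
    unfolding polylog_neg_def using suminf_geometric[OF q] by simp
  then show ?thesis
    unfolding cot_deriv_0[OF uhp_not_Ints[OF assms]] * by (simp add: algebra_simps)
qed

text \<open>Each derivative in \<tau> contributes a factor 2 pi i and raises the order of the
  series. Differentiating an identity requires it on an open set, so \<tau> stays arbitrary in the
  induction.\<close>

lemma cot_deriv_uhp:
  assumes "\<tau> \<in> uhp"
  shows "cot_deriv (Suc n) \<tau> = - ((2 * pi * \<i>) ^ (n + 2)) * polylog_neg (Suc n) (nome \<tau>)"
  using assms
proof (induction n arbitrary: \<tau>)
  case 0
  have "(cot_deriv 0 has_field_derivative - (2 * pi * \<i>) * (2 * pi * \<i> * polylog_neg 1 (nome \<tau>))) (at \<tau>)"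
  proof (rule has_field_derivative_transform_within_open[OF _ open_uhp 0])
    show "((\<lambda>\<tau>. pi * \<i> - 2 * pi * \<i> * polylog_neg 0 (nome \<tau>)) has_field_derivative
       - (2 * pi * \<i>) * (2 * pi * \<i> * polylog_neg 1 (nome \<tau>))) (at \<tau>)"
      using has_field_derivative_polylog_neg_nome[OF 0, of 0]
      by (auto intro!: derivative_eq_intros)
  qed (simp add: cot_deriv_0_uhp)
  from DERIV_unique[OF this has_field_derivative_cot_deriv[OF uhp_not_Ints[OF 0]]]
  show ?case by (simp add: power2_eq_square algebra_simps)
next
  case (Suc n)
  have "(cot_deriv (Suc n) has_field_derivative
      - ((2 * pi * \<i>) ^ (n + 2)) * (2 * pi * \<i> * polylog_neg (Suc (Suc n)) (nome \<tau>))) (at \<tau>)"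
  proof (rule has_field_derivative_transform_within_open[OF _ open_uhp Suc.prems])
    show "((\<lambda>\<tau>. - ((2 * pi * \<i>) ^ (n + 2)) * polylog_neg (Suc n) (nome \<tau>)) has_field_derivative
       - ((2 * pi * \<i>) ^ (n + 2)) * (2 * pi * \<i> * polylog_neg (Suc (Suc n)) (nome \<tau>))) (at \<tau>)"
      by (rule DERIV_cmult, rule has_field_derivative_polylog_neg_nome[OF Suc.prems])
  qed (simp add: Suc.IH)
  from DERIV_unique[OF this has_field_derivative_cot_deriv[OF uhp_not_Ints[OF Suc.prems]]]
  show ?case by (simp add: algebra_simps)
qed

text \<open>The values at \<open>1/2\<close> come from \<open>cot' = - (1 + cot\<^sup>2)\<close>.\<close>

lemma cot_deriv_polynomials:
  fixes z :: complex
  assumes "z \<notin> \<int>"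
  defines "c \<equiv> cot (pi * z)"
  shows "cot_deriv 3 z = - (of_real pi ^ 4) * (1 + c\<^sup>2) * (2 + 6 * c\<^sup>2)"
    and "cot_deriv 5 z = - (of_real pi ^ 6) * (1 + c\<^sup>2) * (16 + 120 * c ^ 2 + 120 * c ^ 4)"
proof -
  define C where "C = (\<lambda>z::complex. cot (pi * z))"
  have D: "(C has_field_derivative - pi * (1 + (C z)\<^sup>2)) (at z)" if "z \<notin> \<int>" for z
  proof -
    have "sin (pi * z) \<noteq> 0" using that by (rule sin_pi_nonzero)
    then show ?thesis
      unfolding C_def cot_def using sin_cos_squared_add[of "pi * z"]
      by (auto intro!: derivative_eq_intros simp: power2_eq_square divide_simps) algebra
  qed
  have op: "open (- \<int> :: complex set)" by (simp add: closed_Ints open_Compl)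
  have step: "cot_deriv (Suc n) z = f' z"
    if eq: "\<And>z. z \<notin> \<int> \<Longrightarrow> cot_deriv n z = f z" and f: "(f has_field_derivative f' z) (at z)"
      and z: "z \<notin> \<int>" for n f f' z
  proof -
    have "(cot_deriv n has_field_derivative f' z) (at z)"
      by (rule has_field_derivative_transform_within_open[OF f op]) (use z eq in auto)
    from DERIV_unique[OF has_field_derivative_cot_deriv[OF z] this] show ?thesis .
  qed
  note der = derivative_eq_intros D
  have 0: "cot_deriv 0 z = pi * C z" if "z \<notin> \<int>" for z
    using cot_deriv_0[OF that] by (simp add: C_def)
  have 1: "cot_deriv (Suc 0) z = - (of_real pi ^ 2) * (1 + (C z)\<^sup>2)" if "z \<notin> \<int>" for z
    by (rule step[where f = "\<lambda>z. pi * C z", OF 0 _ that])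
      (use that in \<open>auto intro!: der simp: power2_eq_square\<close>)
  have 2: "cot_deriv (Suc (Suc 0)) z = of_real pi ^ 3 * (2 * C z + 2 * C z ^ 3)" if "z \<notin> \<int>" for z
    by (rule step[OF 1 _ that], assumption)
      (use that in \<open>auto intro!: der simp: algebra_simps power2_eq_square power3_eq_cube\<close>)
  have 3: "cot_deriv (Suc (Suc (Suc 0))) z = - (of_real pi ^ 4) * (1 + (C z)\<^sup>2) * (2 + 6 * (C z)\<^sup>2)"
    if "z \<notin> \<int>" for z
    by (rule step[OF 2 _ that], assumption)
      (use that in \<open>auto intro!: der simp: algebra_simps power2_eq_square power3_eq_cube power4_eq_xxxx\<close>)
  have 4: "cot_deriv (Suc (Suc (Suc (Suc 0)))) z = of_real pi ^ 5 * (16 * C z + 40 * C z ^ 3 + 24 * C z ^ 5)"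
    if "z \<notin> \<int>" for z
    by (rule step[OF 3 _ that], assumption)
      (use that in \<open>auto intro!: der simp: algebra_simps eval_nat_numeral\<close>)
  have 5: "cot_deriv (Suc (Suc (Suc (Suc (Suc 0))))) z =
      - (of_real pi ^ 6) * (1 + (C z)\<^sup>2) * (16 + 120 * C z ^ 2 + 120 * C z ^ 4)"
    if "z \<notin> \<int>" for z
    by (rule step[OF 4 _ that], assumption)
      (use that in \<open>auto intro!: der simp: algebra_simps eval_nat_numeral\<close>)
  show "cot_deriv 3 z = - (of_real pi ^ 4) * (1 + c\<^sup>2) * (2 + 6 * c\<^sup>2)"
    and "cot_deriv 5 z = - (of_real pi ^ 6) * (1 + c\<^sup>2) * (16 + 120 * c ^ 2 + 120 * c ^ 4)"
    using 3[OF assms(1)] 5[OF assms(1)] by (simp_all add: C_def c_def eval_nat_numeral)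
qed

text \<open>The reflection z \<mapsto> 1 - z fixes 1/2, so for odd n both polygamma terms of
  \<open>cot_deriv\<close> agree up to the common sign and add. Clearing 2^(n + 1) turns the
  half-integers of the polygamma series into odd integers.\<close>

lemma polygamma_half_sums:
  assumes "odd n"
  shows "(\<lambda>k. 1 / (2 * of_nat k + 1 :: complex) ^ Suc n) sums (- cot_deriv n (1/2) / (2 ^ (n + 2) * fact n))"
proof -
  have n: "n > 0" using assms by (cases n) auto
  have "(\<lambda>k. inverse ((1/2 + of_nat k :: complex) ^ Suc n)) sums ((-1) ^ Suc n * Polygamma n (1/2) / fact n)"
    by (rule Polygamma_LIMSEQ) (use n in auto)
  also have "(-1) ^ Suc n * Polygamma n (1/2 :: complex) / fact n = - cot_deriv n (1/2) / (2 * fact n)"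
    using assms by (simp add: cot_deriv_def field_simps)
  finally have "(\<lambda>k. inverse ((1/2 + of_nat k :: complex) ^ Suc n) / 2 ^ Suc n) sums
       (- cot_deriv n (1/2) / (2 * fact n) / 2 ^ Suc n)"
    by (rule sums_divide)
  moreover have "inverse ((1/2 + of_nat k :: complex) ^ Suc n) / 2 ^ Suc n = 1 / (2 * of_nat k + 1) ^ Suc n" for k
  proof -
    have "(2 * of_nat k + 1 :: complex) = 2 * (1/2 + of_nat k)" by simp
    then show ?thesis by (simp only: power_mult_distrib) (simp add: field_simps)
  qed
  ultimately show ?thesis by (simp add: algebra_simps)
qed

lemma half_not_Ints: "(1/2 :: complex) \<notin> \<int>"
proof
  assume "(1/2 :: complex) \<in> \<int>"
  then obtain m where "(1/2 :: complex) = of_int m" by (auto elim: Ints_cases)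
  then have "of_int (2 * m) = (of_int 1 :: complex)" by (simp add: field_simps)
  then have "2 * m = 1" by (simp only: of_int_eq_iff)
  then show False by presburger
qed

lemma cot_deriv_half:
  "cot_deriv 3 (1/2) = - (2 * of_real pi ^ 4)" "cot_deriv 5 (1/2) = - (16 * of_real pi ^ 6)"
proof -
  have "of_real pi * (1/2 :: complex) = of_real (pi / 2)" by simp
  then have "cot (of_real pi * (1/2 :: complex)) = 0"
    unfolding cot_def by (simp only: cos_of_real sin_of_real) simp
  then show "cot_deriv 3 (1/2) = - (2 * of_real pi ^ 4)" "cot_deriv 5 (1/2) = - (16 * of_real pi ^ 6)"
    using cot_deriv_polynomials[OF half_not_Ints] by simp_all
qed

lemma summable_inverse_powers:
  assumes "k \<ge> 2"
  shows "(\<lambda>n. 1 / (of_nat n :: complex) ^ k) summable_on {0<..}"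
proof -
  have "summable (\<lambda>n. inverse (real n ^ k))"
    using assms by (intro inverse_power_summable) auto
  then have "summable (\<lambda>n. norm (1 / (of_nat n :: complex) ^ k))"
    by (simp add: norm_divide norm_power norm_inverse divide_inverse)
  then have "(\<lambda>n. 1 / (of_nat n :: complex) ^ k) summable_on UNIV"
    by (rule norm_summable_imp_summable_on)
  then show ?thesis by (rule summable_on_subset) auto
qed

text \<open>Splitting \<open>\<zeta> (n + 1)\<close> into odd and even terms expresses it by the values at \<open>1/2\<close>.\<close>

lemma zeta_has_sum:
  assumes "odd n"
  shows "((\<lambda>m. 1 / (of_nat m :: complex) ^ Suc n) has_sum
      (- cot_deriv n (1/2) / (2 * (2 ^ Suc n - 1) * fact n))) {0<..}"
proof -
  let ?f = "\<lambda>m. 1 / (of_nat m :: complex) ^ Suc n" and ?c = "- cot_deriv n (1/2) / (2 ^ (n + 2) * fact n)"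
  have n: "Suc n \<ge> 2" using assms by (cases n) auto
  obtain Z where Z: "(?f has_sum Z) {0<..}"
    using summable_inverse_powers[OF n] by (auto simp: summable_on_def)
  let ?O = "{m::nat. odd m}" and ?E = "{m::nat. even m \<and> m > 0}"
  have U: "?E \<union> ?O = {0<..}" by (auto intro: odd_pos)
  have E: "(?f has_sum (1 / 2 ^ Suc n) * Z) ?E"
  proof -
    have "((\<lambda>m. (1 / 2 ^ Suc n) * ?f m) has_sum (1 / 2 ^ Suc n) * Z) {0<..}"
      by (rule has_sum_cmult_right[OF Z])
    also have "?this \<longleftrightarrow> ?thesis"
      by (rule has_sum_reindex_bij_witness[where i = "\<lambda>m. m div 2" and j = "\<lambda>m. 2 * m"])
        (auto simp: power_mult_distrib)
    finally show ?thesis .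
  qed
  have O: "(?f has_sum ?c) ?O"
  proof -
    have "?f summable_on ?O"
      by (rule summable_on_subset[OF summable_inverse_powers[OF n]]) (auto intro: odd_pos)
    then obtain S where S: "(?f has_sum S) ?O" by (auto simp: summable_on_def)
    also have "?this \<longleftrightarrow> ((\<lambda>k. ?f (2 * k + 1)) has_sum S) UNIV"
      by (rule has_sum_reindex_bij_witness[where j = "\<lambda>m. m div 2" and i = "\<lambda>m. 2 * m + 1"])
        (auto elim!: oddE)
    finally have "(\<lambda>k. ?f (2 * k + 1)) sums S" by (rule has_sum_imp_sums)
    moreover have "(\<lambda>k. ?f (2 * k + 1)) sums ?c"
      using polygamma_half_sums[OF assms] by (simp add: add.commute)
    ultimately have "S = ?c" by (rule sums_unique2)
    with S show ?thesis by simp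
  qed
  have "(?f has_sum ((1 / 2 ^ Suc n) * Z + ?c)) (?E \<union> ?O)"
    by (rule has_sum_Un_disjoint[OF E O]) auto
  then have "Z = (1 / 2 ^ Suc n) * Z + ?c"
    unfolding U using Z has_sum_unique by blast
  moreover have "(2 :: complex) ^ Suc n \<noteq> 1"
  proof -
    have "(2::nat) ^ Suc n \<noteq> 1" by simp
    then have "of_nat (2 ^ Suc n) \<noteq> (of_nat 1 :: complex)" by (simp only: of_nat_eq_iff) simp
    then show ?thesis by simp
  qed
  ultimately have "Z = - cot_deriv n (1/2) / (2 * (2 ^ Suc n - 1) * fact n)"
    by (simp add: field_simps)
  with Z show ?thesis by simp
qed

subsection \<open>Lattice sums\<close>

definition nz_lattice :: "(int \<times> int) set" where
  "nz_lattice = UNIV - {(0, 0)}"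

text \<open>One vector from each pair (m, n), (-m, -n). The row \<open>m = 0\<close> yields the zeta
  value, the rows \<open>m > 0\<close> are subject to Lipschitz' formula.\<close>

definition half_lattice :: "(int \<times> int) set" where
  "half_lattice = {0} \<times> {0<..} \<union> {0<..} \<times> UNIV"

definition lattice_term :: "nat \<Rightarrow> complex \<Rightarrow> int \<times> int \<Rightarrow> complex" where
  "lattice_term k \<tau> = (\<lambda>(m, n). 1 / (of_int m * \<tau> + of_int n) ^ k)"

text \<open>The imaginary part of the lattice point bounds m, and the triangle inequality then
  bounds n; \<delta> is the inverse of the constant obtained by adding both bounds.\<close>

lemma lattice_lower_bound:
  assumes "\<tau> \<in> uhp"
  obtains \<delta> where "\<delta> > 0"
    "\<And>m n. norm (of_int m * \<tau> + of_int n) \<ge> \<delta> * (\<bar>of_int m\<bar> + \<bar>of_int n\<bar>)"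
proof
  let ?y = "Im \<tau>" and ?N = "norm \<tau>"
  have y: "?y > 0" using assms by (simp add: uhp_def)
  define \<delta> where "\<delta> = 1 / (1 + (1 + ?N) / ?y)"
  show "\<delta> > 0" unfolding \<delta>_def using y by (intro divide_pos_pos add_pos_nonneg) auto
  fix m n :: int
  let ?w = "of_int m * \<tau> + of_int n"
  have "\<bar>of_int m\<bar> * ?y = \<bar>Im ?w\<bar>" using y by (simp add: abs_mult)
  also have "\<dots> \<le> norm ?w" by (rule abs_Im_le_cmod)
  finally have m: "\<bar>of_int m\<bar> \<le> norm ?w / ?y" using y by (simp add: field_simps)
  have "\<bar>of_int n\<bar> = norm (?w - of_int m * \<tau>)" by (simp add: norm_of_int)
  also have "\<dots> \<le> norm ?w + \<bar>of_int m\<bar> * ?N"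
    by (rule order_trans[OF norm_triangle_ineq4]) (simp add: norm_mult norm_of_int)
  finally have "\<bar>of_int m\<bar> + \<bar>of_int n\<bar> \<le> norm ?w + \<bar>of_int m\<bar> * (1 + ?N)"
    by (simp add: algebra_simps)
  also have "\<dots> \<le> norm ?w + (norm ?w / ?y) * (1 + ?N)"
    by (intro add_left_mono mult_right_mono m) auto
  also have "\<dots> = norm ?w * (1 + (1 + ?N) / ?y)" by (simp add: algebra_simps)
  finally have "\<bar>of_int m\<bar> + \<bar>of_int n\<bar> \<le> norm ?w * (1 + (1 + ?N) / ?y)" .
  moreover have "1 + (1 + ?N) / ?y > 0" using y by (intro add_pos_nonneg) auto
  ultimately show "\<delta> * (\<bar>of_int m\<bar> + \<bar>of_int n\<bar>) \<le> norm ?w"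
    unfolding \<delta>_def by (simp add: field_simps)
qed

lemma summable_int_inverse_square: "(\<lambda>m::int. 1 / (1 + \<bar>real_of_int m\<bar>)\<^sup>2) summable_on UNIV"
proof -
  let ?f = "\<lambda>m::int. 1 / (1 + \<bar>real_of_int m\<bar>)\<^sup>2"
  have "summable (\<lambda>n. inverse (real (n + 1) ^ 2))"
    using inverse_power_summable[of 2, where 'a = real] summable_ignore_initial_segment by fastforce
  then have "(\<lambda>n. inverse (real (n + 1) ^ 2)) summable_on UNIV"
    by (intro norm_summable_imp_summable_on) simp
  then have N: "(\<lambda>n::nat. ?f (int n)) summable_on UNIV"
    by (simp add: divide_inverse add.commute)
  have A: "?f summable_on {0..}"
    using N by (subst summable_on_reindex_bij_witness[where T = "UNIV :: nat set"
        and i = int and j = nat and h = "\<lambda>n. ?f (int n)"]) auto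
  have B: "?f summable_on {..0}"
    using N by (subst summable_on_reindex_bij_witness[where T = "UNIV :: nat set"
        and i = "\<lambda>n. - int n" and j = "\<lambda>m. nat (- m)" and h = "\<lambda>n. ?f (int n)"]) auto
  have "?f summable_on ({..0} - {0})" by (rule summable_on_subset[OF B]) auto
  from summable_on_Un_disjoint[OF A this] have "?f summable_on ({0..} \<union> ({..0} - {0}))" by force
  also have "{0..} \<union> ({..0} - {0}) = (UNIV :: int set)" by auto
  finally show ?thesis .
qed

text \<open>With s = |m| + |n| \<ge> 1 both 1 + |m| and 1 + |n| are at most 2 s, so decay of order
  s^4 is dominated by a product of two inverse squares. The factor 16 is 2^4, and \<delta> comes
  from the lower bound for lattice points.\<close>

lemma summable_lattice:
  assumes "\<tau> \<in> uhp" "k \<ge> 4"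
  shows "lattice_term k \<tau> summable_on nz_lattice"
proof -
  obtain \<delta> where \<delta>: "\<delta> > 0"
    "\<And>m n. norm (of_int m * \<tau> + of_int n) \<ge> \<delta> * (\<bar>of_int m\<bar> + \<bar>of_int n\<bar>)"
    using lattice_lower_bound[OF assms(1)] by blast
  let ?f = "\<lambda>m::int. 1 / (1 + \<bar>real_of_int m\<bar>)\<^sup>2"
  have "(\<lambda>(m, n). ?f m * ?f n) summable_on (UNIV \<times> UNIV)"
  proof (rule summable_on_SigmaI)
    fix m :: int
    have "(?f has_sum infsum ?f UNIV) UNIV"
      using summable_int_inverse_square by (rule has_sum_infsum)
    from has_sum_cmult_right[OF this, of "?f m"]
    show "((\<lambda>n. case (m, n) of (m, n) \<Rightarrow> ?f m * ?f n) has_sum ?f m * infsum ?f UNIV) UNIV" by simp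
  next
    show "(\<lambda>m. ?f m * infsum ?f UNIV) summable_on UNIV"
      by (rule summable_on_cmult_left[OF summable_int_inverse_square])
  qed auto
  then have "(\<lambda>(m, n). ?f m * ?f n) summable_on nz_lattice" by (rule summable_on_subset) auto
  then have S: "(\<lambda>p. (16 / \<delta> ^ k) * (case p of (m, n) \<Rightarrow> ?f m * ?f n)) summable_on nz_lattice"
    by (rule summable_on_cmult_right)
  show ?thesis
  proof (rule abs_summable_summable, rule Infinite_Sum.abs_summable_on_comparison_test'[OF S])
    fix p :: "int \<times> int" assume p: "p \<in> nz_lattice"
    obtain m n where mn: "p = (m, n)" by force
    define s where "s = \<bar>real_of_int m\<bar> + \<bar>real_of_int n\<bar>"
    have "\<bar>m\<bar> + \<bar>n\<bar> \<ge> 1" using p by (auto simp: mn nz_lattice_def)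
    then have s: "s \<ge> 1" unfolding s_def by linarith
    have "(1 + \<bar>real_of_int m\<bar>) * (1 + \<bar>real_of_int n\<bar>) \<le> (2 * s) * (2 * s)"
      using s by (intro mult_mono) (auto simp: s_def)
    then have "((1 + \<bar>real_of_int m\<bar>) * (1 + \<bar>real_of_int n\<bar>))\<^sup>2 \<le> ((2 * s) * (2 * s))\<^sup>2"
      by (intro power_mono) auto
    also have "\<dots> = 16 * s ^ 4" by (simp add: power2_eq_square power4_eq_xxxx)
    also have "\<dots> \<le> 16 * s ^ k" using s assms(2) by (intro mult_left_mono power_increasing) auto
    finally have *: "((1 + \<bar>real_of_int m\<bar>) * (1 + \<bar>real_of_int n\<bar>))\<^sup>2 \<le> 16 * s ^ k" .
    have "norm (lattice_term k \<tau> p) = 1 / norm (of_int m * \<tau> + of_int n) ^ k"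
      by (simp add: mn lattice_term_def norm_divide norm_power)
    also have "\<dots> \<le> 1 / (\<delta> * s) ^ k"
    proof -
      have *: "\<delta> * s > 0" using s \<delta>(1) by simp
      have "0 < norm (of_int m * \<tau> + of_int n)"
        by (rule less_le_trans[OF * \<delta>(2)[of m n, folded s_def]])
      with * \<delta>(2)[of m n] show ?thesis
        by (intro divide_left_mono power_mono mult_pos_pos[OF zero_less_power zero_less_power])
          (simp_all add: s_def)
    qed
    also have "\<dots> = (16 / \<delta> ^ k) * (1 / (16 * s ^ k))"
      using \<delta>(1) s by (simp add: power_mult_distrib)
    also have "\<dots> \<le> (16 / \<delta> ^ k) * (1 / ((1 + \<bar>real_of_int m\<bar>) * (1 + \<bar>real_of_int n\<bar>))\<^sup>2)"
      using \<delta>(1) s * by (intro mult_left_mono divide_left_mono) (auto intro!: mult_pos_pos zero_less_power)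
    also have "\<dots> = (16 / \<delta> ^ k) * (case p of (m, n) \<Rightarrow> ?f m * ?f n)"
      by (simp add: mn power_mult_distrib)
    finally show "norm (lattice_term k \<tau> p) \<le> (16 / \<delta> ^ k) * (case p of (m, n) \<Rightarrow> ?f m * ?f n)" .
  qed
qed

text \<open>Negation carries the half-lattice onto the remaining half and preserves each term, since
  k is even.\<close>

lemma has_sum_half_lattice:
  assumes "\<tau> \<in> uhp" "k \<ge> 4" "even k" "(lattice_term k \<tau> has_sum S) half_lattice"
  shows "(lattice_term k \<tau> has_sum 2 * S) nz_lattice"
proof -
  let ?neg = "\<lambda>(m::int, n::int). (- m, - n)"
  have "lattice_term k \<tau> (?neg p) = lattice_term k \<tau> p" for p
  proof -
    obtain m n where p: "p = (m, n)" by force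
    have "of_int (- m) * \<tau> + of_int (- n) = - (of_int m * \<tau> + of_int n)" by simp
    then show ?thesis
      by (simp only: p lattice_term_def prod.case power_minus_even[OF assms(3)])
  qed
  then have "(lattice_term k \<tau> has_sum S) half_lattice \<longleftrightarrow> (lattice_term k \<tau> has_sum S) (?neg ` half_lattice)"
    by (intro has_sum_reindex_bij_witness[of _ ?neg ?neg]) auto
  with assms(4) have "(lattice_term k \<tau> has_sum S) (?neg ` half_lattice)" by simp
  from has_sum_Un_disjoint[OF assms(4) this]
  have "(lattice_term k \<tau> has_sum S + S) (half_lattice \<union> ?neg ` half_lattice)"
    by (force simp: half_lattice_def)
  also have "half_lattice \<union> ?neg ` half_lattice = nz_lattice"
  proof (rule Set.set_eqI)
    fix p :: "int \<times> int"
    obtain m n where p: "p = (m, n)" by force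
    have "p \<in> ?neg ` half_lattice \<longleftrightarrow> (- m, - n) \<in> half_lattice"
      by (force simp: p image_iff)
    then show "p \<in> half_lattice \<union> ?neg ` half_lattice \<longleftrightarrow> p \<in> nz_lattice"
      by (auto simp: p half_lattice_def nz_lattice_def)
  qed
  finally show ?thesis by simp
qed

text \<open>Lipschitz' formula. The terms with \<open>m \<ge> 0\<close> and with
  \<open>m < 0\<close> are the polygamma series at \<tau> and at 1 - \<tau>; together they form a
  derivative of the cotangent, whose q-series is known.\<close>

lemma lipschitz_has_sum:
  assumes "\<tau> \<in> uhp" "odd n" "n \<ge> 3"
  shows "((\<lambda>m::int. 1 / (\<tau> + of_int m) ^ Suc n) has_sum
      ((2 * pi * \<i>) ^ Suc n / fact n * polylog_neg n (nome \<tau>))) UNIV"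
proof -
  let ?f = "\<lambda>m::int. 1 / (\<tau> + of_int m) ^ Suc n"
  \<comment> \<open>Absolute convergence is inherited from the row \<open>m = 1\<close> of the
    lattice sum.\<close>
  have "{1::int} \<times> (UNIV :: int set) \<subseteq> nz_lattice" by (auto simp: nz_lattice_def)
  then have "lattice_term (Suc n) \<tau> summable_on {1} \<times> UNIV"
    using summable_on_subset[OF summable_lattice[OF assms(1), of "Suc n"]] assms by auto
  also have "?this \<longleftrightarrow> ?f summable_on UNIV"
    by (rule summable_on_reindex_bij_witness[where j = snd and i = "Pair 1"])
      (auto simp: lattice_term_def)
  finally have sm: "?f summable_on UNIV" .
  have nint: "\<tau> \<notin> \<int>" "1 - \<tau> \<notin> \<int>"
    using uhp_not_Ints[OF assms(1)] one_minus_not_Ints by auto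
  have n0: "n \<noteq> 0" using assms by auto
  let ?A = "(-1) ^ Suc n * Polygamma n \<tau> / fact n" and ?B = "(-1) ^ Suc n * Polygamma n (1 - \<tau>) / fact n"
  have sA: "(\<lambda>k. inverse ((\<tau> + of_nat k) ^ Suc n)) sums ?A"
    by (rule Polygamma_LIMSEQ) (use n0 uhp_nonzero[OF assms(1)] in auto)
  have sB: "(\<lambda>k. inverse ((1 - \<tau> + of_nat k) ^ Suc n)) sums ?B"
    by (rule Polygamma_LIMSEQ) (use n0 nint in auto)
  have hA: "(?f has_sum ?A) {0..}"
  proof -
    have "?f summable_on {0..}" by (rule summable_on_subset[OF sm]) auto
    then obtain S where S: "(?f has_sum S) {0..}" by (auto simp: summable_on_def)
    also have "?this \<longleftrightarrow> ((\<lambda>k. inverse ((\<tau> + of_nat k) ^ Suc n)) has_sum S) UNIV"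
      by (rule has_sum_reindex_bij_witness[where j = nat and i = int]) (auto simp: field_simps)
    finally have "S = ?A" using has_sum_imp_sums sums_unique2 sA by blast
    with S show ?thesis by simp
  qed
  have hB: "(?f has_sum ?B) {..<0}"
  proof -
    have "?f summable_on {..<0}" by (rule summable_on_subset[OF sm]) auto
    then obtain S where S: "(?f has_sum S) {..<0}" by (auto simp: summable_on_def)
    \<comment> \<open>The substitution m = - 1 - k, with k counted from 0, turns \<tau> + m into -
      (1 - \<tau> + k); the sign disappears because \<open>Suc n\<close> is even.\<close>
    have eq: "inverse ((1 - \<tau> + of_nat (nat (- m - 1))) ^ Suc n) = ?f m" if "m \<in> {..<0}" for m
    proof -
      have "1 - \<tau> + of_nat (nat (- m - 1)) = - (\<tau> + of_int m)" using that by auto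
      moreover have "(- (\<tau> + of_int m)) ^ Suc n = (\<tau> + of_int m) ^ Suc n"
        by (rule power_minus_even) (use assms in simp)
      ultimately show ?thesis by (simp only: divide_inverse) simp
    qed
    have "(?f has_sum S) {..<0} \<longleftrightarrow> ((\<lambda>k. inverse ((1 - \<tau> + of_nat k) ^ Suc n)) has_sum S) UNIV"
      by (rule has_sum_reindex_bij_witness[where j = "\<lambda>m. nat (- m - 1)" and i = "\<lambda>k. - int k - 1"])
        (use eq in auto)
    with S have "((\<lambda>k. inverse ((1 - \<tau> + of_nat k) ^ Suc n)) has_sum S) UNIV" by simp
    then have "S = ?B" using has_sum_imp_sums sums_unique2 sB by blast
    with S show ?thesis by simp
  qed
  have "(?f has_sum ?A + ?B) ({0..} \<union> {..<0})"
    by (rule has_sum_Un_disjoint[OF hA hB]) auto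
  moreover have "{0..} \<union> {..<0} = (UNIV :: int set)" by auto
  moreover have "?A + ?B = (2 * pi * \<i>) ^ Suc n / fact n * polylog_neg n (nome \<tau>)"
  proof -
    obtain j where j: "n = Suc j" using n0 by (cases n) auto
    have "?A + ?B = - cot_deriv n \<tau> / fact n"
      using assms(2) by (simp add: cot_deriv_def field_simps)
    also have "\<dots> = (2 * pi * \<i>) ^ Suc n / fact n * polylog_neg n (nome \<tau>)"
      using cot_deriv_uhp[OF assms(1), of j] by (simp add: j)
    finally show ?thesis .
  qed
  ultimately show ?thesis by simp
qed

section \<open>Lambert series and the Fourier expansion of Eisenstein series\<close>

definition divisor_sum :: "nat \<Rightarrow> nat \<Rightarrow> nat" where
  "divisor_sum n m = (\<Sum>d | d dvd m. d ^ n)"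

text \<open>The double series is summed once over \<open>m\<close> and once along the hyperbolas \<open>m r = N\<close>.\<close>

lemma lambert_has_sum:
  fixes q :: complex
  assumes "norm q < 1" "n > 0"
  obtains S where "((\<lambda>m. polylog_neg n (q ^ m)) has_sum S) {0<..}"
    "(\<lambda>N. of_nat (divisor_sum n (Suc N)) * q ^ Suc N) sums S"
proof -
  let ?x = "norm q"
  let ?f = "\<lambda>(m, r). of_nat r ^ n * (q ^ m) ^ r :: complex"
  let ?g = "\<lambda>(m, r). ?x ^ m * (real r ^ n * ?x ^ (r - 1))"
  have ps: "(\<lambda>r. of_nat r ^ n * y ^ r) summable_on UNIV" if "norm y < 1" for y :: complex
  proof (rule norm_summable_imp_summable_on)
    have "norm (of_real (norm y) :: complex) < 1" using that by simp
    from summable_polylog_neg[OF this, of n]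
    have "summable (\<lambda>r. of_real (real r ^ n * norm y ^ r) :: complex)" by simp
    then show "summable (\<lambda>r. norm (of_nat r ^ n * y ^ r))"
      by (subst (asm) summable_of_real_iff) (simp add: norm_mult norm_power)
  qed
  have inner: "((\<lambda>r. of_nat r ^ n * y ^ r) has_sum polylog_neg n y) {0<..}" if "norm y < 1" for y :: complex
  proof -
    from ps[OF that] obtain T where T: "((\<lambda>r. of_nat r ^ n * y ^ r) has_sum T) UNIV"
      by (auto simp: summable_on_def)
    have "T = polylog_neg n y"
      unfolding polylog_neg_def using has_sum_imp_sums[OF T] by (simp add: sums_iff)
    moreover have "((\<lambda>r. of_nat r ^ n * y ^ r) has_sum T) UNIV \<longleftrightarrow>
        ((\<lambda>r. of_nat r ^ n * y ^ r) has_sum T) {0<..}"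
      by (rule has_sum_cong_neutral) (use assms in auto)
    ultimately show ?thesis using T by simp
  qed
  have sumf: "?f summable_on {0<..} \<times> {0<..}"
  proof (rule abs_summable_summable, rule Infinite_Sum.abs_summable_on_comparison_test')
    have s1: "summable (\<lambda>m. ?x ^ m)" using assms by (intro summable_geometric) simp
    have s2: "summable (\<lambda>r. real r ^ n * ?x ^ (r - 1))"
    proof (subst summable_Suc_iff [symmetric])
      have "norm (of_real ?x :: complex) < 1" using assms by simp
      then have "summable (\<lambda>r. diffs (\<lambda>r. of_nat r ^ (n - 1)) r * of_real ?x ^ r :: complex)"
        by (rule termdiff_converges[where K = 1]) (rule summable_polylog_neg)
      moreover have "diffs (\<lambda>r. of_nat r ^ (n - 1)) r * of_real ?x ^ r = complex_of_real (real (Suc r) ^ n * ?x ^ (Suc r - 1))" for r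
        using assms(2) by (cases n) (simp_all add: diffs_def)
      ultimately have "summable (\<lambda>r. complex_of_real (real (Suc r) ^ n * ?x ^ (Suc r - 1)))"
        by (simp only:)
      then show "summable (\<lambda>r. real (Suc r) ^ n * ?x ^ (Suc r - 1))" by (subst (asm) summable_of_real_iff)
    qed
    have "(\<lambda>m. ?x ^ m) summable_on UNIV" "(\<lambda>r. real r ^ n * ?x ^ (r - 1)) summable_on UNIV"
      using s1 s2 by (auto intro!: norm_summable_imp_summable_on simp: abs_mult)
    then have s1: "(\<lambda>m. ?x ^ m) summable_on {0<..}" and s2: "(\<lambda>r. real r ^ n * ?x ^ (r - 1)) summable_on {0<..}"
      by (auto intro: summable_on_subset)
    show "?g summable_on {0<..} \<times> {0<..}"
    proof (rule summable_on_SigmaI)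
      fix m :: nat
      show "((\<lambda>r. ?g (m, r)) has_sum ?x ^ m * infsum (\<lambda>r. real r ^ n * ?x ^ (r - 1)) {0<..}) {0<..}"
        using has_sum_cmult_right[OF has_sum_infsum[OF s2]] by simp
      show "(\<lambda>m. ?x ^ m * infsum (\<lambda>r. real r ^ n * ?x ^ (r - 1)) {0<..}) summable_on {0<..}"
        by (rule summable_on_cmult_left[OF s1])
    qed auto
    fix p :: "nat \<times> nat" assume p: "p \<in> {0<..} \<times> {0<..}"
    obtain m r where mr: "p = (m, r)" by force
    then obtain a b where ab: "m = Suc a" "r = Suc b" using p by (cases m; cases r) auto
    have "norm (?f p) = real r ^ n * ?x ^ (m * r)"
      by (simp add: mr norm_mult norm_power power_mult)
    \<comment> \<open>For m, r \<ge> 1 one has m r \<ge> m + r - 1; this separates the variables,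
      and the double series is dominated by a product of two single ones.\<close>
    also have "\<dots> \<le> real r ^ n * ?x ^ (m + (r - 1))"
      using assms by (intro mult_left_mono power_decreasing) (auto simp: ab)
    also have "\<dots> = ?g p" by (simp add: mr power_add)
    finally show "norm (?f p) \<le> ?g p" .
  qed
  then obtain S where S: "(?f has_sum S) ({0<..} \<times> {0<..})" by (auto simp: summable_on_def)
  have 1: "((\<lambda>m. polylog_neg n (q ^ m)) has_sum S) {0<..}"
  proof (rule has_sum_SigmaD[OF S])
    fix m :: nat assume "m \<in> {0<..}"
    then have "norm (q ^ m) < 1" using assms by (simp add: norm_power power_less_one_iff)
    from inner[OF this] show "((\<lambda>r. ?f (m, r)) has_sum polylog_neg n (q ^ m)) {0<..}" by simp
  qed
  have "(?f has_sum S) ({0<..} \<times> {0<..}) \<longleftrightarrow>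
      ((\<lambda>(N, d). of_nat d ^ n * q ^ N) has_sum S) (SIGMA N:{0<..}. {d. d dvd N})"
    by (rule has_sum_reindex_bij_witness[where j = "\<lambda>(m, r). (m * r, r)" and i = "\<lambda>(N, d). (N div d, d)"])
      (auto simp: power_mult intro: Nat.gr0I dest: dvd_pos_nat simp: dvd_div_eq_0_iff elim!: dvdE)
  with S have S': "((\<lambda>(N, d). of_nat d ^ n * q ^ N) has_sum S) (SIGMA N:{0<..}. {d. d dvd N})" by simp
  have "((\<lambda>N. of_nat (divisor_sum n N) * q ^ N) has_sum S) {0<..}"
  proof (rule has_sum_SigmaD[OF S'])
    fix N :: nat assume "N \<in> {0<..}"
    then have "finite {d. d dvd N}" by simp
    then show "((\<lambda>d. case (N, d) of (N, d) \<Rightarrow> of_nat d ^ n * q ^ N) has_sum of_nat (divisor_sum n N) * q ^ N) {d. d dvd N}"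
      by (simp add: has_sum_finite_iff divisor_sum_def sum_distrib_right)
  qed
  also have "?this \<longleftrightarrow> ((\<lambda>N. of_nat (divisor_sum n (Suc N)) * q ^ Suc N) has_sum S) UNIV"
    by (rule has_sum_reindex_bij_witness[where j = "\<lambda>N. N - 1" and i = Suc]) auto
  finally have "(\<lambda>N. of_nat (divisor_sum n (Suc N)) * q ^ Suc N) sums S" by (rule has_sum_imp_sums)
  with 1 show ?thesis by (rule that)
qed

definition eisenstein_sum :: "nat \<Rightarrow> complex \<Rightarrow> complex" where
  "eisenstein_sum k \<tau> = (\<Sum>\<^sub>\<infinity>p\<in>nz_lattice. lattice_term k \<tau> p)"

text \<open>The lattice spanned by -1/\<tau> and 1 is the lattice of \<tau> divided by \<tau>; a
  quarter turn of the index set rearranges the sum and takes out the factor \<tau>^k.\<close>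

lemma eisenstein_sum_S:
  assumes "\<tau> \<in> uhp"
  shows "eisenstein_sum k (- 1 / \<tau>) = \<tau> ^ k * eisenstein_sum k \<tau>"
proof -
  have t: "\<tau> \<noteq> 0" using uhp_nonzero[OF assms] .
  have "eisenstein_sum k (- 1 / \<tau>) = (\<Sum>\<^sub>\<infinity>p\<in>nz_lattice. \<tau> ^ k * lattice_term k \<tau> p)"
    unfolding eisenstein_sum_def
  proof (rule infsum_reindex_bij_witness[where j = "\<lambda>(m, n). (n, - m)" and i = "\<lambda>(m, n). (- n, m)"])
    fix p :: "int \<times> int" assume "p \<in> nz_lattice"
    obtain m n where p: "p = (m, n)" by force
    have "of_int m * (- 1 / \<tau>) + of_int n = (of_int n * \<tau> - of_int m) / \<tau>"
      using t by (simp add: field_simps)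
    then show "\<tau> ^ k * lattice_term k \<tau> (case p of (m, n) \<Rightarrow> (n, - m)) = lattice_term k (- 1 / \<tau>) p"
      by (simp add: p lattice_term_def power_divide)
  qed (auto simp: nz_lattice_def)
  also have "\<dots> = \<tau> ^ k * eisenstein_sum k \<tau>"
    unfolding eisenstein_sum_def by (rule infsum_cmult_right')
  finally show ?thesis .
qed

text \<open>The row \<open>m = 0\<close> of the half-lattice gives the zeta value, the row
  \<open>m > 0\<close> gives Lipschitz' formula at m \<tau>, and the sum over m is a Lambert series
  in the nome.\<close>

lemma eisenstein_sum_q_expansion:
  assumes "\<tau> \<in> uhp" "odd n" "n \<ge> 3"
  shows "eisenstein_sum (Suc n) \<tau> = 2 * (- cot_deriv n (1/2) / (2 * (2 ^ Suc n - 1) * fact n) +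
    (2 * pi * \<i>) ^ Suc n / fact n * (\<Sum>N. of_nat (divisor_sum n (Suc N)) * nome \<tau> ^ Suc N))"
proof -
  let ?Z = "- cot_deriv n (1/2) / (2 * (2 ^ Suc n - 1) * fact n) :: complex"
  let ?c = "(2 * pi * \<i>) ^ Suc n / fact n :: complex"
  let ?L = "lattice_term (Suc n) \<tau>"
  obtain S where S: "((\<lambda>m. polylog_neg n (nome \<tau> ^ m)) has_sum S) {0<..}"
    "(\<lambda>N. of_nat (divisor_sum n (Suc N)) * nome \<tau> ^ Suc N) sums S"
    using lambert_has_sum[OF norm_nome_less[OF assms(1)], of n] assms by auto
  have A: "(?L has_sum ?Z) ({0} \<times> {0<..})"
  proof -
    have "(?L has_sum ?Z) ({0} \<times> {0<..}) \<longleftrightarrow>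
       ((\<lambda>m. 1 / (of_nat m :: complex) ^ Suc n) has_sum ?Z) {0<..}"
      by (rule has_sum_reindex_bij_witness[where j = "\<lambda>p. nat (snd p)" and i = "\<lambda>m. (0, int m)"])
        (auto simp: lattice_term_def)
    then show ?thesis using zeta_has_sum[OF assms(2)] by simp
  qed
  have B: "(?L has_sum ?c * S) ({0<..} \<times> UNIV)"
  proof -
    have "?L summable_on {0<..} \<times> UNIV"
      by (rule summable_on_subset[OF summable_lattice[OF assms(1), of "Suc n"]])
        (use assms in \<open>auto simp: nz_lattice_def\<close>)
    then obtain T where T: "(?L has_sum T) ({0<..} \<times> UNIV)" by (auto simp: summable_on_def)
    have "((\<lambda>m. ?c * polylog_neg n (nome \<tau> ^ nat m)) has_sum T) {0<..}"
    proof (rule has_sum_SigmaD[OF T])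
      fix m :: int assume m: "m \<in> {0<..}"
      then have "of_nat (nat m) * \<tau> \<in> uhp" by (intro uhp_of_nat_mult[OF assms(1)]) auto
      from lipschitz_has_sum[OF this assms(2,3)] m
      show "((\<lambda>y. ?L (m, y)) has_sum ?c * polylog_neg n (nome \<tau> ^ nat m)) UNIV"
        by (simp add: nome_power lattice_term_def)
    qed
    also have "?this \<longleftrightarrow> ((\<lambda>m. ?c * polylog_neg n (nome \<tau> ^ m)) has_sum T) {0<..}"
      by (rule has_sum_reindex_bij_witness[where j = nat and i = int]) auto
    finally have "T = ?c * S" using has_sum_cmult_right[OF S(1)] has_sum_unique by blast
    with T show ?thesis by simp
  qed
  have "(?L has_sum (?Z + ?c * S)) half_lattice"
    unfolding half_lattice_def by (rule has_sum_Un_disjoint[OF A B]) auto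
  from has_sum_half_lattice[OF assms(1) _ _ this]
  have "(?L has_sum 2 * (?Z + ?c * S)) nz_lattice" using assms by simp
  then show ?thesis unfolding eisenstein_sum_def using S(2) by (simp add: infsumI sums_iff)
qed

text \<open>The factor is 2 zeta(4) = pi^4 / 45, and the coefficient 240 arises as 2 (2 pi)^4 / 3!
  divided by it.\<close>

lemma E4_eq_eisenstein_sum:
  assumes "\<tau> \<in> uhp"
  shows "eisenstein_sum 4 \<tau> = of_real pi ^ 4 / 45 * E4 \<tau>"
proof -
  define S where "S = (\<Sum>N. of_nat (divisor_sum 3 (Suc N)) * nome \<tau> ^ Suc N)"
  have E: "E4 \<tau> = 1 + 240 * S" by (simp only: E4_def S_def divisor_sum_def nome_def)
  have "eisenstein_sum (Suc 3) \<tau> = of_real pi ^ 4 / 45 * E4 \<tau>"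
    unfolding E using eisenstein_sum_q_expansion[OF assms, of 3, folded S_def]
    by (simp add: cot_deriv_half fact_numeral power_mult_distrib) (simp add: field_simps)
  then show ?thesis by simp
qed

text \<open>Here 2 zeta(6) = 2 pi^6 / 945, and -504 is 2 (2 pi i)^6 / 5! divided by it.\<close>

lemma E6_eq_eisenstein_sum:
  assumes "\<tau> \<in> uhp"
  shows "eisenstein_sum 6 \<tau> = 2 * of_real pi ^ 6 / 945 * E6 \<tau>"
proof -
  define S where "S = (\<Sum>N. of_nat (divisor_sum 5 (Suc N)) * nome \<tau> ^ Suc N)"
  have E: "E6 \<tau> = 1 - 504 * S" by (simp only: E6_def S_def divisor_sum_def nome_def)
  have "eisenstein_sum (Suc 5) \<tau> = 2 * of_real pi ^ 6 / 945 * E6 \<tau>"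
    unfolding E using eisenstein_sum_q_expansion[OF assms, of 5, folded S_def]
    by (simp add: cot_deriv_half fact_numeral power_mult_distrib) (simp add: field_simps)
  then show ?thesis by simp
qed

lemma E4_S: "\<tau> \<in> uhp \<Longrightarrow> E4 (- 1 / \<tau>) = \<tau> ^ 4 * E4 \<tau>"
  using eisenstein_sum_S[of \<tau> 4] E4_eq_eisenstein_sum[of \<tau>]
    E4_eq_eisenstein_sum[OF uhp_minus_inverse, of \<tau>] by simp

lemma E6_S: "\<tau> \<in> uhp \<Longrightarrow> E6 (- 1 / \<tau>) = \<tau> ^ 6 * E6 \<tau>"
  using eisenstein_sum_S[of \<tau> 6] E6_eq_eisenstein_sum[of \<tau>]
    E6_eq_eisenstein_sum[OF uhp_minus_inverse, of \<tau>] by simp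

subsection \<open>The modular group\<close>

definition mat2 :: "int \<Rightarrow> int \<Rightarrow> int \<Rightarrow> int \<Rightarrow> int^2^2" where
  "mat2 a b c d = vector [vector [a, b], vector [c, d]]"

lemma mat2_nth [simp]:
  "mat2 a b c d $ 1 $ 1 = a" "mat2 a b c d $ 1 $ 2 = b"
  "mat2 a b c d $ 2 $ 1 = c" "mat2 a b c d $ 2 $ 2 = d"
  by (simp_all add: mat2_def)

lemma mat2_collapse: "mat2 (A $ 1 $ 1) (A $ 1 $ 2) (A $ 2 $ 1) (A $ 2 $ 2) = A"
  by (simp add: vec_eq_iff forall_2)

lemma mat2_mult:
  "mat2 a b c d ** mat2 a' b' c' d' =
    mat2 (a * a' + b * c') (a * b' + b * d') (c * a' + d * c') (c * b' + d * d')"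
  by (simp add: vec_eq_iff forall_2 matrix_matrix_mult_def sum_2)

lemma mat2_uminus: "- mat2 a b c d = mat2 (- a) (- b) (- c) (- d)"
  by (simp add: vec_eq_iff forall_2)

lemma S_mat_mat2: "S_mat = mat2 0 (- 1) 1 0" and T_mat_mat2: "T_mat = mat2 1 1 0 1"
  by (simp_all add: S_mat_def T_mat_def mat2_def)

lemma mat_1_mat2: "mat 1 = mat2 1 0 0 1"
  by (simp add: vec_eq_iff forall_2 mat_def)

lemma mat2_in_SL2Z: "mat2 a b c d \<in> carrier SL2Z \<longleftrightarrow> a * d - b * c = 1"
  by (simp add: SL2Z_def det_2)

lemma SL2Z_mult_closed: "A \<in> carrier SL2Z \<Longrightarrow> B \<in> carrier SL2Z \<Longrightarrow> A ** B \<in> carrier SL2Z"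
  by (simp add: SL2Z_def det_mul)

lemma SL2Z_generators:
  "mat 1 \<in> carrier SL2Z" "- mat 1 \<in> carrier SL2Z" "S_mat \<in> carrier SL2Z" "T_mat \<in> carrier SL2Z"
  by (simp_all add: mat_1_mat2 mat2_uminus S_mat_mat2 T_mat_mat2 mat2_in_SL2Z)

lemma S_mat_square: "S_mat ** S_mat = - mat 1"
  by (simp add: mat_1_mat2 mat2_uminus S_mat_mat2 mat2_mult)

lemma S_T_cube: "(S_mat ** T_mat) ** (S_mat ** T_mat) ** (S_mat ** T_mat) = - mat 1"
  by (simp add: mat_1_mat2 mat2_uminus S_mat_mat2 T_mat_mat2 mat2_mult)

text \<open>\<open>S\<close> and \<open>T\<close> generate already as a monoid, since \<open>T\<^sup>-\<^sup>1 = S\<^sup>3TSTS\<close>.\<close>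

lemma SL2Z_induct [consumes 1, case_names one S T]:
  assumes "\<gamma> \<in> carrier SL2Z" and one: "P (mat 1)"
    and S: "\<And>\<gamma>. \<gamma> \<in> carrier SL2Z \<Longrightarrow> P \<gamma> \<Longrightarrow> P (S_mat ** \<gamma>)"
    and T: "\<And>\<gamma>. \<gamma> \<in> carrier SL2Z \<Longrightarrow> P \<gamma> \<Longrightarrow> P (T_mat ** \<gamma>)"
  shows "P \<gamma>"
proof -
  define Q where "Q = (\<lambda>a b c d. a * d - b * c = 1 \<and> P (mat2 a b c d))"
  have QS: "Q (- c) (- d) a b" if "Q a b c d" for a b c d
    using that S[of "mat2 a b c d"] by (simp add: Q_def mat2_in_SL2Z S_mat_mat2 mat2_mult algebra_simps)
  have QT: "Q (a + c) (b + d) c d" if "Q a b c d" for a b c d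
    using that T[of "mat2 a b c d"] by (simp add: Q_def mat2_in_SL2Z T_mat_mat2 mat2_mult algebra_simps)
  have Qneg: "Q (- a) (- b) (- c) (- d)" if "Q a b c d" for a b c d
    using QS[OF QS[OF that]] by simp
  have QT': "Q (a - c) (b - d) c d" if "Q a b c d" for a b c d
    using Qneg[OF QS[OF QT[OF QS[OF QT[OF QS[OF that]]]]]] by simp
  have QTn: "Q (a + n * c) (b + n * d) c d" if "Q a b c d" for a b c d n
  proof (induction n rule: int_induct[where k = 0])
    case base
    then show ?case using that by simp
  next
    case (step1 i)
    from QT[OF step1(2)] show ?case by (simp add: algebra_simps)
  next
    case (step2 i)
    from QT'[OF step2(2)] show ?case by (simp add: algebra_simps)
  qed
  have "Q a b c d" if "a * d - b * c = 1" for a b c d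
    using that
  proof (induction "nat \<bar>c\<bar>" arbitrary: a b c d rule: less_induct)
    case less
    have Q1: "Q 1 n 0 1" for n
      using QTn[of 1 0 0 1 n] one by (simp add: Q_def mat_1_mat2)
    show ?case
    proof (cases "c = 0")
      case True
      then have "a * d = 1" using less.prems by simp
      then consider "a = 1" "d = 1" | "a = - 1" "d = - 1" by (auto simp: zmult_eq_1_iff)
      then show ?thesis
      proof cases
        case 1
        then show ?thesis using Q1[of b] True by simp
      next
        case 2
        then show ?thesis using Qneg[OF Q1[of "- b"]] True by simp
      qed
    next
      case False
      \<comment> \<open>Euclid's algorithm on the first column: a power of T reduces
        \<open>a\<close> to its residue \<open>r\<close>, and S moves \<open>r\<close> to the lower
        left corner, where the induction on |c| applies.\<close>
      define r k where "r = a mod c" and "k = a div c"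
      have a: "a = r + k * c" by (simp add: r_def k_def)
      have "\<bar>r\<bar> < \<bar>c\<bar>" unfolding r_def using False by (rule abs_mod_less)
      then have "Q c d (- r) (- (b - k * d))"
        using less.prems by (intro less.hyps) (auto simp: a algebra_simps)
      from QTn[OF QS[OF this], of k] show ?thesis by (simp add: a)
    qed
  qed
  moreover have "\<gamma>$1$1 * \<gamma>$2$2 - \<gamma>$1$2 * \<gamma>$2$1 = 1"
    using assms(1) by (simp add: SL2Z_def det_2)
  ultimately have "P (mat2 (\<gamma>$1$1) (\<gamma>$1$2) (\<gamma>$2$1) (\<gamma>$2$2))" unfolding Q_def by blast
  then show ?thesis by (simp add: mat2_collapse)
qed

section \<open>The action on the upper half-plane\<close>

definition mob :: "int^2^2 \<Rightarrow> complex \<Rightarrow> complex" where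
  "mob \<gamma> \<tau> = (of_int (\<gamma>$1$1) * \<tau> + of_int (\<gamma>$1$2)) / (of_int (\<gamma>$2$1) * \<tau> + of_int (\<gamma>$2$2))"

definition jac :: "int^2^2 \<Rightarrow> complex \<Rightarrow> complex" where
  "jac \<gamma> \<tau> = of_int (\<gamma>$2$1) * \<tau> + of_int (\<gamma>$2$2)"

lemma lattice_point_nonzero:
  assumes "\<tau> \<in> uhp" "(c, d) \<noteq> (0, 0)"
  shows "of_int c * \<tau> + of_int d \<noteq> 0"
proof
  assume 0: "of_int c * \<tau> + of_int d = 0"
  then have "Im (of_int c * \<tau> + of_int d) = 0" by simp
  then have "c = 0" using assms(1) by (simp add: uhp_def)
  with 0 assms(2) show False by simp
qed

lemma jac_nonzero: "\<gamma> \<in> carrier SL2Z \<Longrightarrow> \<tau> \<in> uhp \<Longrightarrow> jac \<gamma> \<tau> \<noteq> 0"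
  unfolding jac_def by (rule lattice_point_nonzero) (auto simp: SL2Z_def det_2)

lemma Im_mob:
  assumes "\<gamma> \<in> carrier SL2Z"
  shows "Im (mob \<gamma> \<tau>) = Im \<tau> / (norm (jac \<gamma> \<tau>))\<^sup>2"
proof -
  have "real_of_int (\<gamma>$1$1 * \<gamma>$2$2 - \<gamma>$1$2 * \<gamma>$2$1) = 1"
    using assms by (simp add: SL2Z_def det_2)
  then have "real_of_int (\<gamma>$1$1) * of_int (\<gamma>$2$2) - of_int (\<gamma>$1$2) * of_int (\<gamma>$2$1) = 1" by simp
  then have "Im (of_int (\<gamma>$1$1) * \<tau> + of_int (\<gamma>$1$2)) * Re (jac \<gamma> \<tau>) -
        Re (of_int (\<gamma>$1$1) * \<tau> + of_int (\<gamma>$1$2)) * Im (jac \<gamma> \<tau>) = Im \<tau>"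
    by (simp add: jac_def) algebra
  then show ?thesis
    unfolding mob_def jac_def[symmetric] by (simp add: Im_divide cmod_power2)
qed

lemma mob_uhp: "\<gamma> \<in> carrier SL2Z \<Longrightarrow> \<tau> \<in> uhp \<Longrightarrow> mob \<gamma> \<tau> \<in> uhp"
  using jac_nonzero[of \<gamma> \<tau>] by (auto simp: uhp_def Im_mob)

lemma jac_mult:
  assumes "\<delta> \<in> carrier SL2Z" "\<tau> \<in> uhp"
  shows "jac (\<gamma> ** \<delta>) \<tau> = jac \<gamma> (mob \<delta> \<tau>) * jac \<delta> \<tau>"
proof -
  have "jac \<delta> \<tau> \<noteq> 0" using assms by (rule jac_nonzero)
  then show ?thesis
    unfolding mob_def jac_def[of \<delta>, symmetric]
    by (simp add: jac_def[of \<gamma>] jac_def[of "\<gamma> ** \<delta>"] matrix_matrix_mult_def sum_2 field_simps)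
      (simp add: jac_def algebra_simps)
qed

lemma mob_mult:
  assumes "\<gamma> \<in> carrier SL2Z" "\<delta> \<in> carrier SL2Z" "\<tau> \<in> uhp"
  shows "mob (\<gamma> ** \<delta>) \<tau> = mob \<gamma> (mob \<delta> \<tau>)"
proof -
  let ?n = "\<lambda>\<gamma> \<tau>. of_int (\<gamma>$1$1) * \<tau> + of_int (\<gamma>$1$2) :: complex"
  have nz: "jac \<delta> \<tau> \<noteq> 0" "jac \<gamma> (mob \<delta> \<tau>) \<noteq> 0"
    using assms mob_uhp jac_nonzero by blast+
  have "?n (\<gamma> ** \<delta>) \<tau> = ?n \<gamma> (mob \<delta> \<tau>) * jac \<delta> \<tau>"
    using nz(1) unfolding mob_def jac_def[of \<delta>, symmetric]
    by (simp add: matrix_matrix_mult_def sum_2 field_simps) (simp add: jac_def algebra_simps)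
  then show ?thesis
    using nz jac_mult[OF assms(2,3), of \<gamma>]
    unfolding mob_def[of "\<gamma> ** \<delta>"] mob_def[of \<gamma>] jac_def[symmetric] by simp
qed

lemma mob_generators:
  "mob (mat 1) \<tau> = \<tau>" "mob (- mat 1) \<tau> = \<tau>" "mob S_mat \<tau> = - 1 / \<tau>" "mob T_mat \<tau> = \<tau> + 1"
  by (simp_all add: mob_def mat_1_mat2 mat2_uminus S_mat_mat2 T_mat_mat2)

lemma jac_generators:
  "jac (mat 1) \<tau> = 1" "jac (- mat 1) \<tau> = - 1" "jac S_mat \<tau> = \<tau>" "jac T_mat \<tau> = 1"
  by (simp_all add: jac_def mat_1_mat2 mat2_uminus S_mat_mat2 T_mat_mat2)

text \<open>The representative is read off a shortest vector \<open>c \<tau> + d\<close> of the lattice \<open>\<int> \<tau> + \<int>\<close>.\<close>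

lemma orbit_representative:
  assumes "\<tau> \<in> uhp"
  obtains \<gamma> where "\<gamma> \<in> carrier SL2Z" "(Im (mob \<gamma> \<tau>))\<^sup>2 \<ge> 3 / 4"
proof -
  obtain \<delta> where \<delta>: "\<delta> > 0"
    "\<And>m n. norm (of_int m * \<tau> + of_int n) \<ge> \<delta> * (\<bar>of_int m\<bar> + \<bar>of_int n\<bar>)"
    using lattice_lower_bound[OF assms] by blast
  define N where "N = (\<lambda>(c, d). norm (of_int c * \<tau> + of_int d))"
  define F where "F = {p \<in> nz_lattice. N p \<le> 1}"
  define K where "K = \<lceil>1 / \<delta>\<rceil>"
  have "F \<subseteq> {- K..K} \<times> {- K..K}"
  proof
    fix p assume p: "p \<in> F"
    obtain c d where cd: "p = (c, d)" by force
    have "\<delta> * (\<bar>of_int c\<bar> + \<bar>of_int d\<bar>) \<le> 1"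
      using p \<delta>(2)[of c d] by (auto simp: F_def N_def cd)
    then have "\<bar>of_int c\<bar> + \<bar>of_int d\<bar> \<le> 1 / \<delta>" using \<delta>(1) by (simp add: field_simps)
    also have "\<dots> \<le> of_int K" unfolding K_def by (rule le_of_int_ceiling)
    finally have "\<bar>c\<bar> + \<bar>d\<bar> \<le> K" by linarith
    then show "p \<in> {- K..K} \<times> {- K..K}" by (auto simp: cd)
  qed
  then have "finite F" by (rule finite_subset) simp
  moreover have "(0, 1) \<in> F" by (simp add: F_def N_def nz_lattice_def)
  ultimately obtain p where p: "p \<in> F" "\<And>p'. p' \<in> F \<Longrightarrow> N p \<le> N p'"
    using arg_min_if_finite[of F N] by (metis (no_types, lifting) empty_iff not_le_imp_less)
  have min: "N p \<le> N p'" if "p' \<in> nz_lattice" for p'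
    using p that by (cases "p' \<in> F") (auto simp: F_def)
  obtain c d where cd: "p = (c, d)" by force
  have nz: "(c, d) \<noteq> (0, 0)" using p by (auto simp: F_def cd nz_lattice_def)
  \<comment> \<open>A shortest vector is primitive, since dividing by the gcd would shorten it; it
    can therefore be completed to the bottom row of a matrix of determinant 1.\<close>
  define g where "g = gcd c d"
  have g: "g > 0" using nz by (auto simp: g_def)
  obtain c' d' where c': "c = g * c'" "d = g * d'" by (metis g_def gcd_dvd1 gcd_dvd2 dvdE)
  have "N (c', d') \<ge> N (c, d)" using min[of "(c', d')"] nz by (auto simp: cd nz_lattice_def c')
  moreover have "N (c, d) = of_int g * N (c', d')"
  proof -
    have "of_int c * \<tau> + of_int d = of_int g * (of_int c' * \<tau> + of_int d')" by (simp add: c' algebra_simps)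
    then show ?thesis using g by (simp add: N_def norm_mult)
  qed
  moreover have "N (c', d') > 0"
    using lattice_point_nonzero[OF assms, of c' d'] nz by (auto simp: N_def c')
  ultimately have "of_int g \<le> (1::real)" by simp
  then have "g = 1" using g by linarith
  then have "gcd c d = 1" by (simp add: g_def)
  then obtain u v where uv: "u * c + v * d = 1" using bezout_int[of c d] by auto
  define \<gamma> where "\<gamma> = mat2 v (- u) c d"
  have \<gamma>: "\<gamma> \<in> carrier SL2Z" using uv by (simp add: \<gamma>_def mat2_in_SL2Z)
  define z where "z = mob \<gamma> \<tau>"
  \<comment> \<open>Multiplying z - n by the shortest vector gives another nonzero lattice vector,
    so |z - n| \<ge> 1, while the real part of z - n is at most 1/2 in absolute value. This leaves
    3/4 for the square of the imaginary part.\<close>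
  define n where "n = round (Re z)"
  have j: "jac \<gamma> \<tau> \<noteq> 0" using \<gamma> assms by (rule jac_nonzero)
  have "z * jac \<gamma> \<tau> = of_int v * \<tau> + of_int (- u)"
    using j unfolding z_def mob_def jac_def by (simp add: \<gamma>_def)
  then have "(z - of_int n) * jac \<gamma> \<tau> = of_int (v - n * c) * \<tau> + of_int (- u - n * d)"
    by (simp add: \<gamma>_def jac_def algebra_simps)
  moreover have "(v - n * c, - u - n * d) \<in> nz_lattice"
  proof -
    have "(v - n * c) * d - (- u - n * d) * c = 1" using uv by (simp add: algebra_simps)
    then show ?thesis by (auto simp: nz_lattice_def)
  qed
  ultimately have "norm ((z - of_int n) * jac \<gamma> \<tau>) \<ge> norm (jac \<gamma> \<tau>)"
    using min[of "(v - n * c, - u - n * d)"] by (simp add: cd N_def jac_def \<gamma>_def)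
  then have "norm (z - of_int n) \<ge> 1" using j by (simp add: norm_mult)
  then have "(norm (z - of_int n))\<^sup>2 \<ge> 1" by simp
  then have "1 \<le> (Re z - of_int n)\<^sup>2 + (Im z)\<^sup>2" by (simp add: cmod_power2)
  moreover have "(Re z - of_int n)\<^sup>2 \<le> (1/2)\<^sup>2"
    unfolding n_def using of_int_round_abs_le[of "Re z"]
    by (intro abs_le_square_iff[THEN iffD1]) (simp add: abs_minus_commute)
  ultimately have "(Im z)\<^sup>2 \<ge> 3 / 4" by (simp add: power2_eq_square)
  with \<gamma> show ?thesis unfolding z_def by (rule that)
qed

subsection \<open>Scalar modular forms for the even powers of \<open>\<chi>\<close>\<close>

text \<open>The branch of q^(x/6) on the half-plane; exponents are counted in sixths, as in
  \<open>lam\<close>.\<close>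

definition qpow :: "int \<Rightarrow> complex \<Rightarrow> complex" where
  "qpow x \<tau> = exp (2 * pi * \<i> * (of_int x * \<tau> / 6))"

lemma qpow_nonzero [simp]: "qpow x \<tau> \<noteq> 0"
  by (simp add: qpow_def)

lemma qpow_0 [simp]: "qpow 0 \<tau> = 1"
  by (simp add: qpow_def)

lemma qpow_add: "qpow (x + y) \<tau> = qpow x \<tau> * qpow y \<tau>"
  by (simp add: qpow_def exp_add [symmetric] algebra_simps add_divide_distrib)

lemma qpow_6: "qpow (6 * int n) \<tau> = nome \<tau> ^ n"
  unfolding nome_power by (simp add: qpow_def nome_def)

lemma lam_add: "lam (x + y) = lam x * lam y"
  by (simp add: lam_def exp_add [symmetric] algebra_simps add_divide_distrib)

lemma lam_0 [simp]: "lam 0 = 1"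
  by (simp add: lam_def)

lemma lam_nonzero [simp]: "lam x \<noteq> 0"
  by (simp add: lam_def)

lemma nome_plus_1: "nome (\<tau> + 1) = nome \<tau>"
  by (simp add: nome_def distrib_left exp_add)

lemma qpow_plus_1: "qpow x (\<tau> + 1) = lam x * qpow x \<tau>"
  by (simp add: qpow_def lam_def exp_add [symmetric] algebra_simps add_divide_distrib)

lemma has_field_derivative_qpow:
  "(qpow x has_field_derivative 2 * pi * \<i> * (of_int x / 6) * qpow x \<tau>) (at \<tau>)"
  unfolding qpow_def [abs_def] by (auto intro!: derivative_eq_intros simp: mult_ac)

lemma holomorphic_qpow: "qpow x holomorphic_on A"
  unfolding qpow_def [abs_def] by (auto intro!: holomorphic_intros)

lemma nome_in_ball: "\<tau> \<in> uhp \<Longrightarrow> nome \<tau> \<in> ball 0 1"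
  using norm_nome_less by simp

lemma holomorphic_compose_nome:
  assumes "g holomorphic_on ball 0 1"
  shows "(\<lambda>\<tau>. g (nome \<tau>)) holomorphic_on uhp"
proof -
  have "nome holomorphic_on uhp" unfolding nome_def [abs_def] by (intro holomorphic_intros)
  then have "(g \<circ> nome) holomorphic_on uhp"
    by (rule holomorphic_on_compose_gen[OF _ assms]) (use nome_in_ball in auto)
  then show ?thesis by (simp add: o_def)
qed

lemma nome_surj:
  assumes "q \<in> ball 0 1" "q \<noteq> 0"
  obtains \<tau> where "\<tau> \<in> uhp" "nome \<tau> = q"
proof
  let ?t = "Ln q / (2 * pi * \<i>)"
  show "nome ?t = q" using assms by (simp add: nome_def)
  have "Im ?t = - ln (norm q) / (2 * pi)"
    using assms by (simp add: Im_divide Re_Ln power2_eq_square field_simps)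
  moreover have "ln (norm q) < 0" using assms by simp
  ultimately show "?t \<in> uhp" by (simp add: uhp_def divide_neg_pos)
qed

text \<open>Holomorphy of \<open>g\<close> on the full disc encodes both the behaviour under \<tau>
  \<mapsto> \<tau> + 1 and holomorphy at the cusp. The function \<open>g\<close> remains visible
  because its value at 0 decides whether a factor q can be divided off.\<close>

definition q_expansion :: "int \<Rightarrow> (complex \<Rightarrow> complex) \<Rightarrow> (complex \<Rightarrow> complex) \<Rightarrow> bool" where
  "q_expansion x f g \<longleftrightarrow> g holomorphic_on ball 0 1 \<and> (\<forall>\<tau>\<in>uhp. f \<tau> = qpow x \<tau> * g (nome \<tau>))"

text \<open>Holomorphic forms of weight \<open>k\<close> for the character with \<open>T \<mapsto> exp (2 \<pi> \<i> x / 6)\<close> and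
  \<open>S \<mapsto> (- 1)\<^sup>x\<close>. The leading exponent \<open>x / 6\<close> is not reduced modulo 1: negative \<open>x\<close> allow a
  pole at the cusp, and \<open>x \<ge> 6\<close> forces a zero.\<close>

definition modular :: "int \<Rightarrow> int \<Rightarrow> (complex \<Rightarrow> complex) \<Rightarrow> bool" where
  "modular x k f \<longleftrightarrow> (\<exists>g. q_expansion x f g) \<and>
     (\<forall>\<tau>\<in>uhp. f (- 1 / \<tau>) = (- 1) powi x * \<tau> powi k * f \<tau>)"

lemma modularI:
  "q_expansion x f g \<Longrightarrow> (\<And>\<tau>. \<tau> \<in> uhp \<Longrightarrow> f (- 1 / \<tau>) = (- 1) powi x * \<tau> powi k * f \<tau>) \<Longrightarrow> modular x k f"
  by (auto simp: modular_def)

lemma modular_S: "modular x k f \<Longrightarrow> \<tau> \<in> uhp \<Longrightarrow> f (- 1 / \<tau>) = (- 1) powi x * \<tau> powi k * f \<tau>"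
  by (auto simp: modular_def)

lemma q_expansion_holomorphic: "q_expansion x f g \<Longrightarrow> f holomorphic_on uhp"
proof -
  assume "q_expansion x f g"
  then have g: "g holomorphic_on ball 0 1" and f: "\<And>\<tau>. \<tau> \<in> uhp \<Longrightarrow> f \<tau> = qpow x \<tau> * g (nome \<tau>)"
    by (auto simp: q_expansion_def)
  have "(\<lambda>\<tau>. qpow x \<tau> * g (nome \<tau>)) holomorphic_on uhp"
    by (intro holomorphic_intros holomorphic_qpow holomorphic_compose_nome g)
  then show ?thesis by (rule holomorphic_transform) (use f in auto)
qed

lemma uhp_plus_1: "\<tau> \<in> uhp \<Longrightarrow> \<tau> + 1 \<in> uhp"
  by (simp add: uhp_def)

lemma q_expansion_T: "q_expansion x f g \<Longrightarrow> \<tau> \<in> uhp \<Longrightarrow> f (\<tau> + 1) = lam x * f \<tau>"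
  by (simp add: q_expansion_def uhp_plus_1 qpow_plus_1 nome_plus_1)

lemma modular_T: "modular x k f \<Longrightarrow> \<tau> \<in> uhp \<Longrightarrow> f (\<tau> + 1) = lam x * f \<tau>"
  unfolding modular_def using q_expansion_T by blast

lemma q_expansion_cong: "q_expansion x f g \<Longrightarrow> (\<And>\<tau>. \<tau> \<in> uhp \<Longrightarrow> f' \<tau> = f \<tau>) \<Longrightarrow> q_expansion x f' g"
  by (simp add: q_expansion_def)

lemma modular_cong:
  assumes "modular x k f" "\<And>\<tau>. \<tau> \<in> uhp \<Longrightarrow> f' \<tau> = f \<tau>"
  shows "modular x k f'"
  using assms uhp_minus_inverse q_expansion_cong[of x f _ f'] unfolding modular_def by auto

lemma q_expansion_mult:
  "q_expansion x f g \<Longrightarrow> q_expansion y f' g' \<Longrightarrow> q_expansion (x + y) (\<lambda>\<tau>. f \<tau> * f' \<tau>) (\<lambda>q. g q * g' q)"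
  by (auto simp: q_expansion_def qpow_add intro!: holomorphic_intros)

lemma q_expansion_add:
  "q_expansion x f g \<Longrightarrow> q_expansion x f' g' \<Longrightarrow> q_expansion x (\<lambda>\<tau>. f \<tau> + f' \<tau>) (\<lambda>q. g q + g' q)"
  by (auto simp: q_expansion_def algebra_simps intro!: holomorphic_intros)

lemma q_expansion_cmult:
  "q_expansion x f g \<Longrightarrow> q_expansion x (\<lambda>\<tau>. c * f \<tau>) (\<lambda>q. c * g q)"
  by (auto simp: q_expansion_def intro!: holomorphic_intros)

lemma q_expansion_const: "q_expansion 0 (\<lambda>\<tau>. c) (\<lambda>q. c)"
  by (auto simp: q_expansion_def)

lemma q_expansion_zero: "q_expansion x (\<lambda>\<tau>. 0) (\<lambda>q. 0)"
  by (auto simp: q_expansion_def)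

lemma modular_mult:
  assumes "modular x k f" "modular y l g"
  shows "modular (x + y) (k + l) (\<lambda>\<tau>. f \<tau> * g \<tau>)"
  unfolding modular_def
proof (intro conjI ballI)
  show "\<exists>G. q_expansion (x + y) (\<lambda>\<tau>. f \<tau> * g \<tau>) G"
    using assms q_expansion_mult unfolding modular_def by blast
  fix \<tau> assume t: "\<tau> \<in> uhp"
  then show "f (- 1 / \<tau>) * g (- 1 / \<tau>) = (- 1) powi (x + y) * \<tau> powi (k + l) * (f \<tau> * g \<tau>)"
    unfolding modular_S[OF assms(1) t] modular_S[OF assms(2) t]
    using uhp_nonzero[OF t] by (simp add: power_int_add)
qed

lemma modular_add:
  assumes "modular x k f" "modular x k g"
  shows "modular x k (\<lambda>\<tau>. f \<tau> + g \<tau>)"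
  using assms q_expansion_add unfolding modular_def by (fastforce simp: algebra_simps)

lemma modular_cmult: "modular x k f \<Longrightarrow> modular x k (\<lambda>\<tau>. c * f \<tau>)"
  using q_expansion_cmult unfolding modular_def by (fastforce simp: algebra_simps)

lemma modular_const: "modular 0 0 (\<lambda>\<tau>. c)"
  using q_expansion_const unfolding modular_def by auto

lemma modular_zero: "modular x k (\<lambda>\<tau>. 0)"
  using q_expansion_zero unfolding modular_def by auto

lemma modular_power: "modular x k f \<Longrightarrow> modular (int n * x) (int n * k) (\<lambda>\<tau>. f \<tau> ^ n)"
proof (induction n)
  case 0
  then show ?case using modular_const[of 1] by simp
next
  case (Suc n)
  from modular_mult[OF Suc.prems Suc.IH[OF Suc.prems]] show ?case by (simp add: algebra_simps)
qed

lemma minus_one_powi_6: "(- 1 :: complex) powi (x + 6 * y) = (- 1) powi x"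
  by (simp add: power_int_add power_int_mult)

text \<open>Six units of x amount to one factor q, which moves between the prefactor and the power
  series. The converse direction asks for a zero of \<open>g\<close> at 0.\<close>

lemma q_expansion_shift:
  assumes "q_expansion (x + 6 * int n) f g"
  shows "q_expansion x f (\<lambda>q. q ^ n * g q)"
  using assms by (auto simp: q_expansion_def qpow_add qpow_6 intro!: holomorphic_intros)

lemma modular_shift:
  assumes "modular (x + 6 * int n) k f"
  shows "modular x k f"
  using assms q_expansion_shift unfolding modular_def by (force simp: minus_one_powi_6)

lemma holomorphic_divide_q:
  assumes "g holomorphic_on ball 0 1" "g 0 = 0"
  obtains g' where "g' holomorphic_on ball 0 1" "\<And>q. q \<in> ball 0 1 \<Longrightarrow> g q = q * g' q"
proof
  let ?g = "\<lambda>z. if z = 0 then deriv g 0 else g z / z"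
  show "?g holomorphic_on ball 0 1"
    by (rule pole_theorem_open_0[where g = g and a = 0]) (use assms in auto)
  show "g q = q * ?g q" if "q \<in> ball 0 1" for q
    using assms by auto
qed

lemma q_expansion_unshift:
  assumes "q_expansion x f g" "g 0 = 0"
  obtains g' where "q_expansion (x + 6) f g'"
proof -
  obtain g' where g': "g' holomorphic_on ball 0 1" "\<And>q. q \<in> ball 0 1 \<Longrightarrow> g q = q * g' q"
    using holomorphic_divide_q assms by (auto simp: q_expansion_def)
  have "q_expansion (x + 6) f g'"
    using assms(1) g' nome_in_ball qpow_6[of 1]
    by (auto simp: q_expansion_def qpow_add)
  then show ?thesis by (rule that)
qed

lemma modular_unshift:
  assumes "modular x k f" "q_expansion x f g" "g 0 = 0"
  shows "modular (x + 6) k f"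
proof -
  obtain g' where "q_expansion (x + 6) f g'" using q_expansion_unshift[OF assms(2,3)] .
  then show ?thesis
    by (rule modularI) (use modular_S[OF assms(1)] minus_one_powi_6[of x 1] in simp)
qed

text \<open>The nome maps onto the punctured disc, so the two series agree there, and at 0 by
  continuity.\<close>

lemma q_expansion_unique:
  assumes "q_expansion x f g" "q_expansion x f g'"
  shows "g 0 = g' 0"
proof -
  let ?h = "\<lambda>q. g q - g' q"
  have "?h q = 0" if "q \<in> ball 0 1 - {0}" for q
  proof -
    obtain \<tau> where "\<tau> \<in> uhp" "nome \<tau> = q" using nome_surj \<open>q \<in> ball 0 1 - {0}\<close> by blast
    then show ?thesis using assms by (auto simp: q_expansion_def)
  qed
  moreover have "continuous_on (ball 0 1) ?h"
    using assms by (auto simp: q_expansion_def intro!: holomorphic_on_imp_continuous_on holomorphic_intros)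
  then have "isCont ?h 0" by (rule continuous_on_interior) simp
  then have "(?h \<longlongrightarrow> ?h 0) (at 0)" by (simp add: isCont_def)
  moreover have "eventually (\<lambda>q::complex. q \<in> ball 0 1 - {0}) (at 0)"
    by (rule eventually_at_in_open) auto
  ultimately have "((\<lambda>q. 0) \<longlongrightarrow> ?h 0) (at (0::complex))"
    by (elim Lim_transform_eventually) (auto elim: eventually_mono)
  from LIM_const_eq[OF this] show ?thesis by simp
qed

text \<open>The multiplier of a general matrix is left unidentified: modulus 1 is what the maximum
  principle asks for.\<close>

lemma modular_mob:
  assumes "modular x k f" "\<gamma> \<in> carrier SL2Z"
  obtains c where "norm c = 1" "\<And>\<tau>. \<tau> \<in> uhp \<Longrightarrow> f (mob \<gamma> \<tau>) = c * jac \<gamma> \<tau> powi k * f \<tau>"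
proof -
  have "\<exists>c. norm c = 1 \<and> (\<forall>\<tau>\<in>uhp. f (mob \<gamma> \<tau>) = c * jac \<gamma> \<tau> powi k * f \<tau>)"
    using assms(2)
  proof (induction \<gamma> rule: SL2Z_induct)
    case one
    show ?case by (intro exI[of _ 1]) (simp add: mob_generators jac_generators)
  next
    case (S \<gamma>)
    then obtain c where c: "norm c = 1" "\<And>\<tau>. \<tau> \<in> uhp \<Longrightarrow> f (mob \<gamma> \<tau>) = c * jac \<gamma> \<tau> powi k * f \<tau>"
      by blast
    show ?case
    proof (intro exI[of _ "(- 1) powi x * c"] conjI ballI)
      show "norm ((- 1) powi x * c) = 1" using c by (simp add: norm_mult norm_power_int)
      fix \<tau> assume t: "\<tau> \<in> uhp"
      show "f (mob (S_mat ** \<gamma>) \<tau>) = (- 1) powi x * c * jac (S_mat ** \<gamma>) \<tau> powi k * f \<tau>"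
        using modular_S[OF assms(1) mob_uhp[OF S(1) t]] c(2)[OF t]
        by (simp add: mob_mult[OF SL2Z_generators(3) S(1) t] jac_mult[OF S(1) t] mob_generators
            jac_generators power_int_mult_distrib)
    qed
  next
    case (T \<gamma>)
    then obtain c where c: "norm c = 1" "\<And>\<tau>. \<tau> \<in> uhp \<Longrightarrow> f (mob \<gamma> \<tau>) = c * jac \<gamma> \<tau> powi k * f \<tau>"
      by blast
    show ?case
    proof (intro exI[of _ "lam x * c"] conjI ballI)
      show "norm (lam x * c) = 1" using c by (simp add: norm_mult lam_def)
      fix \<tau> assume t: "\<tau> \<in> uhp"
      show "f (mob (T_mat ** \<gamma>) \<tau>) = lam x * c * jac (T_mat ** \<gamma>) \<tau> powi k * f \<tau>"
        using modular_T[OF assms(1) mob_uhp[OF T(1) t]] c(2)[OF t]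
        by (simp add: mob_mult[OF SL2Z_generators(4) T(1) t] jac_mult[OF T(1) t] mob_generators jac_generators)
    qed
  qed
  then show ?thesis using that by blast
qed

text \<open>Rational estimates: sqrt 3 / 2 > 433/500 and pi > 157/50 give 2 pi y \<ge> 27/5 = 20 *
  27/100, and the 20th power of the quadratic Taylor polynomial of exp at 27/100 exceeds
  200.\<close>

lemma exp_lower_bound: "exp (- 2 * pi * y) \<le> 1 / 200" if "y\<^sup>2 \<ge> 3 / 4" "y > 0" for y :: real
proof -
  have "y \<ge> 433 / 500"
  proof (rule ccontr)
    assume "\<not> ?thesis"
    then have "y\<^sup>2 \<le> (433 / 500)\<^sup>2" using that by (intro power_mono) auto
    with that show False by (simp add: power2_eq_square)
  qed
  moreover have "pi \<ge> 157 / 50" using pi_approx by simp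
  ultimately have "(157 / 50) * (433 / 500) \<le> pi * y" by (intro mult_mono) auto
  then have *: "2 * pi * y \<ge> 27 / 5" by simp
  have "(1 + 27 / 100 + (27 / 100)\<^sup>2 / 2) ^ 20 \<le> exp (27 / 100 :: real) ^ 20"
    by (intro power_mono exp_lower_Taylor_quadratic) auto
  also have "\<dots> = exp (27 / 5)" by (simp add: exp_of_nat_mult [symmetric])
  also have "\<dots> \<le> exp (2 * pi * y)" using * by simp
  finally have "200 \<le> exp (2 * pi * y)" by (rule order_trans[rotated]) (simp add: power2_eq_square power_divide)
  then have "1 / exp (2 * pi * y) \<le> 1 / 200" by (intro divide_left_mono) auto
  then show ?thesis by (simp add: exp_minus inverse_eq_divide)
qed

text \<open>This compact disc in q stands in for the fundamental domain, both in the maximum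
  principle and in the proof that the discriminant has no zero.\<close>

lemma orbit_small_nome:
  assumes "\<tau> \<in> uhp"
  obtains \<gamma> where "\<gamma> \<in> carrier SL2Z" "norm (nome (mob \<gamma> \<tau>)) \<le> 1 / 200"
proof -
  obtain \<gamma> where \<gamma>: "\<gamma> \<in> carrier SL2Z" "(Im (mob \<gamma> \<tau>))\<^sup>2 \<ge> 3 / 4"
    using orbit_representative[OF assms] .
  have "Im (mob \<gamma> \<tau>) > 0" using mob_uhp[OF \<gamma>(1) assms] by (simp add: uhp_def)
  then have "norm (nome (mob \<gamma> \<tau>)) \<le> 1 / 200"
    unfolding norm_nome using exp_lower_bound[OF \<gamma>(2)] by simp
  with \<gamma>(1) show ?thesis by (rule that)
qed

text \<open>On the compact disc of radius 1/200, which contains the cusp q = 0, |g| attains a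
  maximum. Invariance of |f| along orbits extends this bound to the whole unit disc, so the maximum
  is an interior one.\<close>

lemma modular_weight_0_constant:
  assumes "modular 0 0 f" "q_expansion 0 f g"
  shows "g constant_on ball 0 1"
proof -
  have g: "g holomorphic_on ball 0 1" and fg: "\<And>\<tau>. \<tau> \<in> uhp \<Longrightarrow> f \<tau> = g (nome \<tau>)"
    using assms(2) by (auto simp: q_expansion_def)
  let ?K = "cball 0 (1/200) :: complex set"
  have K: "?K \<subseteq> ball 0 1" by auto
  have "continuous_on ?K (\<lambda>q. norm (g q))"
    by (intro continuous_intros holomorphic_on_imp_continuous_on holomorphic_on_subset[OF g K])
  then obtain p where p: "p \<in> ?K" "\<And>q. q \<in> ?K \<Longrightarrow> norm (g q) \<le> norm (g p)"
    using continuous_attains_sup[of ?K "\<lambda>q. norm (g q)"] by auto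
  have "norm (g q) \<le> norm (g p)" if q: "q \<in> ball 0 1" for q
  proof (cases "q = 0")
    case True
    then show ?thesis by (intro p) simp
  next
    case False
    then obtain \<tau> where \<tau>: "\<tau> \<in> uhp" "nome \<tau> = q" using nome_surj q by blast
    obtain \<gamma> where \<gamma>: "\<gamma> \<in> carrier SL2Z" "norm (nome (mob \<gamma> \<tau>)) \<le> 1 / 200"
      using orbit_small_nome[OF \<tau>(1)] .
    obtain c where c: "norm c = 1" "\<And>\<tau>. \<tau> \<in> uhp \<Longrightarrow> f (mob \<gamma> \<tau>) = c * jac \<gamma> \<tau> powi 0 * f \<tau>"
      using modular_mob[OF assms(1) \<gamma>(1)] by blast
    have "norm (g q) = norm (f \<tau>)" using fg \<tau> by simp
    also have "\<dots> = norm (f (mob \<gamma> \<tau>))" using c \<tau> by (simp add: norm_mult)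
    also have "\<dots> = norm (g (nome (mob \<gamma> \<tau>)))" using fg mob_uhp[OF \<gamma>(1) \<tau>(1)] by simp
    also have "\<dots> \<le> norm (g p)" using \<gamma>(2) by (intro p) simp
    finally show ?thesis .
  qed
  then show ?thesis
    by (intro maximum_modulus_principle[OF g, of "ball 0 1" p]) (use p K in auto)
qed

subsection \<open>The discriminant and its sixth root\<close>

lemma sigma_le: "divisor_sum n m \<le> m ^ Suc n"
proof (cases "m = 0")
  case True
  then show ?thesis by (simp add: divisor_sum_def)
next
  case False
  have "divisor_sum n m \<le> (\<Sum>d\<in>{1..m}. d ^ n)"
    unfolding divisor_sum_def using False by (intro sum_mono2) (auto intro: dvd_imp_le Suc_leI dvd_pos_nat)
  also have "\<dots> \<le> (\<Sum>d\<in>{1..m}. m ^ n)" by (intro sum_mono power_mono) auto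
  finally show ?thesis by simp
qed

text \<open>One factor q has been removed from the divisor series, so that the value at 0 is 1 and
  the discriminant divided by q is a polynomial in q and two such series.\<close>

definition sigma_series :: "nat \<Rightarrow> complex \<Rightarrow> complex" where
  "sigma_series n q = (\<Sum>N. of_nat (divisor_sum n (Suc N)) * q ^ N)"

lemma summable_sigma_series:
  fixes q :: complex
  assumes "norm q < 1" "n > 0"
  shows "summable (\<lambda>N. of_nat (divisor_sum n (Suc N)) * q ^ N)"
proof (cases "q = 0")
  case True
  then show ?thesis by (intro summable_finite[of "{0}"]) auto
next
  case False
  obtain S where "(\<lambda>N. of_nat (divisor_sum n (Suc N)) * q ^ Suc N) sums S"
    using lambert_has_sum[OF assms] by blast
  then have "summable (\<lambda>N. of_nat (divisor_sum n (Suc N)) * q ^ Suc N * inverse q)"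
    using summable_mult2 sums_summable by blast
  then show ?thesis using False by (simp add: field_simps)
qed

lemma holomorphic_sigma_series:
  assumes "n > 0"
  shows "sigma_series n holomorphic_on ball 0 1"
proof (subst holomorphic_on_open, simp, intro ballI)
  fix q :: complex assume "q \<in> ball 0 1"
  then have "norm q < 1" by simp
  from termdiffs_strong'[where K = 1, OF summable_sigma_series this] assms
  show "\<exists>f'. (sigma_series n has_field_derivative f') (at q)"
    unfolding sigma_series_def [abs_def] by blast
qed

lemma sigma_series_eq:
  assumes "norm q < 1" "n > 0"
  shows "(\<Sum>N. of_nat (divisor_sum n (Suc N)) * q ^ Suc N) = q * sigma_series n q"
  unfolding sigma_series_def
  using suminf_mult[OF summable_sigma_series[OF assms], of q] by (simp add: mult_ac)

lemma E4_q_expansion: "q_expansion 0 E4 (\<lambda>q. 1 + 240 * (q * sigma_series 3 q))"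
  unfolding q_expansion_def
  by (auto intro!: holomorphic_intros holomorphic_sigma_series
      simp: E4_def sigma_series_eq[symmetric] norm_nome_less)
    (simp add: divisor_sum_def nome_def)

lemma E6_q_expansion: "q_expansion 0 E6 (\<lambda>q. 1 - 504 * (q * sigma_series 5 q))"
  unfolding q_expansion_def
  by (auto intro!: holomorphic_intros holomorphic_sigma_series
      simp: E6_def sigma_series_eq[symmetric] norm_nome_less)
    (simp add: divisor_sum_def nome_def)

lemma modular_E4: "modular 0 4 E4"
  using E4_q_expansion by (rule modularI) (use E4_S in simp)

lemma modular_E6: "modular 0 6 E6"
  using E6_q_expansion by (rule modularI) (use E6_S in simp)

definition Discr :: "complex \<Rightarrow> complex" where
  "Discr \<tau> = (E4 \<tau> ^ 3 - E6 \<tau> ^ 2) / 1728"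

text \<open>The discriminant divided by q: (1 + 240 q P)^3 - (1 - 504 q Q)^2 is expanded, the
  constants 1 cancel, and one factor q is removed. Thus 720 = 3 * 240, 172800 = 3 * 240^2, 13824000
  = 240^3, 1008 = 2 * 504 and 254016 = 504^2.\<close>

definition discr_unit :: "complex \<Rightarrow> complex" where
  "discr_unit q = (let P = sigma_series 3 q; Q = sigma_series 5 q in
     (720 * P + 172800 * q * P\<^sup>2 + 13824000 * q\<^sup>2 * P ^ 3 + 1008 * Q - 254016 * q * Q\<^sup>2) / 1728)"

lemma sigma_series_0: "sigma_series n 0 = 1"
proof -
  have "sigma_series n 0 = of_nat (divisor_sum n (Suc 0))"
    unfolding sigma_series_def by (subst suminf_finite[of "{0}"]) auto
  then show ?thesis by (simp add: divisor_sum_def)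
qed

lemma discr_unit_0: "discr_unit 0 = 1"
  by (simp add: discr_unit_def sigma_series_0 Let_def)

lemma holomorphic_discr_unit: "discr_unit holomorphic_on ball 0 1"
  unfolding discr_unit_def Let_def
  by (auto intro!: holomorphic_intros holomorphic_sigma_series)

lemma Discr_q_expansion: "q_expansion 6 Discr discr_unit"
  unfolding q_expansion_def
proof (intro conjI ballI holomorphic_discr_unit)
  fix \<tau> assume "\<tau> \<in> uhp"
  then have E: "E4 \<tau> = 1 + 240 * (nome \<tau> * sigma_series 3 (nome \<tau>))"
      "E6 \<tau> = 1 - 504 * (nome \<tau> * sigma_series 5 (nome \<tau>))"
    using E4_q_expansion E6_q_expansion by (auto simp: q_expansion_def)
  have "qpow 6 \<tau> = nome \<tau>" using qpow_6[of 1] by simp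
  moreover have "((1 + 240 * (q * P)) ^ 3 - (1 - 504 * (q * Q))\<^sup>2) / 1728 =
      q * ((720 * P + 172800 * q * P\<^sup>2 + 13824000 * q\<^sup>2 * P ^ 3 + 1008 * Q - 254016 * q * Q\<^sup>2) / 1728)"
    for q P Q :: complex
    by (simp add: field_simps power2_eq_square power3_eq_cube)
  ultimately show "Discr \<tau> = qpow 6 \<tau> * discr_unit (nome \<tau>)"
    unfolding Discr_def E discr_unit_def Let_def by simp
qed

lemma modular_Discr: "modular 6 12 Discr"
  using Discr_q_expansion
proof (rule modularI)
  fix \<tau> assume "\<tau> \<in> uhp"
  then show "Discr (- 1 / \<tau>) = (- 1) powi 6 * \<tau> powi 12 * Discr \<tau>"
    unfolding Discr_def by (simp only: E4_S E6_S) (simp add: power_mult_distrib field_simps flip: power_mult)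
qed

text \<open>Since the divisor sum of m is at most m^(n + 1), the growth hypothesis bounds the
  coefficients from the third on by 3^(n + 1) c^N, and on the small disc the tail is dominated by a
  geometric series of ratio c / 200 < 1.\<close>

lemma sigma_series_tail_bound:
  assumes "norm q \<le> 1 / 200" "n > 0" "\<And>N. real (N + 3) ^ Suc n \<le> 3 ^ Suc n * c ^ N" "1 \<le> c" "c \<le> 6"
  shows "\<exists>a. sigma_series n q = 1 + of_nat (divisor_sum n 2) * q + q\<^sup>2 * a \<and> norm a \<le> 3 ^ Suc n / (1 - c / 200)"
proof (intro exI conjI)
  let ?s = "\<lambda>N. of_nat (divisor_sum n (Suc N)) * q ^ N"
  let ?t = "\<lambda>N. of_nat (divisor_sum n (N + 3)) * q ^ N"
  let ?a = "\<Sum>N. ?t N"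
  let ?g = "\<lambda>N. 3 ^ Suc n * (c / 200) ^ N"
  have q1: "norm q < 1" using assms(1) by simp
  have le: "norm (?t N) \<le> ?g N" for N
  proof -
    have "real (divisor_sum n (N + 3)) \<le> real ((N + 3) ^ Suc n)" by (rule of_nat_mono[OF sigma_le])
    also have "\<dots> \<le> 3 ^ Suc n * c ^ N" using assms(3)[of N] by simp
    finally have "real (divisor_sum n (N + 3)) * norm q ^ N \<le> (3 ^ Suc n * c ^ N) * (1 / 200) ^ N"
      using assms(1,4) by (intro mult_mono power_mono) auto
    then show ?thesis by (simp add: norm_mult norm_power power_divide)
  qed
  have "(\<lambda>N. (c / 200) ^ N) sums (1 / (1 - c / 200))"
    using assms(4,5) by (intro geometric_sums) auto
  then have gs: "?g sums (3 ^ Suc n / (1 - c / 200))" using sums_mult by fastforce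
  have st: "summable ?t" by (rule summable_comparison_test'[OF sums_summable[OF gs]]) (use le in auto)
  have "norm ?a \<le> (\<Sum>N. ?g N)"
    using suminf_le[OF le] summable_comparison_test'[OF sums_summable[OF gs], of 0 "\<lambda>N. norm (?t N)"]
    by (intro order_trans[OF summable_norm] suminf_le sums_summable[OF gs]) (use le in auto)
  then show "norm ?a \<le> 3 ^ Suc n / (1 - c / 200)" using gs by (simp add: sums_iff)
  have "sigma_series n q = (\<Sum>N. ?s (N + 2)) + (\<Sum>N<2. ?s N)"
    unfolding sigma_series_def by (rule suminf_split_initial_segment[OF summable_sigma_series[OF q1 assms(2)]])
  also have "(\<Sum>N. ?s (N + 2)) = (\<Sum>N. q\<^sup>2 * ?t N)"
    by (intro suminf_cong) (simp add: power_add eval_nat_numeral mult_ac)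
  also have "\<dots> = q\<^sup>2 * ?a" by (rule suminf_mult[OF st])
  also have "(\<Sum>N<2. ?s N) = 1 + of_nat (divisor_sum n 2) * q"
    by (simp add: eval_nat_numeral) (simp add: divisor_sum_def)
  finally show "sigma_series n q = 1 + of_nat (divisor_sum n 2) * q + q\<^sup>2 * ?a" by simp
qed

lemma sigma_two: "divisor_sum n 2 = 1 + 2 ^ n"
proof -
  have "{d::nat. d dvd 2} = {1, 2}"
    using prime_nat_iff two_is_prime_nat by auto
  then show ?thesis by (simp add: divisor_sum_def)
qed

text \<open>The ratio (N + 4) / (N + 3) of consecutive bases is largest at N = 0, where it is 4/3;
  the hypothesis compares its k-th power with c.\<close>

lemma shifted_power_growth:
  assumes "4 ^ k \<le> 3 ^ k * (c :: real)"
  shows "real (N + 3) ^ k \<le> 3 ^ k * c ^ N"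
proof (induction N)
  case (Suc N)
  have "0 \<le> 3 ^ k * c" using assms by (rule order_trans[rotated]) simp
  then have c: "c \<ge> 0" using zero_less_power[of "3 :: real" k] unfolding zero_le_mult_iff by linarith
  have "3 * real (Suc N + 3) \<le> 4 * real (N + 3)" by simp
  then have "(3 * real (Suc N + 3)) ^ k \<le> (4 * real (N + 3)) ^ k" by (intro power_mono) auto
  also have "\<dots> \<le> (3 ^ k * c) * real (N + 3) ^ k"
    unfolding power_mult_distrib by (intro mult_right_mono assms) auto
  also have "\<dots> \<le> (3 ^ k * c) * (3 ^ k * c ^ N)" using c by (intro mult_left_mono Suc.IH) auto
  finally show ?case unfolding power_mult_distrib[of 3] by (simp add: mult_ac)
qed simp

text \<open>On this disc the linear term \<open>- 24 q\<close> of \<open>discr_unit q - 1\<close> dominates; the point is that it is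
  left after cancellations between the much larger coefficients of the five summands.\<close>

lemma discr_unit_nonzero_small:
  assumes q: "norm q \<le> 1 / 200"
  shows "discr_unit q \<noteq> 0"
proof
  assume 0: "discr_unit q = 0"
  \<comment> \<open>9 = 1 + 2^3 and 33 = 1 + 2^5 are the second coefficients. The growth rates 4 and
    6 satisfy 4^4 \<le> 3^4 * 4 and 4^6 \<le> 3^6 * 6; the resulting tail bounds 81 / 0.98 and 729 /
    0.97 are rounded up to 83 and 756.\<close>
  obtain a where a: "sigma_series 3 q = 1 + 9 * q + q\<^sup>2 * a" "norm a \<le> 83"
  proof -
    have "real (N + 3) ^ Suc 3 \<le> 3 ^ Suc 3 * 4 ^ N" for N by (rule shifted_power_growth) simp
    from sigma_series_tail_bound[OF q _ this] show ?thesis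
      by (auto simp: sigma_two intro: that)
  qed
  obtain b where b: "sigma_series 5 q = 1 + 33 * q + q\<^sup>2 * b" "norm b \<le> 756"
  proof -
    have "real (N + 3) ^ Suc 5 \<le> 3 ^ Suc 5 * 6 ^ N" for N by (rule shifted_power_growth) simp
    from sigma_series_tail_bound[OF q _ this] show ?thesis
      by (auto simp: sigma_two intro: that)
  qed
  have q2: "norm (q\<^sup>2) \<le> 1 / 40000"
    using power_mono[OF q, of 2] by (simp add: norm_mult power2_eq_square)
  define u where "u = 9 * q + q\<^sup>2 * a"
  define v where "v = 33 * q + q\<^sup>2 * b"
  have "norm (q\<^sup>2 * a) \<le> 1 / 40000 * 83" unfolding norm_mult by (intro mult_mono q2 a) auto
  then have u: "norm u \<le> 48 / 1000"
    unfolding u_def using q by (intro order_trans[OF norm_triangle_ineq]) (simp add: norm_mult)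
  have "norm (q\<^sup>2 * b) \<le> 1 / 40000 * 756" unfolding norm_mult by (intro mult_mono q2 b) auto
  then have v: "norm v \<le> 184 / 1000"
    unfolding v_def using q by (intro order_trans[OF norm_triangle_ineq]) (simp add: norm_mult)
  have u1: "norm (2 + u) \<le> 2048 / 1000" "norm (1 + u) \<le> 1048 / 1000"
    using u by (intro order_trans[OF norm_triangle_ineq]; simp)+
  have v1: "norm (2 + v) \<le> 2184 / 1000"
    using v by (intro order_trans[OF norm_triangle_ineq]; simp)
  have t1: "norm (41472 * q) \<le> 208" using q by (simp add: norm_mult)
  have t2: "norm (720 * q\<^sup>2 * a) \<le> 2"
    using mult_mono[OF q2 a(2)] by (simp add: norm_mult mult_ac)
  have t3: "norm (172800 * q * (u * (2 + u))) \<le> 86"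
  proof -
    have "norm (q * (u * (2 + u))) \<le> 1 / 200 * (48 / 1000 * (2048 / 1000))"
      unfolding norm_mult by (intro mult_mono q u u1) auto
    then show ?thesis by (simp add: norm_mult)
  qed
  have t4: "norm (13824000 * q\<^sup>2 * (1 + u) ^ 3) \<le> 400"
  proof -
    have "norm (q\<^sup>2 * (1 + u) ^ 3) \<le> 1 / 40000 * (1048 / 1000) ^ 3"
      unfolding norm_mult norm_power[of "1 + u"] by (intro mult_mono q2 power_mono u1) auto
    then have "13824000 * norm (q\<^sup>2 * (1 + u) ^ 3) \<le> 400" by (simp add: power3_eq_cube del: norm_mult)
    then show ?thesis by (simp add: norm_mult mult.assoc)
  qed
  have t5: "norm (1008 * q\<^sup>2 * b) \<le> 20"
    using mult_mono[OF q2 b(2)] by (simp add: norm_mult mult_ac)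
  have t6: "norm (254016 * q * (v * (2 + v))) \<le> 512"
  proof -
    have "norm (q * (v * (2 + v))) \<le> 1 / 200 * (184 / 1000 * (2184 / 1000))"
      unfolding norm_mult by (intro mult_mono q v v1) auto
    then show ?thesis by (simp add: norm_mult)
  qed
  \<comment> \<open>At a zero the constant 720 + 1008 = 1728 is balanced by the other terms. The
    linear ones combine to 720 * 9 + 1008 * 33 + 172800 - 254016 = - 24 * 1728 = - 41472, and the
    six bounds add up to only 1228.\<close>
  have "1728 = 41472 * q - 720 * q\<^sup>2 * a - 172800 * q * (u * (2 + u)) - 13824000 * q\<^sup>2 * (1 + u) ^ 3
      - 1008 * q\<^sup>2 * b + 254016 * q * (v * (2 + v))" (is "_ = ?rhs")
  proof -
    have "720 * P + 172800 * q * P\<^sup>2 + 13824000 * q\<^sup>2 * P ^ 3 + 1008 * Q - 254016 * q * Q\<^sup>2 = 1728 - ?rhs"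
      if "P = 1 + 9 * q + q\<^sup>2 * a" "Q = 1 + 33 * q + q\<^sup>2 * b" for P Q
    proof -
      have "P = 1 + u" "Q = 1 + v" using that by (simp_all add: u_def v_def)
      then have "720 * P + 172800 * q * P\<^sup>2 + 13824000 * q\<^sup>2 * P ^ 3 + 1008 * Q - 254016 * q * Q\<^sup>2 =
        720 * (1 + u) + 1008 * (1 + v) - 81216 * q + 172800 * q * (u * (2 + u)) +
        13824000 * q\<^sup>2 * (1 + u) ^ 3 - 254016 * q * (v * (2 + v))"
        by (simp add: algebra_simps power2_eq_square)
      also have "720 * (1 + u) + 1008 * (1 + v) - 81216 * q =
          1728 - 41472 * q + 720 * q\<^sup>2 * a + 1008 * q\<^sup>2 * b"
        by (simp add: u_def v_def algebra_simps)
      finally show ?thesis by (simp add: algebra_simps)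
    qed
    from this[OF a(1) b(1)] 0 show ?thesis by (simp add: discr_unit_def Let_def)
  qed
  then have "norm (1728 :: complex) = norm ?rhs" by (rule arg_cong)
  also have "\<dots> \<le> 208 + 2 + 86 + 400 + 20 + 512"
    by (intro order_trans[OF norm_triangle_ineq] order_trans[OF norm_triangle_ineq4] add_mono t1 t2 t3 t4 t5 t6)
  finally show False by simp
qed

text \<open>The weight 12 law would carry a zero along its orbit to a point with small nome, where
  the estimate excludes it.\<close>

lemma Discr_nonzero:
  assumes "\<tau> \<in> uhp"
  shows "Discr \<tau> \<noteq> 0"
proof -
  obtain \<gamma> where \<gamma>: "\<gamma> \<in> carrier SL2Z" "norm (nome (mob \<gamma> \<tau>)) \<le> 1 / 200"
    using orbit_small_nome[OF assms] .
  obtain c where "\<And>\<tau>. \<tau> \<in> uhp \<Longrightarrow> Discr (mob \<gamma> \<tau>) = c * jac \<gamma> \<tau> powi 12 * Discr \<tau>"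
    using modular_mob[OF modular_Discr \<gamma>(1)] by blast
  moreover have "Discr (mob \<gamma> \<tau>) \<noteq> 0"
    using Discr_q_expansion mob_uhp[OF \<gamma>(1) assms] discr_unit_nonzero_small[OF \<gamma>(2)]
    by (auto simp: q_expansion_def)
  ultimately show ?thesis using assms by auto
qed

lemma discr_unit_nonzero: "q \<in> ball 0 1 \<Longrightarrow> discr_unit q \<noteq> 0"
proof (cases "q = 0")
  case False
  assume "q \<in> ball 0 1"
  with False obtain \<tau> where "\<tau> \<in> uhp" "nome \<tau> = q" using nome_surj by blast
  then show ?thesis using Discr_nonzero[of \<tau>] Discr_q_expansion by (auto simp: q_expansion_def)
qed (simp add: discr_unit_0)

text \<open>A holomorphic function without zeros on the disc has a logarithm. Subtracting the value
  of the logarithm at 0 changes nothing after exponentiation, because \<open>discr_unit\<close> is 1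
  at 0, and it normalises the root.\<close>

lemma ex_discr_root: "\<exists>w. w holomorphic_on ball 0 1 \<and> w 0 = 1 \<and> (\<forall>q\<in>ball 0 1. w q ^ 6 = discr_unit q)"
proof -
  obtain g where g: "g holomorphic_on ball 0 1" "\<And>q. q \<in> ball 0 1 \<Longrightarrow> discr_unit q = exp (g q)"
    using contractible_imp_holomorphic_log[OF holomorphic_discr_unit] discr_unit_nonzero
      convex_imp_contractible[OF convex_ball] by metis
  have "exp (g 0) = 1" using g(2)[of 0] by (simp add: discr_unit_0)
  have "exp ((g q - g 0) / 6) ^ 6 = discr_unit q" if "q \<in> ball 0 1" for q
  proof -
    have "exp ((g q - g 0) / 6) ^ 6 = exp (of_nat 6 * ((g q - g 0) / 6))" by (rule exp_of_nat_mult [symmetric])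
    also have "of_nat 6 * ((g q - g 0) / 6) = g q - g 0" by simp
    finally show ?thesis using g(2)[OF that] \<open>exp (g 0) = 1\<close> by (simp add: exp_diff)
  qed
  moreover have "(\<lambda>q. exp ((g q - g 0) / 6)) holomorphic_on ball 0 1"
    by (intro holomorphic_intros g) auto
  ultimately show ?thesis by (intro exI[of _ "\<lambda>q. exp ((g q - g 0) / 6)"]) auto
qed

definition eta4_unit :: "complex \<Rightarrow> complex" where
  "eta4_unit = (SOME w. w holomorphic_on ball 0 1 \<and> w 0 = 1 \<and> (\<forall>q\<in>ball 0 1. w q ^ 6 = discr_unit q))"

lemma eta4_unit: "eta4_unit holomorphic_on ball 0 1" "eta4_unit 0 = 1"
    "q \<in> ball 0 1 \<Longrightarrow> eta4_unit q ^ 6 = discr_unit q"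
  using someI_ex[OF ex_discr_root] unfolding eta4_unit_def by auto

lemma eta4_unit_nonzero: "q \<in> ball 0 1 \<Longrightarrow> eta4_unit q \<noteq> 0"
  using eta4_unit(3) discr_unit_nonzero by force

text \<open>\<open>\<eta>\<^sup>4\<close>, obtained as a sixth root instead of from Euler's product.\<close>

definition eta4 :: "complex \<Rightarrow> complex" where
  "eta4 \<tau> = qpow 1 \<tau> * eta4_unit (nome \<tau>)"

lemma eta4_q_expansion: "q_expansion 1 eta4 eta4_unit"
  by (simp add: q_expansion_def eta4_def eta4_unit)

lemma eta4_nonzero: "\<tau> \<in> uhp \<Longrightarrow> eta4 \<tau> \<noteq> 0"
  by (simp add: eta4_def eta4_unit_nonzero norm_nome_less)

lemma eta4_power_6: "\<tau> \<in> uhp \<Longrightarrow> eta4 \<tau> ^ 6 = Discr \<tau>"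
proof -
  assume t: "\<tau> \<in> uhp"
  have "qpow 1 \<tau> ^ 6 = nome \<tau>"
    by (simp add: qpow_def nome_def exp_of_nat_mult [symmetric] mult_ac)
  moreover have "qpow 6 \<tau> = nome \<tau>" using qpow_6[of 1] by simp
  ultimately show ?thesis
    using t Discr_q_expansion nome_in_ball[OF t]
    by (simp add: q_expansion_def eta4_def power_mult_distrib eta4_unit(3))
qed

lemma i_in_uhp: "\<i> \<in> uhp"
  by (simp add: uhp_def)

lemma connected_uhp: "connected uhp"
  unfolding uhp_def by (intro convex_connected convex_halfspace_Im_gt)

text \<open>The sixth power of the quotient of both sides is 1 by the law for \<open>Discr\<close>,
  so on the connected half-plane the quotient is a constant root of unity. At the fixed point i of S
  it equals 1 / i^2 = -1.\<close>

lemma modular_eta4: "modular 1 2 eta4"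
  using eta4_q_expansion
proof (rule modularI)
  let ?r = "\<lambda>\<tau>. eta4 (- 1 / \<tau>) / (\<tau>\<^sup>2 * eta4 \<tau>)"
  have hol: "eta4 holomorphic_on uhp" using eta4_q_expansion by (rule q_expansion_holomorphic)
  have "(\<lambda>\<tau>. - 1 / \<tau>) holomorphic_on uhp"
    using uhp_nonzero by (auto intro!: holomorphic_intros)
  from holomorphic_on_compose_gen[OF this hol] uhp_minus_inverse
  have "(\<lambda>\<tau>. eta4 (- 1 / \<tau>)) holomorphic_on uhp" by (auto simp: o_def)
  then have "continuous_on uhp ?r"
    using hol uhp_nonzero eta4_nonzero
    by (intro holomorphic_on_imp_continuous_on holomorphic_intros) auto
  moreover have "?r \<tau> ^ 6 = 1" if t: "\<tau> \<in> uhp" for \<tau>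
  proof -
    have "Discr (- 1 / \<tau>) = \<tau> ^ 12 * Discr \<tau>" using modular_S[OF modular_Discr t] by simp
    then show ?thesis
      using eta4_power_6[OF t] eta4_power_6[OF uhp_minus_inverse[OF t]] Discr_nonzero[OF t] uhp_nonzero[OF t]
      by (simp add: power_divide power_mult_distrib flip: power_mult)
  qed
  then have "?r ` uhp \<subseteq> {z. z ^ 6 = 1}" by blast
  then have "finite (?r ` uhp)" by (rule finite_subset) (simp add: finite_roots_unity)
  ultimately have "?r constant_on uhp"
    by (rule continuous_finite_range_constant[OF connected_uhp])
  then obtain c where c: "\<And>\<tau>. \<tau> \<in> uhp \<Longrightarrow> ?r \<tau> = c" by (auto simp: constant_on_def)
  have "c = - 1"
    using c[OF i_in_uhp] eta4_nonzero[OF i_in_uhp] by (simp add: divide_simps split: if_splits)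
  fix \<tau> assume t: "\<tau> \<in> uhp"
  show "eta4 (- 1 / \<tau>) = (- 1) powi 1 * \<tau> powi 2 * eta4 \<tau>"
    using c[OF t] \<open>c = - 1\<close> eta4_nonzero[OF t] uhp_nonzero[OF t] by (simp add: field_simps)
qed

lemma eta4_powi_q_expansion: "q_expansion y (\<lambda>\<tau>. eta4 \<tau> powi y) (\<lambda>q. eta4_unit q powi y)"
proof -
  have *: "(\<lambda>q. eta4_unit q powi y) holomorphic_on ball 0 1"
    by (rule holomorphic_on_power_int) (use eta4_unit eta4_unit_nonzero in auto)
  have "qpow 1 \<tau> powi y = qpow y \<tau>" for \<tau>
    by (simp add: qpow_def exp_power_int mult_ac)
  then show ?thesis
    unfolding q_expansion_def eta4_def power_int_mult_distrib using * by simp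
qed

lemma modular_eta4_powi: "modular y (2 * y) (\<lambda>\<tau>. eta4 \<tau> powi y)"
  using eta4_powi_q_expansion
proof (rule modularI)
  fix \<tau> assume t: "\<tau> \<in> uhp"
  have "eta4 (- 1 / \<tau>) = (- 1) powi 1 * \<tau> powi 2 * eta4 \<tau>" using modular_S[OF modular_eta4 t] .
  then show "eta4 (- 1 / \<tau>) powi y = (- 1) powi y * \<tau> powi (2 * y) * eta4 \<tau> powi y"
    unfolding power_int_mult by (simp only: power_int_mult_distrib) (simp add: power_int_mult_distrib)
qed

text \<open>Powers of \<open>eta4\<close> move forms between characters along k = 2 x; with
  \<open>y = x\<close> every question is reduced to the trivial character.\<close>

lemma modular_div_eta4:
  assumes "modular x k f"
  shows "modular (x - y) (k - 2 * y) (\<lambda>\<tau>. f \<tau> * eta4 \<tau> powi (- y))"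
  using modular_mult[OF assms modular_eta4_powi[of "- y"]] by simp

section \<open>Vanishing theorems and the ring of forms for the trivial character\<close>

lemma modular_weight_0:
  assumes "modular 0 0 f"
  obtains c where "\<And>\<tau>. \<tau> \<in> uhp \<Longrightarrow> f \<tau> = c"
proof -
  obtain g where g: "q_expansion 0 f g" using assms by (auto simp: modular_def)
  obtain c where c: "\<And>q. q \<in> ball 0 1 \<Longrightarrow> g q = c"
    using modular_weight_0_constant[OF assms g] unfolding constant_on_def by blast
  show ?thesis
    by (rule that[of c]) (use g c nome_in_ball in \<open>auto simp: q_expansion_def\<close>)
qed

text \<open>The quotient of \<open>f\<^sup>1\<^sup>2\<close> by a power of \<open>\<eta>\<^sup>4\<close> has weight 0 and vanishes at the cusp.\<close>

lemma modular_vanishes: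
  assumes "modular x k f" "k < 2 * x" "\<tau> \<in> uhp"
  shows "f \<tau> = 0"
proof -
  define n where "n = nat (2 * x - k)"
  have n: "n > 0" "int n = 2 * x - k" using assms(2) by (auto simp: n_def)
  \<comment> \<open>f^2 / eta4^k already has weight 0. The further sixth power turns its leading
    exponent (2 x - k) / 6 into the integer n, so that the expansion is one in q.\<close>
  define F where "F = (\<lambda>\<tau>. f \<tau> ^ 12 * eta4 \<tau> powi (- (6 * k)))"
  have "modular (int 12 * x - 6 * k) (int 12 * k - 2 * (6 * k)) F"
    unfolding F_def by (intro modular_div_eta4 modular_power assms)
  then have F: "modular (0 + 6 * int n) 0 F" by (simp add: n algebra_simps)
  then obtain g where g: "q_expansion (0 + 6 * int n) F g" by (auto simp: modular_def)
  have "(\<lambda>q. q ^ n * g q) constant_on ball 0 1"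
    using modular_weight_0_constant[OF modular_shift[OF F] q_expansion_shift[OF g]] .
  then obtain c where c: "\<And>q. q \<in> ball 0 1 \<Longrightarrow> q ^ n * g q = c" unfolding constant_on_def by blast
  have "c = 0" using c[of 0] n by (simp add: zero_power)
  have "F \<tau> = nome \<tau> ^ n * g (nome \<tau>)"
    using q_expansion_shift[OF g] assms(3) by (simp add: q_expansion_def)
  with c[OF nome_in_ball[OF assms(3)]] \<open>c = 0\<close> have "F \<tau> = 0" by simp
  then show ?thesis using eta4_nonzero[OF assms(3)] by (simp add: F_def)
qed

text \<open>Applying S twice returns to \<tau>; the signs of the character cancel and the automorphy
  factors multiply to (-1)^k.\<close>

lemma modular_odd_weight:
  assumes "modular x k f" "odd k" "\<tau> \<in> uhp"
  shows "f \<tau> = 0"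
proof -
  have t: "\<tau> \<noteq> 0" using uhp_nonzero assms(3) .
  have "f \<tau> = f (- 1 / (- 1 / \<tau>))" by simp
  also have "\<dots> = (- 1) powi x * (- 1 / \<tau>) powi k * ((- 1) powi x * \<tau> powi k * f \<tau>)"
    using modular_S[OF assms(1) uhp_minus_inverse[OF assms(3)]] modular_S[OF assms(1,3)] by simp
  also have "\<dots> = ((- 1) powi x * (- 1) powi x) * (((- 1 / \<tau>) * \<tau>) powi k * f \<tau>)"
    unfolding power_int_mult_distrib by simp
  also have "(- 1 / \<tau>) * \<tau> = - 1" using t by simp
  also have "(- 1 :: complex) powi x * (- 1) powi x = 1"
    by (simp add: power_int_add [symmetric])
  also have "(- 1 :: complex) powi k = - 1"
    using assms(2) by (elim oddE) (simp add: power_int_add power_int_mult)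
  finally show ?thesis by simp
qed

text \<open>The difference vanishes at the cusp, so it counts as a form with x = 6, and such forms
  are zero in weights below 12. In low weight a form is thus known by its constant term.\<close>

lemma modular_cusp:
  assumes "modular 0 k f" "q_expansion 0 f g" "q_expansion 0 f' g'" "modular 0 k f'" "k < 12" "\<tau> \<in> uhp"
    "g 0 = g' 0"
  shows "f \<tau> = f' \<tau>"
proof -
  have 1: "q_expansion 0 (\<lambda>\<tau>. f \<tau> + (- 1) * f' \<tau>) (\<lambda>q. g q + (- 1) * g' q)"
    by (intro q_expansion_add q_expansion_cmult assms)
  have 2: "modular 0 k (\<lambda>\<tau>. f \<tau> + (- 1) * f' \<tau>)"
    by (intro modular_add modular_cmult assms)
  have "modular (0 + 6) k (\<lambda>\<tau>. f \<tau> + (- 1) * f' \<tau>)"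
    by (rule modular_unshift[OF 2 1]) (simp add: assms(7))
  from modular_vanishes[OF this _ assms(6)] show ?thesis using assms(5) by simp
qed

text \<open>A form \<open>f\<close> of weight 2 with constant term \<open>c\<close> would satisfy \<open>f\<^sup>2 = c\<^sup>2 E\<^sub>4\<close> and
  \<open>f\<^sup>3 = c\<^sup>3 E\<^sub>6\<close>, whence \<open>c\<^sup>6 (E\<^sub>4\<^sup>3 - E\<^sub>6\<^sup>2) = 0\<close>.\<close>

lemma modular_weight_2:
  assumes "modular 0 2 f" "\<tau> \<in> uhp"
  shows "f \<tau> = 0"
proof -
  obtain g where g: "q_expansion 0 f g" using assms by (auto simp: modular_def)
  have g2: "q_expansion 0 (\<lambda>\<tau>. f \<tau> * f \<tau>) (\<lambda>q. g q * g q)"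
    using q_expansion_mult[OF g g] by simp
  have m2: "modular 0 4 (\<lambda>\<tau>. f \<tau> * f \<tau>)" using modular_mult[OF assms(1,1)] by simp
  have g3: "q_expansion 0 (\<lambda>\<tau>. f \<tau> * (f \<tau> * f \<tau>)) (\<lambda>q. g q * (g q * g q))"
    using q_expansion_mult[OF g g2] by simp
  have m3: "modular 0 6 (\<lambda>\<tau>. f \<tau> * (f \<tau> * f \<tau>))" using modular_mult[OF assms(1) m2] by simp
  let ?c = "g 0"
  have 2: "f \<tau> * f \<tau> = ?c\<^sup>2 * E4 \<tau>"
    by (rule modular_cusp[OF m2 g2 q_expansion_cmult[OF E4_q_expansion] modular_cmult[OF modular_E4] _ assms(2)])
      (simp_all add: power2_eq_square)
  have 3: "f \<tau> * (f \<tau> * f \<tau>) = ?c ^ 3 * E6 \<tau>"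
    by (rule modular_cusp[OF m3 g3 q_expansion_cmult[OF E6_q_expansion] modular_cmult[OF modular_E6] _ assms(2)])
      (simp_all add: power3_eq_cube)
  have "(f \<tau> * f \<tau>) ^ 3 = (f \<tau> * (f \<tau> * f \<tau>)) ^ 2"
    by (simp add: power2_eq_square power3_eq_cube mult_ac)
  moreover have "(f \<tau> * f \<tau>) ^ 3 = (?c\<^sup>2 * E4 \<tau>) ^ 3" by (simp only: 2)
  moreover have "(f \<tau> * (f \<tau> * f \<tau>)) ^ 2 = (?c ^ 3 * E6 \<tau>) ^ 2" by (simp only: 3)
  ultimately have "(?c\<^sup>2 * E4 \<tau>) ^ 3 = (?c ^ 3 * E6 \<tau>) ^ 2" by simp
  then have "?c ^ 6 * (E4 \<tau> ^ 3 - E6 \<tau> ^ 2) = 0"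
    by (simp add: power_mult_distrib right_diff_distrib flip: power_mult)
  moreover have "E4 \<tau> ^ 3 - E6 \<tau> ^ 2 \<noteq> 0" using Discr_nonzero[OF assms(2)] by (simp add: Discr_def)
  ultimately have "?c = 0" by simp
  then show ?thesis using 2 by simp
qed

text \<open>Polynomials in E4 and E6 are generated inductively rather than given by coefficients:
  closure properties become inductions. The functions are not cut off outside the
  half-plane.\<close>

inductive E_poly :: "int \<Rightarrow> (complex \<Rightarrow> complex) \<Rightarrow> bool" where
  E_poly_const: "E_poly 0 (\<lambda>\<tau>. c)"
| E_poly_zero: "E_poly k (\<lambda>\<tau>. 0)"
| E_poly_E4: "E_poly k f \<Longrightarrow> E_poly (k + 4) (\<lambda>\<tau>. E4 \<tau> * f \<tau>)"
| E_poly_E6: "E_poly k f \<Longrightarrow> E_poly (k + 6) (\<lambda>\<tau>. E6 \<tau> * f \<tau>)"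
| E_poly_add: "E_poly k f \<Longrightarrow> E_poly k g \<Longrightarrow> E_poly k (\<lambda>\<tau>. f \<tau> + g \<tau>)"

lemma E_poly_cmult: "E_poly k f \<Longrightarrow> E_poly k (\<lambda>\<tau>. c * f \<tau>)"
proof (induction rule: E_poly.induct)
  case (E_poly_E4 k f)
  from E_poly.E_poly_E4[OF E_poly_E4.IH] show ?case by (simp add: mult_ac)
next
  case (E_poly_E6 k f)
  from E_poly.E_poly_E6[OF E_poly_E6.IH] show ?case by (simp add: mult_ac)
next
  case (E_poly_add k f g)
  from E_poly.E_poly_add[OF E_poly_add.IH] show ?case by (simp add: distrib_left)
qed (auto intro: E_poly.intros)

lemma E_poly_Discr:
  assumes "E_poly k f"
  shows "E_poly (k + 12) (\<lambda>\<tau>. Discr \<tau> * f \<tau>)"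
proof -
  have "E_poly (k + 4 + 4 + 4) (\<lambda>\<tau>. E4 \<tau> * (E4 \<tau> * (E4 \<tau> * (1 / 1728 * f \<tau>))))"
    by (intro E_poly.intros E_poly_cmult assms)
  moreover have "E_poly (k + 6 + 6) (\<lambda>\<tau>. E6 \<tau> * (E6 \<tau> * (- 1 / 1728 * f \<tau>)))"
    by (intro E_poly.intros E_poly_cmult assms)
  ultimately have "E_poly (k + 12) (\<lambda>\<tau>. E4 \<tau> * (E4 \<tau> * (E4 \<tau> * (1 / 1728 * f \<tau>))) +
      E6 \<tau> * (E6 \<tau> * (- 1 / 1728 * f \<tau>)))"
    by (intro E_poly_add) (simp_all add: add.assoc)
  also have "(\<lambda>\<tau>. E4 \<tau> * (E4 \<tau> * (E4 \<tau> * (1 / 1728 * f \<tau>))) +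
      E6 \<tau> * (E6 \<tau> * (- 1 / 1728 * f \<tau>))) = (\<lambda>\<tau>. Discr \<tau> * f \<tau>)"
    by (simp add: fun_eq_iff Discr_def power2_eq_square power3_eq_cube field_simps)
  finally show ?thesis .
qed

lemma E_poly_monomial: "E_poly (4 * int a + 6 * int b) (\<lambda>\<tau>. E4 \<tau> ^ a * E6 \<tau> ^ b)"
proof -
  have b: "E_poly (6 * int b) (\<lambda>\<tau>. E6 \<tau> ^ b)"
  proof (induction b)
    case 0
    then show ?case using E_poly_const[of 1] by simp
  next
    case (Suc b)
    from E_poly_E6[OF this] show ?case by (simp add: add.commute distrib_left)
  qed
  show ?thesis
  proof (induction a)
    case 0
    then show ?case using b by simp
  next
    case (Suc a)
    from E_poly_E4[OF this] show ?case by (simp add: add_ac distrib_left mult_ac)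
  qed
qed

lemma E_poly_modular: "E_poly k f \<Longrightarrow> modular 0 k f"
proof (induction rule: E_poly.induct)
  case (E_poly_E4 k f)
  from modular_mult[OF modular_E4 E_poly_E4.IH] show ?case by (simp add: add.commute)
next
  case (E_poly_E6 k f)
  from modular_mult[OF modular_E6 E_poly_E6.IH] show ?case by (simp add: add.commute)
qed (auto intro: modular_const modular_zero modular_add)

text \<open>A monomial of the same weight has constant term 1; subtracting the right multiple leaves
  a form that vanishes at the cusp and is divisible by the discriminant, which lowers the weight by
  12.\<close>

lemma modular_E_poly:
  assumes "modular 0 k f"
  shows "\<exists>p. E_poly k p \<and> (\<forall>\<tau>\<in>uhp. f \<tau> = p \<tau>)"
  using assms
proof (induction "nat k" arbitrary: k f rule: less_induct)
  case less
  have zero: ?case if "\<And>\<tau>. \<tau> \<in> uhp \<Longrightarrow> f \<tau> = 0"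
    using that E_poly_zero by blast
  have "k < 0 \<or> odd k \<or> k = 0 \<or> k = 2 \<or> even k \<and> k \<ge> 4" by presburger
  then consider "k < 0" | "odd k" | "k = 0" | "k = 2" | "even k" "k \<ge> 4" by blast
  then show ?case
  proof cases
    case 1
    then show ?thesis by (intro zero modular_vanishes[OF less.prems]) auto
  next
    case 2
    then show ?thesis by (intro zero modular_odd_weight[OF less.prems])
  next
    case 3
    with less.prems obtain c where "\<And>\<tau>. \<tau> \<in> uhp \<Longrightarrow> f \<tau> = c"
      by (auto elim: modular_weight_0)
    then show ?thesis using E_poly_const[of c] 3 by auto
  next
    case 4
    then show ?thesis using less.prems by (intro zero modular_weight_2) auto
  next
    case 5
    \<comment> \<open>An even weight k \<ge> 4 is 4 a if 4 divides k, and otherwise 4 a + 6.\<close>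
    obtain a b where ab: "k = 4 * int a + 6 * int b"
    proof (cases "k mod 4 = 0")
      case True
      then obtain j where j: "k = 4 * j" by (metis mod_0_imp_dvd dvdE)
      then have "k = 4 * int (nat j) + 6 * int 0" using 5 by simp
      then show ?thesis by (rule that)
    next
      case False
      obtain i where "k = 2 * i" using 5 by (auto elim: evenE)
      with False have "odd i" by (auto elim!: evenE)
      then obtain j where "i = 2 * j + 1" by (auto elim: oddE)
      with \<open>k = 2 * i\<close> 5 have "k = 4 * int (nat (j - 1)) + 6 * int 1" by simp
      then show ?thesis by (rule that)
    qed
    define m where "m = (\<lambda>\<tau>. E4 \<tau> ^ a * E6 \<tau> ^ b)"
    have m: "E_poly k m" unfolding ab m_def by (rule E_poly_monomial)
    have mm: "modular 0 k m" using m by (rule E_poly_modular)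
    obtain gm where gm: "q_expansion 0 m gm" "gm 0 = 1"
    proof
      show "q_expansion 0 m (\<lambda>q. (1 + 240 * (q * sigma_series 3 q)) ^ a * (1 - 504 * (q * sigma_series 5 q)) ^ b)"
        using E4_q_expansion E6_q_expansion unfolding q_expansion_def m_def
        by (auto intro!: holomorphic_intros holomorphic_sigma_series)
    qed simp
    obtain g where g: "q_expansion 0 f g" using less.prems by (auto simp: modular_def)
    let ?f = "\<lambda>\<tau>. f \<tau> + (- g 0) * m \<tau>"
    have "modular (0 + 6) k ?f"
      by (rule modular_unshift[where g = "\<lambda>q. g q + (- g 0) * gm q"])
        (intro modular_add modular_cmult less.prems mm q_expansion_add q_expansion_cmult g gm | simp add: gm)+
    from modular_div_eta4[OF this, of 6]
    have "modular 0 (k - 12) (\<lambda>\<tau>. ?f \<tau> * eta4 \<tau> powi (- 6))" by simp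
    \<comment> \<open>For k < 12 the quotient has negative weight and the recursive call ends in the
      first case, with the zero polynomial.\<close>
    moreover have "nat (k - 12) < nat k" using 5 by simp
    ultimately have step: "\<exists>p. E_poly (k - 12) p \<and> (\<forall>\<tau>\<in>uhp. ?f \<tau> * eta4 \<tau> powi (- 6) = p \<tau>)"
      by (intro less.hyps)
    then obtain p where p: "E_poly (k - 12) p" "\<And>\<tau>. \<tau> \<in> uhp \<Longrightarrow> ?f \<tau> * eta4 \<tau> powi (- 6) = p \<tau>"
      using step by blast
    have "E_poly (k - 12 + 12) (\<lambda>\<tau>. Discr \<tau> * p \<tau>)" using p(1) by (rule E_poly_Discr)
    then have "E_poly k (\<lambda>\<tau>. Discr \<tau> * p \<tau> + g 0 * m \<tau>)"
      using m by (intro E_poly_add E_poly_cmult) auto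
    moreover have "f \<tau> = Discr \<tau> * p \<tau> + g 0 * m \<tau>" if t: "\<tau> \<in> uhp" for \<tau>
    proof -
      have "Discr \<tau> * p \<tau> = eta4 \<tau> ^ 6 * (?f \<tau> * eta4 \<tau> powi (- 6))"
        using p(2)[OF t] eta4_power_6[OF t] by simp
      also have "\<dots> = ?f \<tau>" using eta4_nonzero[OF t] by (simp add: power_int_minus)
      finally show ?thesis by simp
    qed
    ultimately show ?thesis by blast
  qed
qed

text \<open>Outside weight 0 there is no constant monomial, so every polynomial lies in the ideal
  generated by E4 and E6. For x3 = 0 this ideal is where the third coordinates of forms
  live.\<close>

lemma E_poly_decompose:
  assumes "E_poly k f" "k \<noteq> 0"
  obtains f1 f2 where "E_poly (k - 4) f1" "E_poly (k - 6) f2" "\<And>\<tau>. f \<tau> = E4 \<tau> * f1 \<tau> + E6 \<tau> * f2 \<tau>"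
proof -
  have "k \<noteq> 0 \<longrightarrow> (\<exists>f1 f2. E_poly (k - 4) f1 \<and> E_poly (k - 6) f2 \<and> (\<forall>\<tau>. f \<tau> = E4 \<tau> * f1 \<tau> + E6 \<tau> * f2 \<tau>))"
    using assms(1)
  proof (induction rule: E_poly.induct)
    case (E_poly_const c)
    then show ?case by simp
  next
    case (E_poly_zero k)
    show ?case using E_poly.E_poly_zero[of "k - 4"] E_poly.E_poly_zero[of "k - 6"] by fastforce
  next
    case (E_poly_E4 k f)
    have "E_poly (k + 4 - 4) f" using E_poly_E4 by simp
    moreover have "E_poly (k + 4 - 6) (\<lambda>\<tau>. 0)" by (rule E_poly.E_poly_zero)
    ultimately show ?case by fastforce
  next
    case (E_poly_E6 k f)
    have "E_poly (k + 6 - 6) f" using E_poly_E6 by simp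
    moreover have "E_poly (k + 6 - 4) (\<lambda>\<tau>. 0)" by (rule E_poly.E_poly_zero)
    ultimately show ?case by fastforce
  next
    case (E_poly_add k f g)
    show ?case
    proof
      assume "k \<noteq> 0"
      then obtain f1 f2 g1 g2 where
        "E_poly (k - 4) f1" "E_poly (k - 6) f2" "\<And>\<tau>. f \<tau> = E4 \<tau> * f1 \<tau> + E6 \<tau> * f2 \<tau>"
        "E_poly (k - 4) g1" "E_poly (k - 6) g2" "\<And>\<tau>. g \<tau> = E4 \<tau> * g1 \<tau> + E6 \<tau> * g2 \<tau>"
        using E_poly_add.IH by blast
      then show "\<exists>h1 h2. E_poly (k - 4) h1 \<and> E_poly (k - 6) h2 \<and>
          (\<forall>\<tau>. f \<tau> + g \<tau> = E4 \<tau> * h1 \<tau> + E6 \<tau> * h2 \<tau>)"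
        by (intro exI[of _ "\<lambda>\<tau>. f1 \<tau> + g1 \<tau>"] exI[of _ "\<lambda>\<tau>. f2 \<tau> + g2 \<tau>"])
          (auto intro: E_poly.E_poly_add simp: algebra_simps)
    qed
  qed
  then show ?thesis using that assms(2) by blast
qed

section \<open>Passage to the graded pieces of R\<close>

definition restrict_uhp :: "(complex \<Rightarrow> complex) \<Rightarrow> complex \<Rightarrow> complex" where
  "restrict_uhp f = (\<lambda>\<tau>. if \<tau> \<in> uhp then f \<tau> else 0)"

lemma finite_weight_exponents: "finite {(a, b). 4 * int a + 6 * int b = k}"
  by (rule finite_subset[of _ "{..nat k} \<times> {..nat k}"]) auto

lemma E_poly_R_part:
  assumes "E_poly k f"
  shows "restrict_uhp f \<in> R_part k"
proof -
  have "\<exists>c :: nat \<Rightarrow> nat \<Rightarrow> complex. \<forall>\<tau>. f \<tau> = (\<Sum>(a, b) | 4 * int a + 6 * int b = k. c a b * E4 \<tau> ^ a * E6 \<tau> ^ b)"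
    using assms
  proof (induction rule: E_poly.induct)
    case (E_poly_const c)
    have "{(a, b). 4 * int a + 6 * int b = 0} = {(0, 0)}" by auto
    then show ?case by (intro exI[of _ "\<lambda>a b. c"]) simp
  next
    case (E_poly_zero k)
    then show ?case by (intro exI[of _ "\<lambda>a b. 0"]) (simp add: case_prod_unfold)
  next
    case (E_poly_E4 k f)
    then obtain c where c: "\<And>\<tau>. f \<tau> = (\<Sum>(a, b) | 4 * int a + 6 * int b = k. c a b * E4 \<tau> ^ a * E6 \<tau> ^ b)"
      by blast
    show ?case
    proof (intro exI allI)
      fix \<tau>
      \<comment> \<open>The coefficients are shifted by one in \<open>a\<close>; the value 0 at
        \<open>a = 0\<close> is for the monomials without a factor E4, where \<open>a - 1\<close>
        would truncate.\<close>
      let ?c = "\<lambda>a b. if a = 0 then 0 else c (a - 1) b"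
      let ?A = "{(a, b). 4 * int a + 6 * int b = k}" and ?B = "{(a, b). 4 * int a + 6 * int b = k + 4}"
      have "E4 \<tau> * f \<tau> = (\<Sum>(a, b)\<in>?A. ?c (Suc a) b * E4 \<tau> ^ Suc a * E6 \<tau> ^ b)"
        unfolding c sum_distrib_left by (intro sum.cong) auto
      also have "\<dots> = (\<Sum>(a, b)\<in>?B - {0} \<times> UNIV. ?c a b * E4 \<tau> ^ a * E6 \<tau> ^ b)"
        by (rule sum.reindex_bij_witness[where i = "\<lambda>(a, b). (a - 1, b)" and j = "\<lambda>(a, b). (Suc a, b)"]) auto
      also have "\<dots> = (\<Sum>(a, b)\<in>?B. ?c a b * E4 \<tau> ^ a * E6 \<tau> ^ b)"
        by (rule sum.mono_neutral_left[OF finite_weight_exponents]) auto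
      finally show "E4 \<tau> * f \<tau> = (\<Sum>(a, b)\<in>?B. ?c a b * E4 \<tau> ^ a * E6 \<tau> ^ b)" .
    qed
  next
    case (E_poly_E6 k f)
    then obtain c where c: "\<And>\<tau>. f \<tau> = (\<Sum>(a, b) | 4 * int a + 6 * int b = k. c a b * E4 \<tau> ^ a * E6 \<tau> ^ b)"
      by blast
    show ?case
    proof (intro exI allI)
      fix \<tau>
      let ?c = "\<lambda>a b. if b = 0 then 0 else c a (b - 1)"
      let ?A = "{(a, b). 4 * int a + 6 * int b = k}" and ?B = "{(a, b). 4 * int a + 6 * int b = k + 6}"
      have "E6 \<tau> * f \<tau> = (\<Sum>(a, b)\<in>?A. ?c a (Suc b) * E4 \<tau> ^ a * E6 \<tau> ^ Suc b)"
        unfolding c sum_distrib_left by (intro sum.cong) auto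
      also have "\<dots> = (\<Sum>(a, b)\<in>?B - UNIV \<times> {0}. ?c a b * E4 \<tau> ^ a * E6 \<tau> ^ b)"
        by (rule sum.reindex_bij_witness[where i = "\<lambda>(a, b). (a, b - 1)" and j = "\<lambda>(a, b). (a, Suc b)"]) auto
      also have "\<dots> = (\<Sum>(a, b)\<in>?B. ?c a b * E4 \<tau> ^ a * E6 \<tau> ^ b)"
        by (rule sum.mono_neutral_left[OF finite_weight_exponents]) auto
      finally show "E6 \<tau> * f \<tau> = (\<Sum>(a, b)\<in>?B. ?c a b * E4 \<tau> ^ a * E6 \<tau> ^ b)" .
    qed
  next
    case (E_poly_add k f g)
    then obtain c d where
      c: "\<And>\<tau>. f \<tau> = (\<Sum>(a, b) | 4 * int a + 6 * int b = k. c a b * E4 \<tau> ^ a * E6 \<tau> ^ b)" and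
      d: "\<And>\<tau>. g \<tau> = (\<Sum>(a, b) | 4 * int a + 6 * int b = k. d a b * E4 \<tau> ^ a * E6 \<tau> ^ b)"
      by blast
    show ?case
      by (intro exI[of _ "\<lambda>a b. c a b + d a b"])
        (simp add: c d sum.distrib [symmetric] case_prod_unfold distrib_right)
  qed
  then show ?thesis unfolding R_part_def restrict_uhp_def by (auto simp: fun_eq_iff)
qed

subsection \<open>Eichler integrals of weight 2\<close>

text \<open>Solved coefficientwise: \<open>(n + x / 6) b\<^sub>n = a\<^sub>n\<close>.\<close>

lemma q_ode_solution:
  assumes w: "w holomorphic_on ball 0 1" and x: "\<not> 6 dvd (x::int)"
  obtains W where "W holomorphic_on ball 0 1" "W 0 = 6 * w 0 / of_int x"
    "\<And>q. q \<in> ball 0 1 \<Longrightarrow> q * deriv W q + of_int x / 6 * W q = w q"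
proof -
  let ?\<alpha> = "of_int x / 6 :: complex"
  define a where "a = (\<lambda>n. (deriv ^^ n) w 0 / fact n)"
  define b where "b = (\<lambda>n. a n / (of_nat n + ?\<alpha>))"
  \<comment> \<open>As 6 does not divide x, 6 n + x is a nonzero integer: no denominator vanishes,
    and division enlarges coefficients at most sixfold.\<close>
  have ge: "norm (of_nat n + ?\<alpha>) \<ge> 1 / 6" for n
  proof -
    have "6 * int n + x \<noteq> 0" using x by (metis dvd_add_right_iff dvd_triv_left dvd_0_right)
    then have "\<bar>6 * int n + x\<bar> \<ge> 1" by linarith
    then have "\<bar>real_of_int (6 * int n + x)\<bar> \<ge> 1" by linarith
    then have "norm (of_int (6 * int n + x) :: complex) \<ge> 1" by (simp only: norm_of_int)
    moreover have "of_nat n + ?\<alpha> = of_int (6 * int n + x) / 6" by (simp add: field_simps)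
    ultimately show ?thesis by (simp only: norm_divide) simp
  qed
  have a: "(\<lambda>n. a n * q ^ n) sums w q" if "q \<in> ball 0 1" for q
    using holomorphic_power_series[OF w that] by (simp add: a_def)
  have asm: "summable (\<lambda>n. norm (a n * q ^ n))" if "norm q < 1" for q
  proof -
    define r where "r = (1 + norm q) / 2"
    have r: "norm q < r" "r < 1" "r > 0" using that norm_ge_zero[of q] by (auto simp: r_def simp del: norm_ge_zero)
    have "summable (\<lambda>n. a n * of_real r ^ n)"
      using a[of "of_real r"] r by (auto intro: sums_summable)
    then show ?thesis by (rule powser_insidea) (use r in auto)
  qed
  have bsm: "summable (\<lambda>n. b n * q ^ n)" if "norm q < 1" for q
  proof (rule summable_comparison_test'[where N = 0])
    show "summable (\<lambda>n. 6 * norm (a n * q ^ n))" using asm[OF that] by (rule summable_mult)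
    fix n
    have nz: "norm (of_nat n + ?\<alpha>) > 0" using ge[of n] by linarith
    have "norm (a n) = norm (b n) * norm (of_nat n + ?\<alpha>)"
      using nz unfolding b_def by (simp add: norm_divide)
    moreover have "norm (b n) * norm (of_nat n + ?\<alpha>) \<ge> norm (b n) * (1 / 6)"
      by (intro mult_left_mono ge) auto
    ultimately have "norm (b n) \<le> 6 * norm (a n)" by simp
    then have "norm (b n) * norm (q ^ n) \<le> 6 * norm (a n) * norm (q ^ n)"
      by (intro mult_right_mono) auto
    then show "norm (b n * q ^ n) \<le> 6 * norm (a n * q ^ n)" by (simp add: norm_mult)
  qed
  define W where "W = (\<lambda>q. \<Sum>n. b n * q ^ n)"
  have der: "(W has_field_derivative (\<Sum>n. diffs b n * q ^ n)) (at q)" if "norm q < 1" for q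
    unfolding W_def by (rule termdiffs_strong'[where K = 1, OF bsm that])
  show ?thesis
  proof (rule that)
    show "W holomorphic_on ball 0 1"
      using der by (subst holomorphic_on_open) (simp, metis mem_ball_0)
    have "W 0 = b 0" unfolding W_def by (subst suminf_finite[of "{0}"]) auto
    moreover have "w 0 = a 0" by (simp add: a_def)
    ultimately show "W 0 = 6 * w 0 / of_int x" by (simp add: b_def)
    fix q :: complex assume q: "q \<in> ball 0 1"
    then have q': "norm q < 1" by simp
    have "summable (\<lambda>n. diffs b n * q ^ n)"
      by (rule termdiff_converges[where K = 1, OF q' bsm])
    then have "(\<lambda>n. of_nat n * b n * q ^ (n - Suc 0)) sums (\<Sum>n. diffs b n * q ^ n)"
      by (rule diffs_equiv)
    then have "(\<lambda>n. of_nat n * b n * q ^ (n - Suc 0)) sums deriv W q"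
      using DERIV_imp_deriv[OF der[OF q']] by simp
    then have "(\<lambda>n. q * (of_nat n * b n * q ^ (n - Suc 0))) sums (q * deriv W q)" by (rule sums_mult)
    moreover have "q * (of_nat n * b n * q ^ (n - Suc 0)) = of_nat n * b n * q ^ n" for n
      by (cases n) auto
    moreover have "(\<lambda>n. ?\<alpha> * (b n * q ^ n)) sums (?\<alpha> * W q)"
      unfolding W_def by (intro sums_mult summable_sums bsm q')
    ultimately have "(\<lambda>n. of_nat n * b n * q ^ n + ?\<alpha> * (b n * q ^ n)) sums (q * deriv W q + ?\<alpha> * W q)"
      by (simp add: sums_add)
    moreover have "of_nat n * b n * q ^ n + ?\<alpha> * (b n * q ^ n) = a n * q ^ n" for n
    proof -
      have "of_nat n + ?\<alpha> \<noteq> 0" using ge[of n] by auto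
      then have "b n * (of_nat n + ?\<alpha>) = a n" by (simp add: b_def)
      then show ?thesis by (metis distrib_right mult.assoc mult.commute)
    qed
    ultimately show "q * deriv W q + ?\<alpha> * W q = w q" using a[OF q] sums_unique2 by simp
  qed
qed

text \<open>On functions of q, d/d\<tau> is 2 pi i q d/dq, and the prefactor q^(x/6) contributes
  x/6. The primitive therefore amounts to the differential equation just solved.\<close>

lemma q_expansion_primitive:
  assumes f: "q_expansion x f w" and x: "\<not> 6 dvd x"
  obtains G W where "q_expansion x G W" "W 0 = 6 * w 0 / of_int x"
    "\<And>\<tau>. \<tau> \<in> uhp \<Longrightarrow> (G has_field_derivative 2 * pi * \<i> * f \<tau>) (at \<tau>)"
proof -
  obtain W where W: "W holomorphic_on ball 0 1" "W 0 = 6 * w 0 / of_int x"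
    "\<And>q. q \<in> ball 0 1 \<Longrightarrow> q * deriv W q + of_int x / 6 * W q = w q"
    using q_ode_solution[OF _ x] f by (auto simp: q_expansion_def)
  let ?G = "\<lambda>\<tau>. qpow x \<tau> * W (nome \<tau>)"
  show ?thesis
  proof (rule that[of ?G W])
    show "q_expansion x ?G W" by (simp add: q_expansion_def W)
    fix \<tau> assume t: "\<tau> \<in> uhp"
    have "(W has_field_derivative deriv W (nome \<tau>)) (at (nome \<tau>))"
      by (rule holomorphic_derivI[OF W(1)]) (use nome_in_ball[OF t] in auto)
    then have "((\<lambda>\<tau>. W (nome \<tau>)) has_field_derivative deriv W (nome \<tau>) * (2 * pi * \<i> * nome \<tau>)) (at \<tau>)"
      by (rule DERIV_chain2) (rule has_field_derivative_nome)
    from DERIV_mult[OF has_field_derivative_qpow this]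
    have "(?G has_field_derivative 2 * pi * \<i> * qpow x \<tau> *
        (nome \<tau> * deriv W (nome \<tau>) + of_int x / 6 * W (nome \<tau>))) (at \<tau>)"
      by (simp add: algebra_simps)
    then show "(?G has_field_derivative 2 * pi * \<i> * f \<tau>) (at \<tau>)"
      using W(3)[OF nome_in_ball[OF t]] f t by (simp add: q_expansion_def mult.assoc)
  qed (rule W(2))
qed

lemma has_field_derivative_minus_inverse:
  assumes "\<tau> \<noteq> 0"
  shows "((\<lambda>\<tau>. - 1 / \<tau>) has_field_derivative 1 / \<tau>\<^sup>2) (at (\<tau>::complex))"
  using assms by (auto intro!: derivative_eq_intros simp: power2_eq_square)

text \<open>Normalised so that the additive constant under S is 1. \<open>W 0 \<noteq> 0\<close>
  says that the leading exponent is exactly x/6; for \<open>x = - 1\<close> the pole is then really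
  present.\<close>

definition eichler_integral :: "int \<Rightarrow> (complex \<Rightarrow> complex) \<Rightarrow> (complex \<Rightarrow> complex) \<Rightarrow> bool" where
  "eichler_integral x g W \<longleftrightarrow> q_expansion x g W \<and> W 0 \<noteq> 0 \<and> (\<forall>\<tau>\<in>uhp. g (- 1 / \<tau>) = 1 - g \<tau>)"

lemma convex_uhp: "convex uhp"
  unfolding uhp_def by (rule convex_halfspace_Im_gt)

text \<open>For odd x the sign of f under S is -1, so G(-1/\<tau>) + G(\<tau>) has derivative 0 and
  is a constant c. If c were 0, G would be a form of weight 0 and vanish by \<open>van\<close>,
  against \<open>W 0 \<noteq> 0\<close>; hence division by c is possible.\<close>

lemma eichler_integral_exists:
  assumes f: "modular x 2 f" "q_expansion x f w" "w 0 \<noteq> 0" and x: "odd x"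
    and van: "\<And>G \<tau>. modular x 0 G \<Longrightarrow> \<tau> \<in> uhp \<Longrightarrow> G \<tau> = 0"
  obtains g W where "eichler_integral x g W"
proof -
  have x6: "\<not> 6 dvd x" using x by (meson dvd_trans even_numeral)
  have x0: "x \<noteq> 0" using x by auto
  obtain G W where G: "q_expansion x G W" "W 0 = 6 * w 0 / of_int x"
    "\<And>\<tau>. \<tau> \<in> uhp \<Longrightarrow> (G has_field_derivative 2 * pi * \<i> * f \<tau>) (at \<tau>)"
    by (rule q_expansion_primitive[OF f(2) x6]) (rule that)
  have W0: "W 0 \<noteq> 0" using G(2) f(3) x0 by simp
  have sgn: "(- 1 :: complex) powi x = - 1"
    using x by (elim oddE) (simp add: power_int_add power_int_mult)
  have D: "((\<lambda>\<tau>. G (- 1 / \<tau>) + G \<tau>) has_field_derivative 0) (at \<tau>)" if t: "\<tau> \<in> uhp" for \<tau>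
  proof -
    have t0: "\<tau> \<noteq> 0" using uhp_nonzero[OF t] .
    have "((\<lambda>\<tau>. G (- 1 / \<tau>)) has_field_derivative 2 * pi * \<i> * f (- 1 / \<tau>) * (1 / \<tau>\<^sup>2)) (at \<tau>)"
      by (rule DERIV_chain2[OF G(3)[OF uhp_minus_inverse[OF t]] has_field_derivative_minus_inverse[OF t0]])
    from DERIV_add[OF this G(3)[OF t]] show ?thesis
      unfolding modular_S[OF f(1) t] using t0 by (simp add: sgn)
  qed
  then obtain c where c: "\<And>\<tau>. \<tau> \<in> uhp \<Longrightarrow> G (- 1 / \<tau>) + G \<tau> = c"
    using has_field_derivative_zero_constant[OF convex_uhp, of "\<lambda>\<tau>. G (- 1 / \<tau>) + G \<tau>"]
    by (blast intro: has_field_derivative_at_within)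
  have "c \<noteq> 0"
  proof
    assume "c = 0"
    have "modular x 0 G"
      using G(1) by (rule modularI) (use c \<open>c = 0\<close> sgn in \<open>auto simp: add_eq_0_iff2\<close>)
    then have zero: "G \<tau> = 0" if "\<tau> \<in> uhp" for \<tau> using van that by blast
    have "q_expansion x G (\<lambda>q. 0)"
      by (rule q_expansion_cong[OF q_expansion_zero]) (rule zero)
    from q_expansion_unique[OF G(1) this] have "W 0 = 0" .
    with W0 show False by simp
  qed
  have "eichler_integral x (\<lambda>\<tau>. (1 / c) * G \<tau>) (\<lambda>q. (1 / c) * W q)"
    unfolding eichler_integral_def
  proof (intro conjI ballI q_expansion_cmult G)
    show "1 / c * W 0 \<noteq> 0" using W0 \<open>c \<noteq> 0\<close> by simp
    fix \<tau> assume "\<tau> \<in> uhp"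
    then have "G (- 1 / \<tau>) = c - G \<tau>" using c by (metis add_diff_cancel_right')
    then show "1 / c * G (- 1 / \<tau>) = 1 - 1 / c * G \<tau>" using \<open>c \<noteq> 0\<close> by (simp only:) (simp add: field_simps)
  qed
  then show ?thesis by (rule that)
qed

lemma ex_eichler_integral_1: "\<exists>g W. eichler_integral 1 g W"
  by (rule eichler_integral_exists[OF modular_eta4 eta4_q_expansion])
    (auto simp: eta4_unit intro: modular_vanishes)

text \<open>E4 / eta^4 has weight 2 and leading exponent -1/6. A form of weight 0 with that pole,
  multiplied by eta^4, would have weight 2 for the trivial character, where there is none but
  0.\<close>

lemma ex_eichler_integral_minus_1: "\<exists>g W. eichler_integral (- 1) g W"
proof (rule eichler_integral_exists)
  show "modular (- 1) 2 (\<lambda>\<tau>. E4 \<tau> * eta4 \<tau> powi (- 1))"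
    using modular_div_eta4[OF modular_E4, of 1] by simp
  show "q_expansion (- 1) (\<lambda>\<tau>. E4 \<tau> * eta4 \<tau> powi (- 1))
      (\<lambda>q. (1 + 240 * (q * sigma_series 3 q)) * eta4_unit q powi (- 1))"
    using q_expansion_mult[OF E4_q_expansion eta4_powi_q_expansion[of "- 1"]] by simp
  fix G \<tau> assume G: "modular (- 1) 0 G" and t: "\<tau> \<in> uhp"
  have "modular 0 2 (\<lambda>\<tau>. G \<tau> * eta4 \<tau>)"
    using modular_mult[OF G modular_eta4] by simp
  then show "G \<tau> = 0" using modular_weight_2[OF _ t] eta4_nonzero[OF t] by fastforce
qed (auto simp: eta4_unit)

definition eichler :: "int \<Rightarrow> complex \<Rightarrow> complex" where
  "eichler x = (SOME g. \<exists>W. eichler_integral x g W)"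

lemma eichler: "\<exists>W. eichler_integral 1 (eichler 1) W" "\<exists>W. eichler_integral (- 1) (eichler (- 1)) W"
  unfolding eichler_def
  using someI_ex[OF ex_eichler_integral_1] someI_ex[OF ex_eichler_integral_minus_1] by blast+

lemma eichler_S:
  "\<tau> \<in> uhp \<Longrightarrow> eichler 1 (- 1 / \<tau>) = 1 - eichler 1 \<tau>"
  "\<tau> \<in> uhp \<Longrightarrow> eichler (- 1) (- 1 / \<tau>) = 1 - eichler (- 1) \<tau>"
  using eichler unfolding eichler_integral_def by blast+

lemma eichler_T:
  "\<tau> \<in> uhp \<Longrightarrow> eichler 1 (\<tau> + 1) = lam 1 * eichler 1 \<tau>"
  "\<tau> \<in> uhp \<Longrightarrow> eichler (- 1) (\<tau> + 1) = lam (- 1) * eichler (- 1) \<tau>"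
  using eichler q_expansion_T unfolding eichler_integral_def by blast+

text \<open>i is fixed by S. The value is recorded because it is nonzero, which the independence of
  the coordinates of \<open>Phi\<close> relies on.\<close>

lemma eichler_i: "eichler 1 \<i> = 1 / 2" "eichler (- 1) \<i> = 1 / 2"
  using eichler_S[OF i_in_uhp] by (simp_all add: field_simps)

subsection \<open>Representations\<close>

lemma representation_mult:
  "representation \<rho> \<Longrightarrow> \<gamma> \<in> carrier SL2Z \<Longrightarrow> \<delta> \<in> carrier SL2Z \<Longrightarrow> \<rho> (\<gamma> ** \<delta>) = \<rho> \<gamma> ** \<rho> \<delta>"
  by (auto simp: representation_def hom_def SL2Z_def GL_def)

lemma hom_one_GL:
  assumes "representation \<rho>"
  shows "\<rho> (mat 1) = mat 1"
proof -
  have "\<rho> (mat 1) = \<rho> (mat 1) ** \<rho> (mat 1)"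
    using representation_mult[OF assms SL2Z_generators(1,1)] by simp
  moreover have "invertible (\<rho> (mat 1))"
    using assms SL2Z_generators(1) by (auto simp: representation_def hom_def GL_def Pi_iff)
  ultimately show ?thesis
    by (metis invertible_def matrix_mul_assoc matrix_mul_lid)
qed

lemma SL2Z_inverse:
  assumes "\<gamma> \<in> carrier SL2Z"
  obtains \<delta> where "\<delta> \<in> carrier SL2Z" "\<gamma> ** \<delta> = mat 1" "\<delta> ** \<gamma> = mat 1"
proof
  let ?d = "mat2 (\<gamma>$2$2) (- (\<gamma>$1$2)) (- (\<gamma>$2$1)) (\<gamma>$1$1)"
  have det: "\<gamma>$1$1 * \<gamma>$2$2 - \<gamma>$1$2 * \<gamma>$2$1 = 1" using assms by (simp add: SL2Z_def det_2)
  then show "?d \<in> carrier SL2Z" by (simp add: mat2_in_SL2Z algebra_simps)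
  have "mat2 (\<gamma>$1$1) (\<gamma>$1$2) (\<gamma>$2$1) (\<gamma>$2$2) ** ?d = mat 1" "?d ** mat2 (\<gamma>$1$1) (\<gamma>$1$2) (\<gamma>$2$1) (\<gamma>$2$2) = mat 1"
    using det unfolding mat_1_mat2 mat2_mult by (simp_all add: algebra_simps)
  then show "\<gamma> ** ?d = mat 1" "?d ** \<gamma> = mat 1" by (simp_all add: mat2_collapse)
qed

text \<open>Invertibility of the values comes from inverses in the group.\<close>

lemma representationI:
  assumes "\<And>\<gamma> \<delta>. \<gamma> \<in> carrier SL2Z \<Longrightarrow> \<delta> \<in> carrier SL2Z \<Longrightarrow> \<rho> (\<gamma> ** \<delta>) = \<rho> \<gamma> ** \<rho> \<delta>"
    and "\<rho> (mat 1) = mat 1"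
  shows "representation \<rho>"
proof -
  have "invertible (\<rho> \<gamma>)" if "\<gamma> \<in> carrier SL2Z" for \<gamma>
    using SL2Z_inverse[OF that] assms that unfolding invertible_def by metis
  then show ?thesis
    using assms by (auto simp: representation_def hom_def SL2Z_def GL_def)
qed

lemma representation_unique:
  assumes "representation \<rho>" "representation \<rho>'" "\<rho> S_mat = \<rho>' S_mat" "\<rho> T_mat = \<rho>' T_mat"
    "\<gamma> \<in> carrier SL2Z"
  shows "\<rho> \<gamma> = \<rho>' \<gamma>"
  using assms(5)
proof (induction \<gamma> rule: SL2Z_induct)
  case one
  show ?case using assms by (simp add: hom_one_GL)
next
  case (S \<gamma>)
  then show ?case using assms by (simp add: representation_mult SL2Z_generators)
next
  case (T \<gamma>)
  then show ?case using assms by (simp add: representation_mult SL2Z_generators)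
qed

lemma representation_extensional_unique:
  assumes "representation \<rho>" "representation \<rho>'" "\<rho> S_mat = \<rho>' S_mat" "\<rho> T_mat = \<rho>' T_mat"
    "\<rho> \<in> extensional (carrier SL2Z)" "\<rho>' \<in> extensional (carrier SL2Z)"
  shows "\<rho> = \<rho>'"
  using extensionalityI[OF assms(5,6)] representation_unique[OF assms(1-4)] by blast

lemma vec_cscale_mult: "A *v (c *s v) = c *s (A *v (v :: complex^'n))"
  by (simp add: vec_eq_iff matrix_vector_mult_def sum_distrib_left mult_ac)

lemma transform_all:
  assumes "representation \<rho>"
    and S: "\<And>\<tau>. \<tau> \<in> uhp \<Longrightarrow> F (- 1 / \<tau>) = \<tau> powi k *s (\<rho> S_mat *v F \<tau>)"
    and T: "\<And>\<tau>. \<tau> \<in> uhp \<Longrightarrow> F (\<tau> + 1) = \<rho> T_mat *v F \<tau>"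
    and "\<gamma> \<in> carrier SL2Z" "\<tau> \<in> uhp"
  shows "F (mob \<gamma> \<tau>) = jac \<gamma> \<tau> powi k *s (\<rho> \<gamma> *v (F \<tau> :: complex^'n))"
  using assms(4,5)
proof (induction \<gamma> arbitrary: \<tau> rule: SL2Z_induct)
  case one
  show ?case using assms(1) by (simp add: mob_generators jac_generators hom_one_GL)
next
  case (S \<gamma>)
  note g = SL2Z_generators(3)
  show ?case
    using assms(2)[OF mob_uhp[OF S(1) S.prems]] S(2)[OF S.prems]
    by (simp add: mob_mult[OF g S(1) S.prems] jac_mult[OF S(1) S.prems] mob_generators jac_generators
        representation_mult[OF assms(1) g S(1)] power_int_mult_distrib vec_cscale_mult matrix_vector_mul_assoc mult_ac)
next
  case (T \<gamma>)
  note g = SL2Z_generators(4)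
  show ?case
    using assms(3)[OF mob_uhp[OF T(1) T.prems]] T(2)[OF T.prems]
    by (simp add: mob_mult[OF g T(1) T.prems] jac_mult[OF T(1) T.prems] mob_generators jac_generators
        representation_mult[OF assms(1) g T(1)] vec_cscale_mult matrix_vector_mul_assoc)
qed

text \<open>A vector of linearly independent functions that is transformed by matrices under \<open>S\<close> and
  \<open>T\<close> yields a representation without recourse to a presentation of the modular group.\<close>

lemma representation_from_functions:
  fixes \<Phi> :: "complex \<Rightarrow> complex^'n"
  assumes S: "\<And>\<tau>. \<tau> \<in> uhp \<Longrightarrow> \<Phi> (- 1 / \<tau>) = \<tau> powi k *s (A *v \<Phi> \<tau>)"
    and T: "\<And>\<tau>. \<tau> \<in> uhp \<Longrightarrow> \<Phi> (\<tau> + 1) = B *v \<Phi> \<tau>"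
    and indep: "\<And>C D :: complex^'n^'n. (\<And>\<tau>. \<tau> \<in> uhp \<Longrightarrow> C *v \<Phi> \<tau> = D *v \<Phi> \<tau>) \<Longrightarrow> C = D"
    and "even k"
  obtains \<rho> where "PSL2Z_representation \<rho>" "\<rho> \<in> extensional (carrier SL2Z)"
    "\<rho> S_mat = A" "\<rho> T_mat = B"
proof -
  define P where "P = (\<lambda>\<gamma> M. \<forall>\<tau>\<in>uhp. \<Phi> (mob \<gamma> \<tau>) = jac \<gamma> \<tau> powi k *s (M *v \<Phi> \<tau>))"
  have uniq: "M = M'" if "P \<gamma> M" "P \<gamma> M'" "\<gamma> \<in> carrier SL2Z" for \<gamma> M M'
  proof (rule indep)
    fix \<tau> assume t: "\<tau> \<in> uhp"
    have "jac \<gamma> \<tau> \<noteq> 0" using jac_nonzero[OF that(3) t] .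
    moreover have "jac \<gamma> \<tau> powi k *s (M *v \<Phi> \<tau>) = jac \<gamma> \<tau> powi k *s (M' *v \<Phi> \<tau>)"
      using that t by (simp add: P_def)
    ultimately show "M *v \<Phi> \<tau> = M' *v \<Phi> \<tau>" by simp
  qed
  have mult: "P (\<gamma> ** \<delta>) (M ** N)" if "P \<gamma> M" "P \<delta> N" "\<gamma> \<in> carrier SL2Z" "\<delta> \<in> carrier SL2Z" for \<gamma> \<delta> M N
    using that by (auto simp: P_def mob_mult jac_mult mob_uhp power_int_mult_distrib vec_cscale_mult
        matrix_vector_mul_assoc[symmetric] mult_ac)
  have PS: "P S_mat A" and PT: "P T_mat B" and P1: "P (mat 1) (mat 1)"
    using S T by (simp_all add: P_def mob_generators jac_generators)
  have ex: "\<exists>M. P \<gamma> M" if "\<gamma> \<in> carrier SL2Z" for \<gamma>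
    using that
  proof (induction \<gamma> rule: SL2Z_induct)
    case one
    show ?case using P1 by blast
  next
    case (S \<gamma>)
    then show ?case using mult[OF PS] SL2Z_generators by blast
  next
    case (T \<gamma>)
    then show ?case using mult[OF PT] SL2Z_generators by blast
  qed
  define \<rho> where "\<rho> = restrict (\<lambda>\<gamma>. SOME M. P \<gamma> M) (carrier SL2Z)"
  have \<rho>: "P \<gamma> (\<rho> \<gamma>)" if "\<gamma> \<in> carrier SL2Z" for \<gamma>
    using someI_ex[OF ex[OF that]] that by (simp add: \<rho>_def)
  have eq: "\<rho> \<gamma> = M" if "P \<gamma> M" "\<gamma> \<in> carrier SL2Z" for \<gamma> M
    using uniq[OF \<rho>[OF that(2)] that] .
  have "representation \<rho>"
  proof (rule representationI)
    show "\<rho> (mat 1) = mat 1" by (rule eq[OF P1 SL2Z_generators(1)])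
    fix \<gamma> \<delta> assume "\<gamma> \<in> carrier SL2Z" "\<delta> \<in> carrier SL2Z"
    then show "\<rho> (\<gamma> ** \<delta>) = \<rho> \<gamma> ** \<rho> \<delta>"
      by (intro eq mult \<rho> SL2Z_mult_closed)
  qed
  \<comment> \<open>Minus the identity fixes every \<tau> with automorphy factor (-1)^k = 1, so
    uniqueness forces its matrix to be the identity.\<close>
  moreover have "P (- mat 1) (mat 1)"
    using \<open>even k\<close> by (auto simp: P_def mob_generators jac_generators elim!: evenE)
  then have "\<rho> (- mat 1) = mat 1" by (rule eq[OF _ SL2Z_generators(2)])
  ultimately have "PSL2Z_representation \<rho>" by (simp add: PSL2Z_representation_def)
  moreover have "\<rho> \<in> extensional (carrier SL2Z)" unfolding \<rho>_def by (rule restrict_extensional)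
  ultimately show ?thesis
    using eq[OF PS SL2Z_generators(3)] eq[OF PT SL2Z_generators(4)] by (rule that)
qed

lemma lam_eq_iff: "lam x = lam y \<longleftrightarrow> 6 dvd (x - y)"
proof
  assume "6 dvd (x - y)"
  then obtain n where "x = y + 6 * n" by (metis dvdE diff_add_cancel add.commute)
  moreover have "lam (6 * n) = 1"
    unfolding lam_def exp_eq_1 by (auto intro: exI[of _ n])
  ultimately show "lam x = lam y" by (simp add: lam_add)
next
  assume "lam x = lam y"
  then obtain n :: int where "2 * pi * \<i> * of_int x / 6 = 2 * pi * \<i> * of_int y / 6 + (of_int (2 * n) * pi) * \<i>"
    unfolding lam_def exp_eq by blast
  from arg_cong[OF this, of "\<lambda>z. 6 * z"]
  have "(2 * pi * \<i>) * of_int x = (2 * pi * \<i>) * (of_int y + 6 * of_int n)"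
    by (simp add: algebra_simps)
  then have "of_int x = (of_int (y + 6 * n) :: complex)" by simp
  then have "x = y + 6 * n" by (simp only: of_int_eq_iff)
  then show "6 dvd (x - y)" by simp
qed

lemma lam_cube: "lam x ^ 3 = (- 1) powi x"
proof -
  have "lam x ^ 3 = exp (of_nat 3 * (2 * pi * \<i> * of_int x / 6))" unfolding lam_def by (rule exp_of_nat_mult[symmetric])
  also have "of_nat 3 * (2 * pi * \<i> * of_int x / 6) = of_int x * (pi * \<i>)" by simp
  also have "exp \<dots> = exp (pi * \<i>) powi x" by (rule exp_power_int[symmetric])
  finally show ?thesis by simp
qed

subsection \<open>The characters\<close>

lemma matrix_1_eq: "(A :: complex^1^1) = B \<longleftrightarrow> A$1$1 = B$1$1"
  by (simp add: vec_eq_iff forall_1)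

lemma matrix_1_mult: "((A :: complex^1^1) ** B)$1$1 = A$1$1 * B$1$1"
  by (simp add: matrix_matrix_mult_def sum_1)

text \<open>S^2 = (S T)^3 = -1 and (-1)^2 = 1 give s^2 = s^3 t^3 with s^4 = 1. A character is thus
  determined by its value at T.\<close>

lemma character_S:
  fixes \<psi> :: "int^2^2 \<Rightarrow> complex^1^1"
  assumes "representation \<psi>"
  shows "\<psi> S_mat $ 1 $ 1 * (\<psi> T_mat $ 1 $ 1) ^ 3 = 1"
proof -
  note g = SL2Z_generators
  let ?s = "\<psi> S_mat $ 1 $ 1" and ?t = "\<psi> T_mat $ 1 $ 1"
  have m: "\<psi> (\<gamma> ** \<delta>) $ 1 $ 1 = \<psi> \<gamma> $ 1 $ 1 * \<psi> \<delta> $ 1 $ 1"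
    if "\<gamma> \<in> carrier SL2Z" "\<delta> \<in> carrier SL2Z" for \<gamma> \<delta>
    using representation_mult[OF assms that] by (simp add: matrix_1_mult)
  have "\<psi> (- mat 1) $ 1 $ 1 = ?s * ?s" using m[OF g(3,3)] by (simp add: S_mat_square)
  moreover have "\<psi> (- mat 1) $ 1 $ 1 = (?s * ?t) * (?s * ?t) * (?s * ?t)"
    unfolding S_T_cube[symmetric] by (simp add: m g SL2Z_mult_closed)
  moreover have "\<psi> (- mat 1) $ 1 $ 1 * \<psi> (- mat 1) $ 1 $ 1 = 1"
    using m[OF g(2,2)] hom_one_GL[OF assms]
    by (simp add: mat_1_mat2 mat2_uminus mat2_mult mat_def[where 'a = complex])
  ultimately show ?thesis by algebra
qed

text \<open>The character is realised by the function eta^(4 x) of weight 2 x. The description in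
  \<open>chi\<close> singles it out because the value at T determines the value at S.\<close>

lemma chi_even:
  shows "representation (chi (2 * x))" "chi (2 * x) \<in> extensional (carrier SL2Z)"
    "chi (2 * x) T_mat = mat (lam x)" "chi (2 * x) S_mat = mat ((- 1) powi x)"
proof -
  let ?F = "\<lambda>\<tau>. vec (eta4 \<tau> powi x) :: complex^1"
  have [simp]: "A *v ?F \<tau> = vec (A$1$1 * eta4 \<tau> powi x)" for A :: "complex^1^1" and \<tau>
    by (simp add: vec_eq_iff forall_1 matrix_vector_mult_def sum_1)
  have [simp]: "mat c $ 1 $ 1 = c" for c :: complex by (simp add: mat_def)
  obtain \<psi> :: "int^2^2 \<Rightarrow> complex^1^1" where \<psi>: "PSL2Z_representation \<psi>" "\<psi> \<in> extensional (carrier SL2Z)"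
    "\<psi> S_mat = mat ((- 1) powi x)" "\<psi> T_mat = mat (lam x)"
  proof (rule representation_from_functions[of ?F "2 * x" "mat ((- 1) powi x)" "mat (lam x)"])
    fix \<tau> assume t: "\<tau> \<in> uhp"
    show "?F (- 1 / \<tau>) = \<tau> powi (2 * x) *s (mat ((- 1) powi x) *v ?F \<tau>)"
      using modular_S[OF modular_eta4_powi t, of x] by (simp add: vec_eq_iff)
    show "?F (\<tau> + 1) = mat (lam x) *v ?F \<tau>"
      using modular_T[OF modular_eta4_powi t, of x] by (simp add: vec_eq_iff)
  next
    fix C D :: "complex^1^1"
    assume "\<And>\<tau>. \<tau> \<in> uhp \<Longrightarrow> C *v ?F \<tau> = D *v ?F \<tau>"
    from this[OF i_in_uhp] show "C = D"
      using eta4_nonzero[OF i_in_uhp] by (simp add: vec_eq_iff forall_1)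
  qed auto
  have lam: "exp (2 * pi * \<i> * of_int (2 * x) / 12) = lam x" by (simp add: lam_def)
  have "chi (2 * x) = \<psi>"
    unfolding chi_def lam
  proof (rule the_equality)
    show "representation \<psi> \<and> \<psi> \<in> extensional (carrier SL2Z) \<and> \<psi> T_mat = mat (lam x)"
      using \<psi> by (simp add: PSL2Z_representation_def)
    fix \<phi> :: "int^2^2 \<Rightarrow> complex^1^1"
    assume \<phi>: "representation \<phi> \<and> \<phi> \<in> extensional (carrier SL2Z) \<and> \<phi> T_mat = mat (lam x)"
    show "\<phi> = \<psi>"
    proof (rule representation_extensional_unique)
      have "\<phi> S_mat $ 1 $ 1 * lam x ^ 3 = 1" "\<psi> S_mat $ 1 $ 1 * lam x ^ 3 = 1"
        using character_S[of \<phi>] character_S[of \<psi>] \<phi> \<psi> by (auto simp: PSL2Z_representation_def)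
      then have "\<phi> S_mat $ 1 $ 1 = \<psi> S_mat $ 1 $ 1" by (metis mult_cancel_right zero_neq_one mult_zero_right)
      then show "\<phi> S_mat = \<psi> S_mat" by (simp add: matrix_1_eq)
    qed (use \<phi> \<psi> in \<open>auto simp: PSL2Z_representation_def\<close>)
  qed
  with \<psi> show "representation (chi (2 * x))" "chi (2 * x) \<in> extensional (carrier SL2Z)"
    "chi (2 * x) T_mat = mat (lam x)" "chi (2 * x) S_mat = mat ((- 1) powi x)"
    by (auto simp: PSL2Z_representation_def)
qed

subsection \<open>Exponents of diagonal matrices\<close>

definition diag :: "('n \<Rightarrow> complex) \<Rightarrow> complex^'n^'n" where
  "diag d = (\<chi> i j. if i = j then d i else 0)"

lemma diag_nth: "diag d $ i $ j = (if i = j then d i else 0)"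
  by (simp add: diag_def)

lemma diag_mult_left: "(diag d ** A) $ i $ j = d i * A $ i $ j"
  by (simp add: matrix_matrix_mult_def diag_nth if_distrib[of "\<lambda>x. x * _"] cong: if_cong)

lemma diag_mult_right: "(A ** diag d) $ i $ j = A $ i $ j * d j"
  by (simp add: matrix_matrix_mult_def diag_nth if_distrib[of "\<lambda>x. _ * x"] cong: if_cong)

lemma diag_mult_vec: "(diag d *v v) $ i = d i * v $ i"
  by (simp add: matrix_vector_mult_def diag_nth if_distrib[of "\<lambda>x. x * _"] cong: if_cong)

lemma cscale_diag: "cscale c (diag d) = diag (\<lambda>i. c * d i)"
  by (simp add: vec_eq_iff cscale_def diag_nth)

definition mpow :: "complex^'n^'n \<Rightarrow> nat \<Rightarrow> complex^'n^'n" where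
  "mpow A k = (((**) A) ^^ k) (mat 1)"

lemma mpow_simps [simp]: "mpow A 0 = mat 1" "mpow A (Suc k) = A ** mpow A k"
  by (simp_all add: mpow_def)

lemma mpow_diag: "mpow (diag d) k = diag (\<lambda>i. d i ^ k)"
  by (induction k) (simp_all add: vec_eq_iff diag_mult_left, simp_all add: diag_nth mat_def)

lemma mpow_commutes:
  assumes "L ** A = A ** L"
  shows "L ** mpow A k = mpow A k ** L"
  by (induction k) (simp_all, metis assms matrix_mul_assoc)

lemma sums_matrix_iff:
  fixes f :: "nat \<Rightarrow> complex^'n^'m"
  shows "f sums s \<longleftrightarrow> (\<forall>i j. (\<lambda>k. f k $ i $ j) sums (s $ i $ j))"
proof
  assume f: "f sums s"
  have "(\<lambda>n. (\<Sum>k<n. f k) $ i $ j) \<longlonglongrightarrow> s $ i $ j" for i j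
    using f unfolding sums_def by (intro tendsto_vec_nth)
  then show "\<forall>i j. (\<lambda>k. f k $ i $ j) sums (s $ i $ j)"
    by (simp add: sums_def sum_component)
next
  assume *: "\<forall>i j. (\<lambda>k. f k $ i $ j) sums (s $ i $ j)"
  show "f sums s"
    unfolding sums_def by (intro vec_tendstoI) (use * in \<open>simp add: sums_def sum_component\<close>)
qed

lemma mpow_bound:
  fixes A :: "complex^'n^'n"
  assumes "\<And>i j. norm (A $ i $ j) \<le> K" "K \<ge> 0"
  shows "norm (mpow A k $ i $ j) \<le> (real CARD('n) * K) ^ k"
proof (induction k arbitrary: i j)
  case 0
  show ?case by (simp add: mat_def)
next
  case (Suc k)
  have "norm (mpow A (Suc k) $ i $ j) \<le> (\<Sum>m\<in>UNIV. norm (A $ i $ m * mpow A k $ m $ j))"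
    by (simp add: matrix_matrix_mult_def norm_sum)
  also have "\<dots> \<le> (\<Sum>m\<in>(UNIV :: 'n set). K * (real CARD('n) * K) ^ k)"
    unfolding norm_mult by (intro sum_mono mult_mono assms Suc.IH) auto
  finally show ?case by (simp add: mult_ac)
qed

lemma matrix_exp_sums:
  fixes A :: "complex^'n^'n"
  shows "(\<lambda>k. (1 / fact k) *\<^sub>R mpow A k) sums matrix_exp A"
proof -
  define K where "K = (\<Sum>i\<in>UNIV. \<Sum>j\<in>UNIV. norm (A $ i $ j))"
  have K: "norm (A $ i $ j) \<le> K" for i j
  proof -
    have "norm (A $ i $ j) \<le> (\<Sum>j\<in>UNIV. norm (A $ i $ j))" by (rule member_le_sum) auto
    also have "\<dots> \<le> K" unfolding K_def
      by (rule member_le_sum[of i UNIV "\<lambda>i. \<Sum>j\<in>UNIV. norm (A $ i $ j)"]) (auto intro: sum_nonneg)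
    finally show ?thesis .
  qed
  have K0: "K \<ge> 0" unfolding K_def by (intro sum_nonneg) auto
  let ?f = "\<lambda>k. (1 / fact k) *\<^sub>R mpow A k"
  have "summable (\<lambda>k. ?f k $ i $ j)" for i j
  proof (rule summable_comparison_test'[where N = 0])
    show "summable (\<lambda>k. inverse (fact k) * (real CARD('n) * K) ^ k)" by (rule summable_exp)
    fix k
    show "norm (?f k $ i $ j) \<le> inverse (fact k) * (real CARD('n) * K) ^ k"
      using mpow_bound[OF K K0, of k i j] by (simp add: divide_inverse mult_left_mono)
  qed
  then have "?f sums (\<chi> i j. \<Sum>k. ?f k $ i $ j)"
    unfolding sums_matrix_iff by (simp add: summable_sums)
  then have "?f sums suminf ?f" by (simp add: sums_iff)
  then show ?thesis by (simp add: matrix_exp_def mpow_def)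
qed

lemma matrix_exp_diag: "matrix_exp (diag d) = diag (\<lambda>i. exp (d i))"
proof -
  have "(\<lambda>k. (1 / fact k) *\<^sub>R mpow (diag d) k) sums diag (\<lambda>i. exp (d i))"
    unfolding sums_matrix_iff
  proof (intro allI)
    fix i j
    show "(\<lambda>k. ((1 / fact k) *\<^sub>R mpow (diag d) k) $ i $ j) sums (diag (\<lambda>i. exp (d i)) $ i $ j)"
      using exp_converges[of "d i"] by (auto simp: mpow_diag diag_nth divide_inverse)
  qed
  with matrix_exp_sums show ?thesis by (rule sums_unique2)
qed

lemma matrix_exp_commutes:
  assumes "L ** A = A ** L"
  shows "L ** matrix_exp A = matrix_exp A ** (L :: complex^'n^'n)"
proof -
  let ?f = "\<lambda>k. (1 / fact k) *\<^sub>R mpow A k"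
  have s: "(\<lambda>k. ?f k $ i $ j) sums (matrix_exp A $ i $ j)" for i j
    using matrix_exp_sums[of A] unfolding sums_matrix_iff by blast
  have "(\<lambda>k. L ** ?f k) sums (L ** matrix_exp A)"
    unfolding sums_matrix_iff matrix_matrix_mult_def
    by (simp del: vector_scaleR_component mult_scaleR_left mult_scaleR_right)
      (intro allI sums_sum sums_mult s)
  moreover have "(\<lambda>k. ?f k ** L) sums (matrix_exp A ** L)"
    unfolding sums_matrix_iff matrix_matrix_mult_def
    by (simp del: vector_scaleR_component mult_scaleR_left mult_scaleR_right)
      (intro allI sums_sum sums_mult2 s)
  moreover have "(\<lambda>k. L ** ?f k) = (\<lambda>k. ?f k ** L)"
  proof
    fix k
    have "L ** ?f k = (1 / fact k) *\<^sub>R (L ** mpow A k)" "?f k ** L = (1 / fact k) *\<^sub>R (mpow A k ** L)"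
      by (simp_all add: vec_eq_iff matrix_matrix_mult_def scaleR_sum_right)
    then show "L ** ?f k = ?f k ** L" using mpow_commutes[OF assms, of k] by simp
  qed
  ultimately show ?thesis by (simp only: sums_unique2)
qed

text \<open>A competing logarithm L commutes with its own exponential ?M. The diagonal entries of ?M
  are distinct, so L is diagonal, and each entry is fixed by its exponential together with the strip
  of width 1.\<close>

lemma exponent_diag:
  fixes e :: "'n::finite \<Rightarrow> real"
  assumes e: "\<And>i. 0 \<le> e i" "\<And>i. e i < 1" and "inj e"
  shows "exponent (diag (\<lambda>i. exp (2 * pi * \<i> * of_real (e i)))) = diag (\<lambda>i. of_real (e i))"
    (is "exponent ?M = ?L")
  unfolding exponent_def
proof (rule the_equality)
  show "matrix_exp (cscale (2 * pi * \<i>) ?L) = ?M \<and>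
      (\<forall>c v. v \<noteq> 0 \<and> ?L *v v = c *s v \<longrightarrow> 0 \<le> Re c \<and> Re c < 1)"
  proof (intro conjI allI impI)
    show "matrix_exp (cscale (2 * pi * \<i>) ?L) = ?M" by (simp add: cscale_diag matrix_exp_diag)
    fix c v assume v: "v \<noteq> 0 \<and> ?L *v v = c *s v"
    then obtain i where i: "v $ i \<noteq> 0" by (auto simp: vec_eq_iff)
    have "(?L *v v) $ i = (c *s v) $ i" using v by simp
    then have "c = of_real (e i)" using i by (simp add: diag_mult_vec)
    then show "0 \<le> Re c" "Re c < 1" using e by auto
  qed
next
  fix L :: "complex^'n^'n"
  assume L: "matrix_exp (cscale (2 * pi * \<i>) L) = ?M \<and>
      (\<forall>c v. v \<noteq> 0 \<and> L *v v = c *s v \<longrightarrow> 0 \<le> Re c \<and> Re c < 1)"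
  have "L ** cscale (2 * pi * \<i>) L = cscale (2 * pi * \<i>) L ** L"
    by (simp add: vec_eq_iff matrix_matrix_mult_def cscale_def mult_ac)
  from matrix_exp_commutes[OF this] have comm: "L ** ?M = ?M ** L" using L by simp
  have off: "L $ i $ j = 0" if "i \<noteq> j" for i j
  proof -
    have "(L ** ?M) $ i $ j = (?M ** L) $ i $ j" using comm by simp
    then have "L $ i $ j = 0 \<or> exp (2 * pi * \<i> * of_real (e j)) = exp (2 * pi * \<i> * of_real (e i))"
      by (auto simp: diag_mult_left diag_mult_right)
    moreover have "exp (2 * pi * \<i> * of_real (e j)) \<noteq> exp (2 * pi * \<i> * of_real (e i))"
    proof
      assume "exp (2 * pi * \<i> * of_real (e j)) = exp (2 * pi * \<i> * of_real (e i))"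
      then obtain n :: int where "2 * pi * \<i> * of_real (e j) = 2 * pi * \<i> * of_real (e i) + (of_int (2 * n) * pi) * \<i>"
        unfolding exp_eq by blast
      then have "(2 * pi * \<i>) * of_real (e j) = (2 * pi * \<i>) * (of_real (e i) + of_int n)" by (simp add: algebra_simps)
      then have "complex_of_real (e j) = of_real (e i + of_int n)" by simp
      then have ej: "e j = e i + of_int n" by (simp only: of_real_eq_iff)
      then have "\<bar>real_of_int n\<bar> < 1" using e(1)[of i] e(2)[of i] e(1)[of j] e(2)[of j] by linarith
      then have "n = 0" by linarith
      with ej have "i = j" using \<open>inj e\<close> by (auto dest: injD)
      with that show False by simp
    qed
    ultimately show ?thesis by simp
  qed
  define l where "l = (\<lambda>i. L $ i $ i)"
  have Ll: "L = diag l" using off by (simp add: vec_eq_iff diag_nth l_def)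
  have "l i = of_real (e i)" for i
  proof -
    \<comment> \<open>The coordinate vectors are eigenvectors of the diagonal L; this transfers the
      condition on eigenvalues to the diagonal entries.\<close>
    have "axis i 1 \<noteq> (0 :: complex^'n)" by (simp add: axis_eq_0_iff)
    moreover have "L *v axis i 1 = l i *s axis i 1"
      unfolding Ll by (simp add: vec_eq_iff diag_mult_vec axis_def)
    ultimately have Re: "0 \<le> Re (l i)" "Re (l i) < 1" using L by blast+
    have "matrix_exp (cscale (2 * pi * \<i>) (diag l)) $ i $ i = ?M $ i $ i" using L by (simp add: Ll)
    then have "exp (2 * pi * \<i> * l i) = exp (2 * pi * \<i> * of_real (e i))"
      by (simp add: cscale_diag matrix_exp_diag diag_nth)
    then obtain n :: int where "2 * pi * \<i> * l i = 2 * pi * \<i> * of_real (e i) + (of_int (2 * n) * pi) * \<i>"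
      unfolding exp_eq by blast
    then have "(2 * pi * \<i>) * l i = (2 * pi * \<i>) * (of_real (e i) + of_int n)" by (simp add: algebra_simps)
    then have li: "l i = of_real (e i) + of_int n" by simp
    then have "\<bar>real_of_int n\<bar> < 1" using Re e(1)[of i] e(2)[of i] by simp
    then have "n = 0" by linarith
    with li show ?thesis by simp
  qed
  then have "l = (\<lambda>i. of_real (e i))" by (simp add: fun_eq_iff)
  then show "L = ?L" using Ll by simp
qed

lemma exponent_lam:
  fixes x :: "'n::finite \<Rightarrow> int"
  assumes "\<And>i. 0 \<le> x i" "\<And>i. x i < 6" "inj x"
  shows "exponent (diag (\<lambda>i. lam (x i))) = diag (\<lambda>i. of_int (x i) / 6)"
proof -
  have "inj (\<lambda>i. real_of_int (x i) / 6)" using assms(3) by (auto simp: inj_def)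
  from exponent_diag[OF _ _ this] assms show ?thesis by (simp add: lam_def)
qed

section \<open>Vector-valued forms in coordinates\<close>

definition transforms :: "(int^2^2 \<Rightarrow> complex^'n^'n) \<Rightarrow> int \<Rightarrow> (complex \<Rightarrow> complex^'n) \<Rightarrow> bool" where
  "transforms \<rho> k F \<longleftrightarrow> (\<forall>\<tau>\<in>uhp. F (- 1 / \<tau>) = \<tau> powi k *s (\<rho> S_mat *v F \<tau>))"

text \<open>The behaviour under \<open>T\<close> is implied by the \<open>q\<close>-expansions.\<close>

lemma vvmf_iff:
  fixes x :: "'n::finite \<Rightarrow> int"
  assumes \<rho>: "representation \<rho>" "\<rho> T_mat = diag (\<lambda>i. lam (x i))"
    and x: "\<And>i. 0 \<le> x i" "\<And>i. x i < 6" "inj x"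
  shows "F \<in> vvmf \<rho> k \<longleftrightarrow> (\<forall>\<tau>. \<tau> \<notin> uhp \<longrightarrow> F \<tau> = 0) \<and> transforms \<rho> k F \<and>
    (\<forall>i. \<exists>g. q_expansion (x i) (\<lambda>\<tau>. F \<tau> $ i) g)"
proof -
  \<comment> \<open>For diagonal \<rho>(T) the factor exp (- 2 pi i \<tau> L) multiplies the i-th
    coordinate by q^(- x_i / 6), so holomorphy at q = 0 becomes one scalar expansion per
    coordinate.\<close>
  have E: "matrix_exp (cscale (- (2 * pi * \<i> * \<tau>)) (exponent (\<rho> T_mat))) = diag (\<lambda>i. inverse (qpow (x i) \<tau>))" for \<tau>
    unfolding \<rho>(2) exponent_lam[OF x] cscale_diag matrix_exp_diag
    by (simp add: qpow_def exp_minus [symmetric] mult_ac)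
  have E': "diag (\<lambda>i. inverse (qpow (x i) \<tau>)) *v v = w \<longleftrightarrow> (\<forall>i. v $ i = qpow (x i) \<tau> * w $ i)"
    for \<tau> and v w :: "complex^'n"
    by (auto simp: vec_eq_iff diag_mult_vec field_simps)
  show ?thesis
  proof (intro iffI conjI)
    assume F: "F \<in> vvmf \<rho> k"
    then show "\<forall>\<tau>. \<tau> \<notin> uhp \<longrightarrow> F \<tau> = 0" by (simp add: vvmf_def)
    have "\<forall>\<gamma>\<in>carrier SL2Z. \<forall>\<tau>\<in>uhp. F (mob \<gamma> \<tau>) = jac \<gamma> \<tau> powi k *s (\<rho> \<gamma> *v F \<tau>)"
      using F by (simp add: vvmf_def mob_def jac_def)
    from bspec[OF this SL2Z_generators(3)] show "transforms \<rho> k F"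
      by (simp add: transforms_def mob_generators jac_generators)
    obtain f where f: "\<forall>i. (\<lambda>q. f q $ i) holomorphic_on ball 0 1"
      "\<forall>\<tau>\<in>uhp. matrix_exp (cscale (- (2 * pi * \<i> * \<tau>)) (exponent (\<rho> T_mat))) *v F \<tau> = f (exp (2 * pi * \<i> * \<tau>))"
      using F by (auto simp: vvmf_def)
    have "q_expansion (x i) (\<lambda>\<tau>. F \<tau> $ i) (\<lambda>q. f q $ i)" for i
      unfolding q_expansion_def using f unfolding E E' by (simp add: nome_def)
    then show "\<forall>i. \<exists>g. q_expansion (x i) (\<lambda>\<tau>. F \<tau> $ i) g" by blast
  next
    assume F: "(\<forall>\<tau>. \<tau> \<notin> uhp \<longrightarrow> F \<tau> = 0) \<and> transforms \<rho> k F \<and> (\<forall>i. \<exists>g. q_expansion (x i) (\<lambda>\<tau>. F \<tau> $ i) g)"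
    then obtain g where g: "\<And>i. q_expansion (x i) (\<lambda>\<tau>. F \<tau> $ i) (g i)" by metis
    have T: "F (\<tau> + 1) = \<rho> T_mat *v F \<tau>" if "\<tau> \<in> uhp" for \<tau>
      using q_expansion_T[OF g that] by (simp add: \<rho>(2) vec_eq_iff diag_mult_vec)
    have "F (mob \<gamma> \<tau>) = jac \<gamma> \<tau> powi k *s (\<rho> \<gamma> *v F \<tau>)" if "\<gamma> \<in> carrier SL2Z" "\<tau> \<in> uhp" for \<gamma> \<tau>
      by (rule transform_all[where F = F and k = k, OF \<rho>(1) _ T that]) (use F in \<open>auto simp: transforms_def\<close>)
    moreover have "\<exists>f. (\<forall>i. (\<lambda>q. f q $ i) holomorphic_on ball 0 1) \<and>
        (\<forall>\<tau>\<in>uhp. matrix_exp (cscale (- (2 * pi * \<i> * \<tau>)) (exponent (\<rho> T_mat))) *v F \<tau> =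
                f (exp (2 * pi * \<i> * \<tau>)))"
      unfolding E E' by (intro exI[of _ "\<lambda>q. \<chi> i. g i q"]) (use g in \<open>auto simp: q_expansion_def nome_def\<close>)
    moreover have "(\<lambda>\<tau>. F \<tau> $ i) holomorphic_on uhp" for i
      using q_expansion_holomorphic[OF g] .
    ultimately show "F \<in> vvmf \<rho> k" using F by (simp add: vvmf_def mob_def jac_def)
  qed
qed

lemma vvmf_chi_iff:
  assumes "0 \<le> x" "x < 6"
  shows "G \<in> vvmf (chi (2 * x)) k \<longleftrightarrow> (\<forall>\<tau>. \<tau> \<notin> uhp \<longrightarrow> G \<tau> = 0) \<and> modular x k (\<lambda>\<tau>. G \<tau> $ 1)"
proof -
  have "chi (2 * x) T_mat = diag (\<lambda>i. lam x)"
    by (simp add: chi_even vec_eq_iff diag_nth mat_def)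
  from vvmf_iff[OF chi_even(1) this, of G k] assms
  show ?thesis
    by (auto simp: inj_def transforms_def modular_def chi_even vec_eq_iff forall_1 matrix_vector_mult_def
        sum_1 mat_def mult.assoc mult.left_commute)
qed

subsection \<open>The three-dimensional representations\<close>

lemma vector_3_mult_vec:
  "(vector [vector [a, b, c], vector [d, e, f], vector [g, h, i]] :: complex^3^3) *v v =
    vector [a * v$1 + b * v$2 + c * v$3, d * v$1 + e * v$2 + f * v$3, g * v$1 + h * v$2 + i * v$3]"
  by (simp add: vec_eq_iff forall_3 matrix_vector_mult_def sum_3)

definition restrict_vec :: "(complex \<Rightarrow> complex^'n) \<Rightarrow> complex \<Rightarrow> complex^'n" where
  "restrict_vec F = (\<lambda>\<tau>. if \<tau> \<in> uhp then F \<tau> else 0)"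

text \<open>In terms of modules: the forms for one x are free of rank one over R, with generator
  eta^(4 x).\<close>

lemma modular_div_eta4_E_poly:
  assumes "modular x k f"
  obtains p where "E_poly (k - 2 * x) p" "\<And>\<tau>. \<tau> \<in> uhp \<Longrightarrow> f \<tau> = p \<tau> * eta4 \<tau> powi x"
proof -
  have "modular 0 (k - 2 * x) (\<lambda>\<tau>. f \<tau> * eta4 \<tau> powi (- x))"
    using modular_div_eta4[OF assms, of x] by simp
  then obtain p where p: "E_poly (k - 2 * x) p" "\<And>\<tau>. \<tau> \<in> uhp \<Longrightarrow> f \<tau> * eta4 \<tau> powi (- x) = p \<tau>"
    using modular_E_poly by blast
  show ?thesis
  proof (rule that[OF p(1)])
    fix \<tau> assume t: "\<tau> \<in> uhp"
    then show "f \<tau> = p \<tau> * eta4 \<tau> powi x"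
      using eta4_nonzero[OF t] by (simp add: p(2)[OF t, symmetric] power_int_minus field_simps)
  qed
qed

section \<open>A criterion for homogeneous bases\<close>

lemma R_part_off_uhp: "f \<in> R_part k \<Longrightarrow> \<tau> \<notin> uhp \<Longrightarrow> f \<tau> = 0"
  by (auto simp: R_part_def)

text \<open>Homogeneity of \<open>B i\<close> leaves only the component of \<open>r i\<close> of
  weight \<open>k - ks ! i\<close>. The finite support demanded in \<open>R\<close> makes the sum in
  \<open>R_act\<close> a genuine one.\<close>

lemma R_combination_eq:
  fixes B :: "nat \<Rightarrow> complex \<Rightarrow> complex^'n"
  assumes "\<And>i. i < length ks \<Longrightarrow> r i \<in> R"
  shows "R_combination ks B r k \<tau> = (\<Sum>i<length ks. r i (k - ks ! i) \<tau> *s B i \<tau>)"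
  unfolding R_combination_def
proof (rule sum.cong[OF refl])
  fix i assume "i \<in> {..<length ks}"
  then have fin: "finite {j. r i j \<noteq> (\<lambda>\<tau>. 0)}" using assms by (auto simp: R_def)
  have "R_act (r i) (homogeneous (ks ! i) (B i)) k \<tau> =
      (\<Sum>j\<in>{j. r i j \<noteq> (\<lambda>\<tau>. 0)}. if j = k - ks ! i then r i j \<tau> *s B i \<tau> else 0)"
    unfolding R_act_def homogeneous_def by (intro sum.cong) (auto simp: algebra_simps)
  also have "\<dots> = r i (k - ks ! i) \<tau> *s B i \<tau>"
    using fin by (auto simp: sum.delta)
  finally show "R_act (r i) (homogeneous (ks ! i) (B i)) k \<tau> = r i (k - ks ! i) \<tau> *s B i \<tau>" .
qed

text \<open>Linear independence is required pointwise; it also makes the coefficient families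
  finitely supported.\<close>

lemma homogeneous_basisI:
  fixes B :: "nat \<Rightarrow> complex \<Rightarrow> complex^'n"
  assumes B: "\<And>i. i < length ks \<Longrightarrow> B i \<in> vvmf \<rho> (ks ! i)"
    and span: "\<And>k F. F \<in> vvmf \<rho> k \<Longrightarrow> \<exists>c. (\<forall>i<length ks. E_poly (k - ks ! i) (c i)) \<and>
       (\<forall>\<tau>\<in>uhp. F \<tau> = (\<Sum>i<length ks. c i \<tau> *s B i \<tau>))"
    and indep: "\<And>\<tau> a i. \<tau> \<in> uhp \<Longrightarrow> (\<Sum>i<length ks. a i *s B i \<tau>) = 0 \<Longrightarrow> i < length ks \<Longrightarrow> a i = 0"
  shows "homogeneous_basis \<rho> ks B"
  unfolding homogeneous_basis_def
proof (intro conjI allI impI ballI)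
  fix i assume "i < length ks"
  then show "B i \<in> vvmf \<rho> (ks ! i)" by (rule B)
next
  fix F assume F: "F \<in> vvmf_module \<rho>"
  then have Fk: "F k \<in> vvmf \<rho> k" for k by (simp add: vvmf_module_def)
  have "\<forall>k. \<exists>c. (\<forall>i<length ks. E_poly (k - ks ! i) (c i)) \<and>
       (\<forall>\<tau>\<in>uhp. F k \<tau> = (\<Sum>i<length ks. c i \<tau> *s B i \<tau>))"
    using span[OF Fk] by blast
  then obtain c where c: "\<And>k i. i < length ks \<Longrightarrow> E_poly (k - ks ! i) (c k i)"
    "\<And>k \<tau>. \<tau> \<in> uhp \<Longrightarrow> F k \<tau> = (\<Sum>i<length ks. c k i \<tau> *s B i \<tau>)"
    by metis
  \<comment> \<open>A component of \<open>r i\<close> is indexed by its own weight \<open>l\<close>;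
    the form whose coefficient it is has weight \<open>l + ks ! i\<close>.\<close>
  define r where "r = (\<lambda>i l. restrict_uhp (c (l + ks ! i) i))"
  have r: "r i \<in> R" if i: "i < length ks" for i
    unfolding R_def
  proof (intro CollectI conjI allI)
    fix l
    show "r i l \<in> R_part l" unfolding r_def using c(1)[OF i, of "l + ks ! i"] by (auto intro: E_poly_R_part)
  next
    have "{l. r i l \<noteq> (\<lambda>\<tau>. 0)} \<subseteq> (\<lambda>k. k - ks ! i) ` {k. F k \<noteq> (\<lambda>\<tau>. 0)}"
    proof
      fix l assume "l \<in> {l. r i l \<noteq> (\<lambda>\<tau>. 0)}"
      then obtain \<tau> where \<tau>: "\<tau> \<in> uhp" "c (l + ks ! i) i \<tau> \<noteq> 0"
        by (auto simp: r_def restrict_uhp_def fun_eq_iff split: if_splits)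
      have "F (l + ks ! i) \<noteq> (\<lambda>\<tau>. 0)"
      proof
        assume "F (l + ks ! i) = (\<lambda>\<tau>. 0)"
        then have "(\<Sum>j<length ks. c (l + ks ! i) j \<tau> *s B j \<tau>) = 0" using c(2)[OF \<tau>(1)] by metis
        from indep[OF \<tau>(1) this i] \<tau>(2) show False by simp
      qed
      then show "l \<in> (\<lambda>k. k - ks ! i) ` {k. F k \<noteq> (\<lambda>\<tau>. 0)}" by (intro image_eqI[of _ _ "l + ks ! i"]) auto
    qed
    then show "finite {l. r i l \<noteq> (\<lambda>\<tau>. 0)}"
      by (rule finite_subset) (use F in \<open>simp add: vvmf_module_def\<close>)
  qed
  show "\<exists>r. (\<forall>i<length ks. r i \<in> R) \<and> F = R_combination ks B r"
  proof (intro exI conjI allI impI)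
    show "F = R_combination ks B r"
    proof (intro ext)
      fix k \<tau>
      show "F k \<tau> = R_combination ks B r k \<tau>"
      proof (cases "\<tau> \<in> uhp")
        case True
        then show ?thesis using c(2)[OF True, of k] by (simp add: R_combination_eq r) (simp add: r_def restrict_uhp_def)
      next
        case False
        then have "F k \<tau> = 0" using Fk by (simp add: vvmf_def)
        with False show ?thesis by (simp add: R_combination_eq r) (simp add: r_def restrict_uhp_def)
      qed
    qed
  qed (rule r)
next
  fix r i assume r: "(\<forall>i<length ks. r i \<in> R) \<and> R_combination ks B r = (\<lambda>k \<tau>. 0)" and i: "i < length ks"
  show "r i = (\<lambda>k \<tau>. 0)"
  proof (intro ext)
    fix l \<tau>
    show "r i l \<tau> = 0"
    proof (cases "\<tau> \<in> uhp")
      case True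
      have "R_combination ks B r (l + ks ! i) \<tau> = 0" using r by simp
      then have "(\<Sum>j<length ks. r j (l + ks ! i - ks ! j) \<tau> *s B j \<tau>) = 0"
        using R_combination_eq[of ks r B "l + ks ! i" \<tau>] r by simp
      from indep[OF True this i] show ?thesis by simp
    next
      case False
      have "r i l \<in> R_part l" using r i by (simp add: R_def)
      then show ?thesis using False by (rule R_part_off_uhp)
    qed
  qed
qed

text \<open>In every triple x1 = x3 + 1 and x2 = x3 - 1 modulo 6. The reduction is harmless for x1
  at x3 = 5, where the exponent of the function exceeds the required one by 6, and fatal for x2 at
  x3 = 0, where it is -1 instead of 5.\<close>

locale rho_triple =
  fixes x1 x2 x3 :: int
  assumes triple: "(x1, x2, x3) \<in> {(1,5,0), (2,0,1), (3,1,2), (4,2,3), (5,3,4), (0,4,5)}"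
begin

abbreviation \<sigma> :: complex where "\<sigma> \<equiv> (- 1) powi x3"

lemma x_bounds: "0 \<le> x1" "x1 < 6" "0 \<le> x2" "x2 < 6" "0 \<le> x3" "x3 < 6"
  using triple by auto

lemma x1_cases: "x1 = x3 + 1 \<or> x3 + 1 = x1 + 6 * int 1"
  using triple by auto

lemma x2_eq: "x3 \<noteq> 0 \<Longrightarrow> x2 = x3 - 1"
  using triple by auto

lemma x_zero: "x3 = 0 \<Longrightarrow> x1 = 1" "x3 = 0 \<Longrightarrow> x2 = 5"
  using triple by auto

lemma lam_x: "lam x1 = lam 1 * lam x3" "lam x2 = lam (- 1) * lam x3"
  unfolding lam_add[symmetric] lam_eq_iff using triple by auto

lemma sgn_x: "(- 1 :: complex) powi x1 = - \<sigma>" "(- 1 :: complex) powi x2 = - \<sigma>"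
  using triple by auto

lemma sigma_square [simp]: "\<sigma> * \<sigma> = 1"
  by simp

lemma lam_distinct: "lam x1 \<noteq> lam x2" "lam x1 \<noteq> lam x3" "lam x2 \<noteq> lam x3"
  unfolding lam_eq_iff using triple by auto

text \<open>eta^(4 x3) (\<sigma> g1, \<sigma> g2, 1) with the two Eichler integrals. The signs
  \<sigma> are chosen so that g \<mapsto> 1 - g under S produces the entries 1 in the last column of
  \<rho>(S).\<close>

definition Phi :: "complex \<Rightarrow> complex^3" where
  "Phi \<tau> = vector [\<sigma> * eichler 1 \<tau> * eta4 \<tau> powi x3, \<sigma> * eichler (- 1) \<tau> * eta4 \<tau> powi x3, eta4 \<tau> powi x3]"

lemma Phi_S:
  assumes "\<tau> \<in> uhp"
  shows "Phi (- 1 / \<tau>) $ 1 = \<tau> powi (2 * x3) * (Phi \<tau> $ 3 - \<sigma> * Phi \<tau> $ 1)"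
    "Phi (- 1 / \<tau>) $ 2 = \<tau> powi (2 * x3) * (Phi \<tau> $ 3 - \<sigma> * Phi \<tau> $ 2)"
    "Phi (- 1 / \<tau>) $ 3 = \<tau> powi (2 * x3) * (\<sigma> * Phi \<tau> $ 3)"
proof -
  have alg: "s * (1 - g) * (s * t * e) = t * (e - s * (s * g * e))" "s * t * e = t * (s * e)"
    if "s * s = 1" for s t g e :: complex
    using that by (algebra, simp add: mult_ac)
  note S = modular_S[OF modular_eta4_powi assms, of x3] eichler_S[OF assms]
  show "Phi (- 1 / \<tau>) $ 1 = \<tau> powi (2 * x3) * (Phi \<tau> $ 3 - \<sigma> * Phi \<tau> $ 1)"
    "Phi (- 1 / \<tau>) $ 2 = \<tau> powi (2 * x3) * (Phi \<tau> $ 3 - \<sigma> * Phi \<tau> $ 2)"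
    "Phi (- 1 / \<tau>) $ 3 = \<tau> powi (2 * x3) * (\<sigma> * Phi \<tau> $ 3)"
    unfolding Phi_def vector_3 S by (rule alg[OF sigma_square])+
qed

lemma Phi_T:
  assumes "\<tau> \<in> uhp"
  shows "Phi (\<tau> + 1) $ 1 = lam x1 * Phi \<tau> $ 1" "Phi (\<tau> + 1) $ 2 = lam x2 * Phi \<tau> $ 2"
    "Phi (\<tau> + 1) $ 3 = lam x3 * Phi \<tau> $ 3"
  unfolding Phi_def vector_3 eichler_T[OF assms] modular_T[OF modular_eta4_powi assms] lam_x
  by (simp_all only: mult_ac)

text \<open>Applying a linear relation at \<open>\<i>\<close>, \<open>\<i> + 1\<close> and \<open>\<i> + 2\<close> separates the three coordinates,
  which are nonzero at \<open>\<i>\<close>.\<close>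

lemma Phi_independent:
  assumes "\<And>\<tau>. \<tau> \<in> uhp \<Longrightarrow> C *v Phi \<tau> = D *v Phi \<tau>"
  shows "C = (D :: complex^3^3)"
proof -
  have "C $ i $ j = D $ i $ j" for i j
  proof -
    let ?d = "\<lambda>j. C $ i $ j - D $ i $ j"
    have rel: "?d 1 * Phi \<tau> $ 1 + ?d 2 * Phi \<tau> $ 2 + ?d 3 * Phi \<tau> $ 3 = 0" if "\<tau> \<in> uhp" for \<tau>
    proof -
      have "(C *v Phi \<tau>) $ i = (D *v Phi \<tau>) $ i" using assms[OF that] by simp
      then show ?thesis by (simp add: matrix_vector_mult_def sum_3 algebra_simps)
    qed
    define u v w where "u = ?d 1 * Phi \<i> $ 1" and "v = ?d 2 * Phi \<i> $ 2" and "w = ?d 3 * Phi \<i> $ 3"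
    note u1 = uhp_plus_1[OF i_in_uhp]
    have r0: "u + v + w = 0" using rel[OF i_in_uhp] by (simp add: u_def v_def w_def)
    have r1: "lam x1 * u + lam x2 * v + lam x3 * w = 0"
      using rel[OF u1] unfolding Phi_T[OF i_in_uhp] by (simp add: u_def v_def w_def mult_ac)
    have r2: "lam x1 * lam x1 * u + lam x2 * lam x2 * v + lam x3 * lam x3 * w = 0"
      using rel[OF uhp_plus_1[OF u1]] unfolding Phi_T[OF u1] Phi_T[OF i_in_uhp]
      by (simp add: u_def v_def w_def mult_ac)
    have "(lam x1 - lam x2) * (lam x1 - lam x3) * u = 0" using r0 r1 r2 by algebra
    then have "u = 0" using lam_distinct by simp
    have "(lam x2 - lam x1) * (lam x2 - lam x3) * v = 0" using r0 r1 r2 by algebra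
    then have "v = 0" using lam_distinct by simp
    with \<open>u = 0\<close> r0 have "w = 0" by simp
    have "Phi \<i> $ 1 \<noteq> 0" "Phi \<i> $ 2 \<noteq> 0" "Phi \<i> $ 3 \<noteq> 0"
      using eta4_nonzero[OF i_in_uhp] by (simp_all add: Phi_def eichler_i)
    with \<open>u = 0\<close> \<open>v = 0\<close> \<open>w = 0\<close> have "?d 1 = 0" "?d 2 = 0" "?d 3 = 0"
      by (simp_all add: u_def v_def w_def)
    then have "\<forall>j. ?d j = 0" unfolding forall_3 by blast
    then show ?thesis by simp
  qed
  then show ?thesis by (simp add: vec_eq_iff)
qed

definition xs :: "3 \<Rightarrow> int" where
  "xs i = (if i = 1 then x1 else if i = 2 then x2 else x3)"

lemma xs_nth [simp]: "xs 1 = x1" "xs 2 = x2" "xs 3 = x3"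
  by (simp_all add: xs_def)

lemma T_diag: "vector [vector [lam x1, 0, 0], vector [0, lam x2, 0], vector [0, 0, lam x3]] = diag (\<lambda>i. lam (xs i))"
  by (simp add: vec_eq_iff forall_3 diag_nth)

lemma ex_rho: "\<exists>\<rho>. is_rho x1 x2 x3 \<rho>"
proof -
  let ?A = "vector [vector [- \<sigma>, 0, 1], vector [0, - \<sigma>, 1], vector [0, 0, \<sigma>]] :: complex^3^3"
  obtain \<rho> where "PSL2Z_representation \<rho>" "\<rho> \<in> extensional (carrier SL2Z)" "\<rho> S_mat = ?A"
    "\<rho> T_mat = diag (\<lambda>i. lam (xs i))"
  proof (rule representation_from_functions[of Phi "2 * x3" ?A "diag (\<lambda>i. lam (xs i))"])
    fix \<tau> assume t: "\<tau> \<in> uhp"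
    show "Phi (- 1 / \<tau>) = \<tau> powi (2 * x3) *s (?A *v Phi \<tau>)"
      unfolding vec_eq_iff forall_3 Phi_S[OF t] vector_3_mult_vec by (simp add: algebra_simps)
    show "Phi (\<tau> + 1) = diag (\<lambda>i. lam (xs i)) *v Phi \<tau>"
      unfolding vec_eq_iff forall_3 Phi_T[OF t] diag_mult_vec by simp
  qed (use Phi_independent in auto)
  then show ?thesis unfolding is_rho_def T_diag lam_cube Let_def by blast
qed

lemma rho_unique: "is_rho x1 x2 x3 \<rho> \<Longrightarrow> is_rho x1 x2 x3 \<rho>' \<Longrightarrow> \<rho> = \<rho>'"
  by (rule representation_extensional_unique) (simp_all add: is_rho_def PSL2Z_representation_def Let_def)

context
  fixes \<rho> :: "int^2^2 \<Rightarrow> complex^3^3"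
  assumes rho: "is_rho x1 x2 x3 \<rho>"
begin

lemma rho_representation: "representation \<rho>"
  using rho by (simp add: is_rho_def PSL2Z_representation_def)

lemma rho_T: "\<rho> T_mat = diag (\<lambda>i. lam (xs i))"
  using rho by (simp add: is_rho_def T_diag)

lemma rho_S: "\<rho> S_mat = vector [vector [- \<sigma>, 0, 1], vector [0, - \<sigma>, 1], vector [0, 0, \<sigma>]]"
  using rho by (simp add: is_rho_def lam_cube Let_def)

lemma vvmf_rho_iff:
  "F \<in> vvmf \<rho> k \<longleftrightarrow> (\<forall>\<tau>. \<tau> \<notin> uhp \<longrightarrow> F \<tau> = 0) \<and>
     (\<exists>g. q_expansion x1 (\<lambda>\<tau>. F \<tau> $ 1) g) \<and> (\<exists>g. q_expansion x2 (\<lambda>\<tau>. F \<tau> $ 2) g) \<and>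
     (\<exists>g. q_expansion x3 (\<lambda>\<tau>. F \<tau> $ 3) g) \<and>
     (\<forall>\<tau>\<in>uhp. F (- 1 / \<tau>) $ 1 = \<tau> powi k * (F \<tau> $ 3 - \<sigma> * F \<tau> $ 1) \<and>
        F (- 1 / \<tau>) $ 2 = \<tau> powi k * (F \<tau> $ 3 - \<sigma> * F \<tau> $ 2) \<and>
        F (- 1 / \<tau>) $ 3 = \<tau> powi k * (\<sigma> * F \<tau> $ 3))"
proof -
  have "inj xs"
  proof (rule injI)
    fix i j assume "xs i = xs j"
    then have "lam (xs i) = lam (xs j)" by simp
    moreover have "i \<in> {1, 2, 3}" "j \<in> {1, 2, 3}" using UNIV_3 by auto
    ultimately show "i = j" using lam_distinct by auto
  qed
  moreover have "0 \<le> xs i" "xs i < 6" for i using x_bounds by (auto simp: xs_def)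
  moreover have "transforms \<rho> k F \<longleftrightarrow>
     (\<forall>\<tau>\<in>uhp. F (- 1 / \<tau>) $ 1 = \<tau> powi k * (F \<tau> $ 3 - \<sigma> * F \<tau> $ 1) \<and>
        F (- 1 / \<tau>) $ 2 = \<tau> powi k * (F \<tau> $ 3 - \<sigma> * F \<tau> $ 2) \<and>
        F (- 1 / \<tau>) $ 3 = \<tau> powi k * (\<sigma> * F \<tau> $ 3))"
    unfolding transforms_def rho_S vector_3_mult_vec vec_eq_iff forall_3
    by (simp add: add.commute)
  ultimately show ?thesis
    using vvmf_iff[OF rho_representation rho_T, of F k] by (auto simp: forall_3)
qed

lemma restrict_vec_in_vvmf:
  assumes "q_expansion x1 (\<lambda>\<tau>. F \<tau> $ 1) g1" "q_expansion x2 (\<lambda>\<tau>. F \<tau> $ 2) g2"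
    "q_expansion x3 (\<lambda>\<tau>. F \<tau> $ 3) g3"
    "\<And>\<tau>. \<tau> \<in> uhp \<Longrightarrow> F (- 1 / \<tau>) $ 1 = \<tau> powi k * (F \<tau> $ 3 - \<sigma> * F \<tau> $ 1)"
    "\<And>\<tau>. \<tau> \<in> uhp \<Longrightarrow> F (- 1 / \<tau>) $ 2 = \<tau> powi k * (F \<tau> $ 3 - \<sigma> * F \<tau> $ 2)"
    "\<And>\<tau>. \<tau> \<in> uhp \<Longrightarrow> F (- 1 / \<tau>) $ 3 = \<tau> powi k * (\<sigma> * F \<tau> $ 3)"
  shows "restrict_vec F \<in> vvmf \<rho> k"
proof -
  have "q_expansion (xs i) (\<lambda>\<tau>. restrict_vec F \<tau> $ i) g" if "q_expansion (xs i) (\<lambda>\<tau>. F \<tau> $ i) g" for i g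
    by (rule q_expansion_cong[OF that]) (simp add: restrict_vec_def)
  from this[of 1 g1] this[of 2 g2] this[of 3 g3] show ?thesis
    unfolding vvmf_rho_iff using assms uhp_minus_inverse by (auto simp: restrict_vec_def)
qed

lemma vvmf_third_modular: "F \<in> vvmf \<rho> k \<Longrightarrow> modular x3 k (\<lambda>\<tau>. F \<tau> $ 3)"
  by (auto simp: vvmf_rho_iff intro!: modularI)

lemma vvmf_multiple:
  assumes p: "modular 0 l p" and H: "restrict_vec H \<in> vvmf \<rho> m"
  shows "restrict_vec (\<lambda>\<tau>. p \<tau> *s H \<tau>) \<in> vvmf \<rho> (l + m)"
proof -
  obtain e where e: "q_expansion 0 p e" using p by (auto simp: modular_def)
  note Hm = H[unfolded vvmf_rho_iff]
  from Hm obtain g1 g2 g3 where "q_expansion x1 (\<lambda>\<tau>. restrict_vec H \<tau> $ 1) g1"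
    "q_expansion x2 (\<lambda>\<tau>. restrict_vec H \<tau> $ 2) g2" "q_expansion x3 (\<lambda>\<tau>. restrict_vec H \<tau> $ 3) g3"
    by blast
  then have g: "q_expansion x1 (\<lambda>\<tau>. H \<tau> $ 1) g1"
    "q_expansion x2 (\<lambda>\<tau>. H \<tau> $ 2) g2" "q_expansion x3 (\<lambda>\<tau>. H \<tau> $ 3) g3"
    by (auto elim!: q_expansion_cong simp: restrict_vec_def)
  have S: "H (- 1 / \<tau>) $ 1 = \<tau> powi m * (H \<tau> $ 3 - \<sigma> * H \<tau> $ 1)"
    "H (- 1 / \<tau>) $ 2 = \<tau> powi m * (H \<tau> $ 3 - \<sigma> * H \<tau> $ 2)"
    "H (- 1 / \<tau>) $ 3 = \<tau> powi m * (\<sigma> * H \<tau> $ 3)" if "\<tau> \<in> uhp" for \<tau>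
    using Hm that uhp_minus_inverse[OF that] by (auto simp: restrict_vec_def)
  have P: "p (- 1 / \<tau>) = \<tau> powi l * p \<tau>" "\<tau> powi (l + m) = \<tau> powi l * \<tau> powi m" if "\<tau> \<in> uhp" for \<tau>
    using modular_S[OF p that] uhp_nonzero[OF that] by (simp_all add: power_int_add)
  show ?thesis
    by (rule restrict_vec_in_vvmf)
      (use q_expansion_mult[OF e g(1)] q_expansion_mult[OF e g(2)] q_expansion_mult[OF e g(3)]
       in \<open>simp_all only: vector_smult_component add_0 S P algebra_simps\<close>)
qed

lemma vvmf_add:
  assumes "F \<in> vvmf \<rho> k" "G \<in> vvmf \<rho> k"
  shows "(\<lambda>\<tau>. F \<tau> + G \<tau>) \<in> vvmf \<rho> k"
  unfolding vvmf_rho_iff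
proof (intro conjI allI impI ballI)
  note FG = assms[unfolded vvmf_rho_iff]
  show "\<exists>g. q_expansion x1 (\<lambda>\<tau>. (F \<tau> + G \<tau>) $ 1) g" "\<exists>g. q_expansion x2 (\<lambda>\<tau>. (F \<tau> + G \<tau>) $ 2) g"
    "\<exists>g. q_expansion x3 (\<lambda>\<tau>. (F \<tau> + G \<tau>) $ 3) g"
    using FG q_expansion_add unfolding vector_add_component by blast+
qed (use assms[unfolded vvmf_rho_iff] in \<open>simp_all add: algebra_simps\<close>)

end

end

section \<open>The exact sequence and its projections\<close>

lemma chi_even_nth:
  "chi (2 * x) S_mat $ 1 $ 1 = (- 1) powi x" "chi (2 * x) T_mat $ 1 $ 1 = lam x" "chi (2 * x) (mat 1) $ 1 $ 1 = 1"
  by (simp_all add: chi_even hom_one_GL[OF chi_even(1)]) (simp_all add: mat_def)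

lemma chi_even_mult:
  "\<gamma> \<in> carrier SL2Z \<Longrightarrow> \<delta> \<in> carrier SL2Z \<Longrightarrow>
    chi (2 * x) (\<gamma> ** \<delta>) $ 1 $ 1 = chi (2 * x) \<gamma> $ 1 $ 1 * chi (2 * x) \<delta> $ 1 $ 1"
  by (simp add: representation_mult[OF chi_even(1)] matrix_1_mult)

text \<open>The complement of an invariant \<open>W\<close> is spanned by the coordinate axes not contained in \<open>W\<close>.\<close>

lemma completely_reducible_diag:
  fixes \<rho>0 :: "int^2^2 \<Rightarrow> complex^2^2"
  assumes diag: "\<And>\<gamma>. \<rho>0 \<gamma> = diag (d \<gamma>)" and "d T_mat 1 \<noteq> d T_mat 2"
  shows "completely_reducible \<rho>0"
  unfolding completely_reducible_def
proof (intro allI impI)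
  fix W assume "invariant_subspace \<rho>0 W"
  then have sub: "vec.subspace W" and inv: "\<And>\<gamma> v. \<gamma> \<in> carrier SL2Z \<Longrightarrow> v \<in> W \<Longrightarrow> \<rho>0 \<gamma> *v v \<in> W"
    by (auto simp: invariant_subspace_def)
  let ?e = "\<lambda>i::2. axis i 1 :: complex^2"
  define W' where "W' = {v :: complex^2. \<forall>i. ?e i \<in> W \<longrightarrow> v $ i = 0}"
  have "invariant_subspace \<rho>0 W'"
    unfolding invariant_subspace_def W'_def vec.subspace_def
    by (auto simp: diag diag_mult_vec)
  moreover have "W \<inter> W' = {0}"
  proof -
    have "v = 0" if v: "v \<in> W" "v \<in> W'" for v
    proof -
      have T: "\<rho>0 T_mat *v v \<in> W" using inv[OF SL2Z_generators(4) v(1)] .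
      have mem: "c *s (\<rho>0 T_mat *v v - b *s v) \<in> W" for b c
        by (intro vec.subspace_scale vec.subspace_diff sub T v)
      \<comment> \<open>Applying \<rho>0(T) - d_j removes the coordinate j and scales the coordinate
        i by d_i - d_j \<noteq> 0. A vector of W with nonzero i-th coordinate thus puts the i-th
        axis into W, against membership in W'.\<close>
      have "v $ i = 0" if "i \<noteq> j" and ij: "\<And>k. k = i \<or> k = j" and dd: "d T_mat i \<noteq> d T_mat j" for i j
      proof (rule ccontr)
        assume nz: "v $ i \<noteq> 0"
        have "(1 / (v $ i * (d T_mat i - d T_mat j))) *s (\<rho>0 T_mat *v v - d T_mat j *s v) = ?e i"
          unfolding vec_eq_iff
        proof
          fix k
          show "((1 / (v $ i * (d T_mat i - d T_mat j))) *s (\<rho>0 T_mat *v v - d T_mat j *s v)) $ k = ?e i $ k"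
            using ij[of k] nz dd \<open>i \<noteq> j\<close>
            by (auto simp: diag diag_mult_vec axis_def left_diff_distrib[symmetric] diff_divide_distrib[symmetric])
        qed
        then have "?e i \<in> W" using mem by metis
        with v(2) nz show False by (auto simp: W'_def)
      qed
      note coord = this
      have "v $ 1 = 0" by (rule coord[of 1 2, OF _ exhaust_2 assms(2)]) simp
      moreover have swap: "k = 2 \<or> k = 1" for k :: 2 using exhaust_2[of k] by blast
      have "v $ 2 = 0" by (rule coord[of 2 1, OF _ swap assms(2)[symmetric]]) simp
      ultimately show "v = 0" by (simp add: vec_eq_iff forall_2)
    qed
    moreover have "0 \<in> W" using sub by (rule vec.subspace_0)
    ultimately show ?thesis by (auto simp: W'_def)
  qed
  moreover have "{w + w' | w w'. w \<in> W \<and> w' \<in> W'} = UNIV"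
  proof -
    have "\<exists>w w'. v = w + w' \<and> w \<in> W \<and> w' \<in> W'" for v :: "complex^2"
    proof (intro exI conjI)
      let ?w = "\<Sum>i\<in>UNIV. if ?e i \<in> W then v $ i *s ?e i else 0"
      show "?w \<in> W"
        by (intro vec.subspace_sum sub) (auto intro: vec.subspace_scale sub vec.subspace_0)
      show "v = ?w + (v - ?w)" by simp
      have "?e i \<in> W \<longrightarrow> (v - ?w) $ i = 0" for i
        using exhaust_2[of i] by (elim disjE) (auto simp: sum_2 axis_def)
      then show "v - ?w \<in> W'" unfolding W'_def by blast
    qed
    then show ?thesis by auto
  qed
  ultimately show "\<exists>W'. invariant_subspace \<rho>0 W' \<and> W \<inter> W' = {0} \<and> {w + w' | w w'. w \<in> W \<and> w' \<in> W'} = UNIV"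
    by blast
qed

context rho_triple
begin

context
  fixes \<rho> :: "int^2^2 \<Rightarrow> complex^3^3"
  assumes rho: "is_rho x1 x2 x3 \<rho>"
begin

text \<open>\<rho>(S) and \<rho>(T) have this shape, which is stable under multiplication, and the
  diagonal entries multiply like characters. The entries (1, 3) and (2, 3) carry the extension and
  stay free.\<close>

lemma rho_entries:
  assumes "\<gamma> \<in> carrier SL2Z"
  shows "\<rho> \<gamma> $ 1 $ 1 = chi (2 * x1) \<gamma> $ 1 $ 1 \<and> \<rho> \<gamma> $ 1 $ 2 = 0 \<and> \<rho> \<gamma> $ 2 $ 1 = 0 \<and>
    \<rho> \<gamma> $ 2 $ 2 = chi (2 * x2) \<gamma> $ 1 $ 1 \<and> \<rho> \<gamma> $ 3 $ 1 = 0 \<and> \<rho> \<gamma> $ 3 $ 2 = 0 \<and>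
    \<rho> \<gamma> $ 3 $ 3 = chi (2 * x3) \<gamma> $ 1 $ 1"
  using assms
proof (induction \<gamma> rule: SL2Z_induct)
  case one
  show ?case
    by (simp add: hom_one_GL[OF rho_representation[OF rho]] chi_even_nth(3)) (simp add: mat_def)
next
  case (S \<gamma>)
  note g = SL2Z_generators(3)
  show ?case
    using S(2)
    unfolding representation_mult[OF rho_representation[OF rho] g S(1)] chi_even_mult[OF g S(1)] chi_even_nth
    by (simp add: rho_S[OF rho] sgn_x matrix_matrix_mult_def sum_3)
next
  case (T \<gamma>)
  note g = SL2Z_generators(4)
  show ?case
    using T(2)
    unfolding representation_mult[OF rho_representation[OF rho] g T(1)] chi_even_mult[OF g T(1)] chi_even_nth
    by (simp add: rho_T[OF rho] diag_mult_left)
qed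

lemma ex_extension: "\<exists>\<rho>0 \<iota> p. is_extension x1 x2 x3 \<rho>0 \<iota> \<rho> p"
proof -
  define d where "d = (\<lambda>\<gamma> (i::2). if i = 1 then chi (2 * x1) \<gamma> $ 1 $ 1 else chi (2 * x2) \<gamma> $ 1 $ 1)"
  define \<rho>0 where "\<rho>0 = (\<lambda>\<gamma>. diag (d \<gamma>))"
  define \<iota> :: "complex^2^3" where "\<iota> = vector [vector [1, 0], vector [0, 1], vector [0, 0]]"
  define p :: "complex^3^1" where "p = vector [vector [0, 0, 1]]"
  have \<iota>v: "\<iota> *v v = vector [v $ 1, v $ 2, 0]" for v
    by (simp add: \<iota>_def vec_eq_iff forall_3 matrix_vector_mult_def sum_2)
  have pv: "(p *v v) $ 1 = v $ 3" for v
    by (simp add: p_def matrix_vector_mult_def sum_3)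
  have rep0: "representation \<rho>0"
  proof (rule representationI)
    show "\<rho>0 (mat 1) = mat 1" by (simp add: \<rho>0_def d_def vec_eq_iff diag_nth chi_even_nth) (simp add: mat_def)
    fix \<gamma> \<delta> assume "\<gamma> \<in> carrier SL2Z" "\<delta> \<in> carrier SL2Z"
    then show "\<rho>0 (\<gamma> ** \<delta>) = \<rho>0 \<gamma> ** \<rho>0 \<delta>"
      by (simp add: \<rho>0_def d_def vec_eq_iff diag_mult_left) (simp add: diag_nth chi_even_mult)
  qed
  have "exact_sequence \<rho>0 \<iota> \<rho> p (chi (2 * x3))"
    unfolding exact_sequence_def
  proof (intro conjI rep0 chi_even rho_representation[OF rho])
    show "intertwines \<iota> \<rho>0 \<rho>"
      unfolding intertwines_def
      by (auto simp: vec_eq_iff forall_3 forall_2 \<rho>0_def diag_mult_right matrix_matrix_mult_def[of "\<rho> _"] sum_3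
          \<iota>_def rho_entries d_def)
    show "intertwines p \<rho> (chi (2 * x3))"
      unfolding intertwines_def
      by (auto simp: vec_eq_iff forall_3 forall_1 matrix_matrix_mult_def sum_3 sum_1 p_def rho_entries)
    show "inj ((*v) \<iota>)"
      by (rule injI) (simp add: \<iota>v vec_eq_iff forall_3 forall_2)
    show "surj ((*v) p)"
    proof (rule surjI)
      fix w :: "complex^1"
      show "p *v vector [0, 0, w $ 1] = w" by (simp add: vec_eq_iff forall_1 pv)
    qed
    show "range ((*v) \<iota>) = {v. p *v v = 0}"
    proof (intro equalityI subsetI)
      fix v assume "v \<in> {v. p *v v = 0}"
      then have "v $ 3 = 0" using pv[of v] by simp
      then have "v = \<iota> *v vector [v $ 1, v $ 2]" by (simp add: \<iota>v vec_eq_iff forall_3)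
      then show "v \<in> range ((*v) \<iota>)" by blast
    qed (auto simp: vec_eq_iff forall_1 pv \<iota>v)
  qed
  moreover have "rep_iso \<rho>0 (rep_sum (chi (2 * x1)) (chi (2 * x2)))"
  proof -
    define P :: "complex^2^(1 + 1)" where
      "P = (\<chi> i j. case i of Inl _ \<Rightarrow> if j = 1 then 1 else 0 | Inr _ \<Rightarrow> if j = 2 then 1 else 0)"
    have Pv: "(P *v v) $ i = (case i of Inl _ \<Rightarrow> v $ 1 | Inr _ \<Rightarrow> v $ 2)" for v i
      by (cases i) (simp_all add: P_def matrix_vector_mult_def sum_2)
    have sum_diag: "rep_sum (chi (2 * x1)) (chi (2 * x2)) \<gamma> =
        diag (\<lambda>i. case i of Inl _ \<Rightarrow> chi (2 * x1) \<gamma> $ 1 $ 1 | Inr _ \<Rightarrow> chi (2 * x2) \<gamma> $ 1 $ 1)" for \<gamma>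
    proof -
      have Inl_Inr: "i = Inl 1 \<or> i = Inr 1" for i :: "1 + 1" by (cases i) simp_all
      have "rep_sum (chi (2 * x1)) (chi (2 * x2)) \<gamma> $ i $ j =
        diag (\<lambda>i. case i of Inl _ \<Rightarrow> chi (2 * x1) \<gamma> $ 1 $ 1 | Inr _ \<Rightarrow> chi (2 * x2) \<gamma> $ 1 $ 1) $ i $ j" for i j
        using Inl_Inr[of i] Inl_Inr[of j] by (elim disjE) (simp_all add: rep_sum_def diag_nth)
      then show ?thesis by (simp add: vec_eq_iff)
    qed
    have "intertwines P \<rho>0 (rep_sum (chi (2 * x1)) (chi (2 * x2)))"
      unfolding intertwines_def
    proof
      fix \<gamma>
      have "(P ** \<rho>0 \<gamma>) $ i $ j = (rep_sum (chi (2 * x1)) (chi (2 * x2)) \<gamma> ** P) $ i $ j" for i j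
        unfolding sum_diag \<rho>0_def diag_mult_left diag_mult_right
        by (cases i) (auto simp: P_def d_def)
      then show "P ** \<rho>0 \<gamma> = rep_sum (chi (2 * x1)) (chi (2 * x2)) \<gamma> ** P" by (simp add: vec_eq_iff)
    qed
    moreover have "bij ((*v) P)"
    proof (rule bijI)
      show "inj ((*v) P)"
      proof (rule injI)
        fix v w assume "P *v v = P *v w"
        then have "(P *v v) $ Inl 1 = (P *v w) $ Inl 1" "(P *v v) $ Inr 1 = (P *v w) $ Inr 1" by simp_all
        then show "v = w" by (simp add: Pv vec_eq_iff forall_2)
      qed
      show "surj ((*v) P)"
      proof (rule surjI)
        fix w :: "complex^(1 + 1)"
        have "(P *v vector [w $ Inl 1, w $ Inr 1]) $ i = w $ i" for i
        proof (cases i)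
          case (Inl a)
          moreover have "a = 1" by simp
          ultimately show ?thesis by (simp add: Pv)
        next
          case (Inr a)
          moreover have "a = 1" by simp
          ultimately show ?thesis by (simp add: Pv)
        qed
        then show "P *v vector [w $ Inl 1, w $ Inr 1] = w" by (simp add: vec_eq_iff)
      qed
    qed
    ultimately show ?thesis unfolding rep_iso_def by blast
  qed
  moreover have "completely_reducible \<rho>0"
    by (rule completely_reducible_diag[of _ d]) (use lam_distinct in \<open>simp_all add: \<rho>0_def d_def chi_even_nth\<close>)
  ultimately show ?thesis unfolding is_extension_def by blast
qed

text \<open>The eigenvalues of \<rho>(T) are distinct, so an intertwiner to the quotient character
  kills the first two coordinate vectors. All projections are therefore proportional, and
  M-splitness is the same question for each of them.\<close>

lemma extension_projection:
  assumes "is_extension x1 x2 x3 \<rho>0 \<iota> \<rho> p"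
  obtains c where "c \<noteq> 0" "\<And>v. (p *v v) $ 1 = c * v $ 3"
proof -
  have "intertwines p \<rho> (chi (2 * x3))" and surj: "surj ((*v) p)"
    using assms by (auto simp: is_extension_def exact_sequence_def)
  then have eq: "p ** \<rho> T_mat = chi (2 * x3) T_mat ** p"
    using SL2Z_generators(4) by (auto simp: intertwines_def)
  have "p $ 1 $ i * lam (xs i) = lam x3 * p $ 1 $ i" for i
  proof -
    have "(p ** \<rho> T_mat) $ 1 $ i = (chi (2 * x3) T_mat ** p) $ 1 $ i" using eq by simp
    then show ?thesis
      by (simp add: rho_T[OF rho] diag_mult_right) (simp add: matrix_matrix_mult_def sum_1 chi_even_nth)
  qed
  from this[of 1] this[of 2] have "p $ 1 $ 1 = 0" "p $ 1 $ 2 = 0"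
    using lam_distinct by auto
  then have pv: "(p *v v) $ 1 = p $ 1 $ 3 * v $ 3" for v
    by (simp add: matrix_vector_mult_def sum_3)
  obtain v where "p *v v = vec 1" using surj by (metis surjD)
  then have "p $ 1 $ 3 \<noteq> 0" using pv[of v] by auto
  then show ?thesis using pv by (rule that)
qed

end

end

section \<open>The split triples\<close>

lemma sum_three: "(\<Sum>i<length [a, b, c]. f i) = f 0 + f 1 + (f 2 :: complex^'n)"
  by (simp add: eval_nat_numeral)

lemma three_indices:
  assumes "i < length [a, b, c]"
  obtains "i = 0" | "i = 1" | "i = 2"
proof -
  have "i = 0 \<or> i = 1 \<or> i = 2" using assms by auto
  then show ?thesis using that by blast
qed

context rho_triple
begin

lemma Phi_q_expansions:
  obtains g1 g3 where "q_expansion x1 (\<lambda>\<tau>. Phi \<tau> $ 1) g1" "q_expansion x3 (\<lambda>\<tau>. Phi \<tau> $ 3) g3"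
proof -
  obtain W where W: "q_expansion 1 (eichler 1) W" using eichler(1) by (auto simp: eichler_integral_def)
  have "q_expansion (1 + x3) (\<lambda>\<tau>. (\<sigma> * eichler 1 \<tau>) * eta4 \<tau> powi x3) (\<lambda>q. (\<sigma> * W q) * eta4_unit q powi x3)"
    by (intro q_expansion_mult q_expansion_cmult W eta4_powi_q_expansion)
  then have *: "q_expansion (x3 + 1) (\<lambda>\<tau>. Phi \<tau> $ 1) (\<lambda>q. (\<sigma> * W q) * eta4_unit q powi x3)"
    by (simp add: Phi_def add.commute)
  \<comment> \<open>For x3 = 5 the first coordinate has exponent 6/6 whereas x1 = 0; the surplus
    factor q is absorbed into the power series.\<close>
  have "\<exists>g. q_expansion x1 (\<lambda>\<tau>. Phi \<tau> $ 1) g"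
    using x1_cases * q_expansion_shift[of x1 1] by metis
  moreover have "q_expansion x3 (\<lambda>\<tau>. Phi \<tau> $ 3) (\<lambda>q. eta4_unit q powi x3)"
    unfolding Phi_def vector_3 by (rule eta4_powi_q_expansion)
  ultimately show ?thesis using that by blast
qed

lemma Phi_q_expansion_2:
  assumes "x3 \<noteq> 0"
  obtains g where "q_expansion x2 (\<lambda>\<tau>. Phi \<tau> $ 2) g"
proof -
  obtain W where W: "q_expansion (- 1) (eichler (- 1)) W" using eichler(2) by (auto simp: eichler_integral_def)
  have "q_expansion (- 1 + x3) (\<lambda>\<tau>. (\<sigma> * eichler (- 1) \<tau>) * eta4 \<tau> powi x3) (\<lambda>q. (\<sigma> * W q) * eta4_unit q powi x3)"
    by (intro q_expansion_mult q_expansion_cmult W eta4_powi_q_expansion)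
  then show ?thesis using x2_eq[OF assms] by (intro that) (simp add: Phi_def)
qed

context
  fixes \<rho> :: "int^2^2 \<Rightarrow> complex^3^3"
  assumes rho: "is_rho x1 x2 x3 \<rho>"
begin

lemma Phi_in_vvmf:
  assumes "x3 \<noteq> 0"
  shows "restrict_vec Phi \<in> vvmf \<rho> (2 * x3)"
proof -
  obtain g1 g3 where g: "q_expansion x1 (\<lambda>\<tau>. Phi \<tau> $ 1) g1" "q_expansion x3 (\<lambda>\<tau>. Phi \<tau> $ 3) g3"
    using Phi_q_expansions .
  obtain g2 where "q_expansion x2 (\<lambda>\<tau>. Phi \<tau> $ 2) g2" using Phi_q_expansion_2[OF assms] .
  then show ?thesis
    by (rule restrict_vec_in_vvmf[OF rho g(1) _ g(2)]) (simp_all only: Phi_S)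
qed

lemma vvmf_multiple_Phi:
  assumes "x3 \<noteq> 0" "modular 0 (k - 2 * x3) f"
  shows "restrict_vec (\<lambda>\<tau>. f \<tau> *s Phi \<tau>) \<in> vvmf \<rho> k"
  using vvmf_multiple[OF rho assms(2) Phi_in_vvmf[OF assms(1)]] by simp

text \<open>Every form for the quotient character is a multiple of eta^(4 x3), the third coordinate
  of \<open>Phi\<close>. The same multiple of \<open>Phi\<close>, divided by the scalar c of the
  projection, is a lift.\<close>

lemma rho_M_split:
  assumes "x3 \<noteq> 0" "is_extension x1 x2 x3 \<rho>0 \<iota> \<rho> p"
  shows "M_split \<rho> p (chi (2 * x3))"
  unfolding M_split_def
proof
  fix G assume G: "G \<in> vvmf_module (chi (2 * x3))"
  obtain c where c: "c \<noteq> 0" "\<And>v. (p *v v) $ 1 = c * v $ 3"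
    by (rule extension_projection[OF rho assms(2)]) (rule that)
  define f where "f = (\<lambda>k \<tau>. (1 / c) * (G k \<tau> $ 1 * eta4 \<tau> powi (- x3)))"
  define F where "F = (\<lambda>k. restrict_vec (\<lambda>\<tau>. f k \<tau> *s Phi \<tau>))"
  have Gk: "\<And>\<tau>. \<tau> \<notin> uhp \<Longrightarrow> G k \<tau> = 0" "modular x3 k (\<lambda>\<tau>. G k \<tau> $ 1)" for k
    using G vvmf_chi_iff[OF x_bounds(5,6)] by (auto simp: vvmf_module_def)
  have "F k \<in> vvmf \<rho> k" for k
  proof -
    have "modular 0 (k - 2 * x3) (f k)"
      unfolding f_def using modular_div_eta4[OF Gk(2)[of k], of x3] by (intro modular_cmult) simp
    from vvmf_multiple_Phi[OF assms(1) this] show ?thesis by (simp add: F_def)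
  qed
  moreover have "finite {k. F k \<noteq> (\<lambda>\<tau>. 0)}"
  proof (rule finite_subset)
    show "finite {k. G k \<noteq> (\<lambda>\<tau>. 0)}" using G by (simp add: vvmf_module_def)
    have "F k = (\<lambda>\<tau>. 0)" if "G k = (\<lambda>\<tau>. 0)" for k
      using that by (simp add: F_def f_def restrict_vec_def fun_eq_iff)
    then show "{k. F k \<noteq> (\<lambda>\<tau>. 0)} \<subseteq> {k. G k \<noteq> (\<lambda>\<tau>. 0)}" by blast
  qed
  ultimately have "F \<in> vvmf_module \<rho>" by (simp add: vvmf_module_def)
  moreover have "(\<lambda>k \<tau>. p *v F k \<tau>) = G"
  proof (intro ext)
    fix k \<tau>
    show "p *v F k \<tau> = G k \<tau>"
    proof (cases "\<tau> \<in> uhp")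
      case True
      have "(p *v F k \<tau>) $ 1 = G k \<tau> $ 1"
        using True c(1) eta4_nonzero[OF True]
        by (simp add: c(2) F_def f_def restrict_vec_def Phi_def power_int_minus)
      then show ?thesis by (simp add: vec_eq_iff forall_1)
    next
      case False
      then show ?thesis using Gk(1)[OF False] by (simp add: F_def restrict_vec_def)
    qed
  qed
  ultimately show "\<exists>F\<in>vvmf_module \<rho>. (\<lambda>k \<tau>. p *v F k \<tau>) = G" by blast
qed

lemma first_axis_in_vvmf:
  "restrict_vec (\<lambda>\<tau>. vector [eta4 \<tau> powi x1, 0, 0]) \<in> vvmf \<rho> (2 * x1)"
  by (rule restrict_vec_in_vvmf[OF rho])
    (use eta4_powi_q_expansion[of x1] q_expansion_zero modular_S[OF modular_eta4_powi, of _ x1]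
     in \<open>auto simp: sgn_x\<close>)

lemma second_axis_in_vvmf:
  "restrict_vec (\<lambda>\<tau>. vector [0, eta4 \<tau> powi x2, 0]) \<in> vvmf \<rho> (2 * x2)"
  by (rule restrict_vec_in_vvmf[OF rho])
    (use eta4_powi_q_expansion[of x2] q_expansion_zero modular_S[OF modular_eta4_powi, of _ x2]
     in \<open>auto simp: sgn_x\<close>)

text \<open>When the third coordinates agree, the inhomogeneous term in the S-law cancels in the
  difference. Its first two coordinates are then scalar forms, hence multiples of eta^(4 x1) and
  eta^(4 x2).\<close>

lemma vvmf_difference:
  assumes "F \<in> vvmf \<rho> k" "G \<in> vvmf \<rho> k" "\<And>\<tau>. \<tau> \<in> uhp \<Longrightarrow> F \<tau> $ 3 = G \<tau> $ 3"
  obtains p1 p2 where "E_poly (k - 2 * x1) p1" "E_poly (k - 2 * x2) p2"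
    "\<And>\<tau>. \<tau> \<in> uhp \<Longrightarrow> F \<tau> = G \<tau> + vector [p1 \<tau> * eta4 \<tau> powi x1, p2 \<tau> * eta4 \<tau> powi x2, 0]"
proof -
  have FG: "\<exists>g. q_expansion x1 (\<lambda>\<tau>. F \<tau> $ 1 + (- 1) * G \<tau> $ 1) g" "\<exists>g. q_expansion x2 (\<lambda>\<tau>. F \<tau> $ 2 + (- 1) * G \<tau> $ 2) g"
    using assms(1,2) q_expansion_add q_expansion_cmult unfolding vvmf_rho_iff[OF rho] by blast+
  have S: "\<And>\<tau>. \<tau> \<in> uhp \<Longrightarrow> F (- 1 / \<tau>) $ 1 = \<tau> powi k * (F \<tau> $ 3 - \<sigma> * F \<tau> $ 1)"
    "\<And>\<tau>. \<tau> \<in> uhp \<Longrightarrow> F (- 1 / \<tau>) $ 2 = \<tau> powi k * (F \<tau> $ 3 - \<sigma> * F \<tau> $ 2)"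
    "\<And>\<tau>. \<tau> \<in> uhp \<Longrightarrow> G (- 1 / \<tau>) $ 1 = \<tau> powi k * (G \<tau> $ 3 - \<sigma> * G \<tau> $ 1)"
    "\<And>\<tau>. \<tau> \<in> uhp \<Longrightarrow> G (- 1 / \<tau>) $ 2 = \<tau> powi k * (G \<tau> $ 3 - \<sigma> * G \<tau> $ 2)"
    using assms(1,2) unfolding vvmf_rho_iff[OF rho] by blast+
  obtain g where "q_expansion x1 (\<lambda>\<tau>. F \<tau> $ 1 + (- 1) * G \<tau> $ 1) g" using FG(1) by blast
  then have "modular x1 k (\<lambda>\<tau>. F \<tau> $ 1 + (- 1) * G \<tau> $ 1)"
    by (rule modularI) (simp only: S assms(3) sgn_x, simp add: algebra_simps)
  then obtain p1 where p1: "E_poly (k - 2 * x1) p1" "\<And>\<tau>. \<tau> \<in> uhp \<Longrightarrow> F \<tau> $ 1 + (- 1) * G \<tau> $ 1 = p1 \<tau> * eta4 \<tau> powi x1"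
    by (rule modular_div_eta4_E_poly) (rule that)
  obtain g where "q_expansion x2 (\<lambda>\<tau>. F \<tau> $ 2 + (- 1) * G \<tau> $ 2) g" using FG(2) by blast
  then have "modular x2 k (\<lambda>\<tau>. F \<tau> $ 2 + (- 1) * G \<tau> $ 2)"
    by (rule modularI) (simp only: S assms(3) sgn_x, simp add: algebra_simps)
  then obtain p2 where p2: "E_poly (k - 2 * x2) p2" "\<And>\<tau>. \<tau> \<in> uhp \<Longrightarrow> F \<tau> $ 2 + (- 1) * G \<tau> $ 2 = p2 \<tau> * eta4 \<tau> powi x2"
    by (rule modular_div_eta4_E_poly) (rule that)
  show ?thesis
  proof (rule that[OF p1(1) p2(1)])
    fix \<tau> assume t: "\<tau> \<in> uhp"
    show "F \<tau> = G \<tau> + vector [p1 \<tau> * eta4 \<tau> powi x1, p2 \<tau> * eta4 \<tau> powi x2, 0]"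
      using p1(2)[OF t] p2(2)[OF t] assms(3)[OF t] by (simp add: vec_eq_iff forall_3 algebra_simps)
  qed
qed

text \<open>The third coordinate fixes the coefficient of \<open>Phi\<close>, and the remainder has
  third coordinate 0. At each \<tau> the three vectors form a triangular matrix with powers of eta^4
  on the diagonal, whence independence.\<close>

lemma split_generating_weights:
  assumes "x3 \<noteq> 0"
  shows "has_generating_weights \<rho> {#2 * x1, 2 * x2, 2 * x3#}"
proof -
  define B where "B = (\<lambda>i::nat. restrict_vec (if i = 0 then (\<lambda>\<tau>. vector [eta4 \<tau> powi x1, 0, 0])
    else if i = 1 then (\<lambda>\<tau>. vector [0, eta4 \<tau> powi x2, 0]) else Phi))"
  let ?ks = "[2 * x1, 2 * x2, 2 * x3]"
  have B: "B i \<in> vvmf \<rho> (?ks ! i)" if "i < length ?ks" for i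
    using that first_axis_in_vvmf second_axis_in_vvmf Phi_in_vvmf[OF assms] by (elim three_indices) (simp_all add: B_def)
  have B_eq: "B 0 \<tau> = vector [eta4 \<tau> powi x1, 0, 0]" "B 1 \<tau> = vector [0, eta4 \<tau> powi x2, 0]" "B 2 \<tau> = Phi \<tau>"
    if "\<tau> \<in> uhp" for \<tau>
    using that by (simp_all add: B_def restrict_vec_def)
  have "homogeneous_basis \<rho> ?ks B"
  proof (rule homogeneous_basisI[OF B])
    fix k F assume F: "F \<in> vvmf \<rho> k"
    obtain p3 where p3: "E_poly (k - 2 * x3) p3" "\<And>\<tau>. \<tau> \<in> uhp \<Longrightarrow> F \<tau> $ 3 = p3 \<tau> * eta4 \<tau> powi x3"
      by (rule modular_div_eta4_E_poly[OF vvmf_third_modular[OF rho F]]) (rule that)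
    have G: "restrict_vec (\<lambda>\<tau>. p3 \<tau> *s Phi \<tau>) \<in> vvmf \<rho> k"
      using vvmf_multiple_Phi[OF assms E_poly_modular[OF p3(1)]] by simp
    obtain p1 p2 where p: "E_poly (k - 2 * x1) p1" "E_poly (k - 2 * x2) p2"
      "\<And>\<tau>. \<tau> \<in> uhp \<Longrightarrow> F \<tau> = restrict_vec (\<lambda>\<tau>. p3 \<tau> *s Phi \<tau>) \<tau> +
         vector [p1 \<tau> * eta4 \<tau> powi x1, p2 \<tau> * eta4 \<tau> powi x2, 0]"
      by (rule vvmf_difference[OF F G]) (simp_all add: p3(2) restrict_vec_def Phi_def)
    let ?c = "\<lambda>i::nat. if i = 0 then p1 else if i = 1 then p2 else p3"
    show "\<exists>c. (\<forall>i<length ?ks. E_poly (k - ?ks ! i) (c i)) \<and>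
       (\<forall>\<tau>\<in>uhp. F \<tau> = (\<Sum>i<length ?ks. c i \<tau> *s B i \<tau>))"
    proof (intro exI[of _ ?c] conjI allI impI ballI)
      fix i assume "i < length ?ks"
      then show "E_poly (k - ?ks ! i) (?c i)" using p(1,2) p3(1) by (elim three_indices) simp_all
    next
      fix \<tau> assume t: "\<tau> \<in> uhp"
      show "F \<tau> = (\<Sum>i<length ?ks. ?c i \<tau> *s B i \<tau>)"
        unfolding sum_three B_eq[OF t] p(3)[OF t]
        using t by (simp add: vec_eq_iff forall_3 restrict_vec_def)
    qed
  next
    fix \<tau> a i assume t: "\<tau> \<in> uhp" and 0: "(\<Sum>i<length ?ks. a i *s B i \<tau>) = 0" and i: "i < length ?ks"
    have "a 2 = 0 \<and> a 1 = 0 \<and> a 0 = 0"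
      using 0 eta4_nonzero[OF t] unfolding sum_three B_eq[OF t]
      by (auto simp: vec_eq_iff forall_3 Phi_def)
    with i show "a i = 0" by (elim three_indices) simp_all
  qed
  then show ?thesis unfolding has_generating_weights_def by fastforce
qed

end

section \<open>The exceptional triple\<close>

context
  fixes \<rho> :: "int^2^2 \<Rightarrow> complex^3^3"
  assumes rho: "is_rho x1 x2 x3 \<rho>" and x3: "x3 = 0"
begin

text \<open>The third coordinate is a constant d, and the second minus d times the Eichler integral
  is a form of weight 0 with pole at most q^(-1/6), hence 0. But the second coordinate starts at
  q^(5/6) and the Eichler integral at q^(-1/6), so d = 0.\<close>

lemma weight_0_third_zero:
  assumes F: "F \<in> vvmf \<rho> 0" and "\<tau> \<in> uhp"
  shows "F \<tau> $ 3 = 0"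
proof -
  have S: "F (- 1 / \<tau>) $ 2 = F \<tau> $ 3 - F \<tau> $ 2" if "\<tau> \<in> uhp" for \<tau>
    using F that unfolding vvmf_rho_iff[OF rho] by (simp add: x3)
  have "modular 0 0 (\<lambda>\<tau>. F \<tau> $ 3)" using vvmf_third_modular[OF rho F] by (simp add: x3)
  then obtain d where d: "\<And>\<tau>. \<tau> \<in> uhp \<Longrightarrow> F \<tau> $ 3 = d" by (rule modular_weight_0) (rule that)
  obtain g where "q_expansion 5 (\<lambda>\<tau>. F \<tau> $ 2) g"
    using F x_zero(2)[OF x3] unfolding vvmf_rho_iff[OF rho] by auto
  \<comment> \<open>Reading 5/6 as -1/6 + 1 brings both expansions to the same prefactor and
    displays the zero at q = 0.\<close>
  then have g: "q_expansion (- 1) (\<lambda>\<tau>. F \<tau> $ 2) (\<lambda>q. q ^ 1 * g q)"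
    by (intro q_expansion_shift[where n = 1]) simp
  obtain W where W: "eichler_integral (- 1) (eichler (- 1)) W" using eichler(2) by blast
  then have Wq: "q_expansion (- 1) (eichler (- 1)) W" and W0: "W 0 \<noteq> 0" by (auto simp: eichler_integral_def)
  let ?D = "\<lambda>\<tau>. F \<tau> $ 2 + (- d) * eichler (- 1) \<tau>"
  have "q_expansion (- 1) ?D (\<lambda>q. q ^ 1 * g q + (- d) * W q)"
    by (intro q_expansion_add q_expansion_cmult g Wq)
  then have "modular (- 1) 0 ?D"
    by (rule modularI) (simp only: S d eichler_S, simp add: algebra_simps)
  from modular_mult[OF this modular_eta4] have "modular 0 2 (\<lambda>\<tau>. ?D \<tau> * eta4 \<tau>)" by simp
  from modular_weight_2[OF this] have "F \<tau> $ 2 = d * eichler (- 1) \<tau>" if "\<tau> \<in> uhp" for \<tau>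
    using that eta4_nonzero[OF that] by fastforce
  then have "q_expansion (- 1) (\<lambda>\<tau>. F \<tau> $ 2) (\<lambda>q. d * W q)"
    by (intro q_expansion_cong[OF q_expansion_cmult[OF Wq]])
  from q_expansion_unique[OF g this] W0 have "d = 0" by simp
  with d assms(2) show ?thesis by simp
qed

text \<open>The constant 1, a form of weight 0 for the trivial character, has no lift.\<close>

lemma rho_not_M_split:
  assumes "is_extension x1 x2 x3 \<rho>0 \<iota> \<rho> p"
  shows "\<not> M_split \<rho> p (chi (2 * x3))"
proof
  assume split: "M_split \<rho> p (chi (2 * x3))"
  obtain c where c: "c \<noteq> 0" "\<And>v. (p *v v) $ 1 = c * v $ 3"
    by (rule extension_projection[OF rho assms]) (rule that)
  define G where "G = homogeneous 0 (restrict_vec (\<lambda>\<tau>. vec 1 :: complex^1))"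
  have "G \<in> vvmf_module (chi (2 * 0))"
    unfolding vvmf_module_def
  proof (intro CollectI conjI allI)
    fix k
    have "modular 0 0 (\<lambda>\<tau>. restrict_vec (\<lambda>\<tau>. vec 1 :: complex^1) \<tau> $ 1)"
      by (rule modular_cong[OF modular_const[of 1]]) (simp add: restrict_vec_def)
    moreover have "modular 0 k (\<lambda>\<tau>. (0 :: complex^1) $ 1)" using modular_zero by simp
    ultimately show "G k \<in> vvmf (chi (2 * 0)) k"
      using vvmf_chi_iff[of 0 "G k" k] by (auto simp: G_def homogeneous_def restrict_vec_def)
    show "finite {k. G k \<noteq> (\<lambda>\<tau>. 0)}"
      by (rule finite_subset[of _ "{0}"]) (auto simp: G_def homogeneous_def)
  qed
  then obtain F where F: "F \<in> vvmf_module \<rho>" "(\<lambda>k \<tau>. p *v F k \<tau>) = G"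
    using split unfolding M_split_def x3 by blast
  have "F 0 \<in> vvmf \<rho> 0" using F(1) by (simp add: vvmf_module_def)
  from weight_0_third_zero[OF this i_in_uhp] have "(p *v F 0 \<i>) $ 1 = 0" by (simp add: c(2))
  moreover have "p *v F 0 \<i> = vec 1"
    using fun_cong[OF fun_cong[OF F(2), of 0], of \<i>] i_in_uhp
    by (simp add: G_def homogeneous_def restrict_vec_def)
  ultimately show False by simp
qed

text \<open>\<open>(g\<^sub>1, g\<^sub>2, 1)\<close> with the Eichler integrals \<open>g\<^sub>1, g\<^sub>2\<close> has a pole at the cusp in its second
  coordinate. It can be cancelled only after multiplication by \<open>E\<^sub>4\<close> or \<open>E\<^sub>6\<close>.\<close>

lemma nonsplit_generator:
  assumes W: "eichler_integral (- 1) (eichler (- 1)) W"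
    and E: "modular 0 k E" "q_expansion 0 E e" "e 0 = 1"
    and E': "modular 0 (k + 2) E'" "q_expansion 0 E' e'" "e' 0 = 1"
  shows "restrict_vec (\<lambda>\<tau>. vector [E \<tau> * eichler 1 \<tau>,
     E \<tau> * eichler (- 1) \<tau> - W 0 * (E' \<tau> * eta4 \<tau> powi (- 1)), E \<tau>]) \<in> vvmf \<rho> k"
proof -
  have Wq: "q_expansion (- 1) (eichler (- 1)) W" using W by (auto simp: eichler_integral_def)
  obtain W1 where W1: "q_expansion 1 (eichler 1) W1" using eichler(1) by (auto simp: eichler_integral_def)
  let ?f = "\<lambda>\<tau>. E \<tau> * eichler (- 1) \<tau> + (- W 0) * (E' \<tau> * eta4 \<tau> powi (- 1))"
  let ?g = "\<lambda>q. e q * W q + (- W 0) * (e' q * eta4_unit q powi (- 1))"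
  have "q_expansion (0 + - 1) ?f ?g"
    by (intro q_expansion_add q_expansion_cmult q_expansion_mult eta4_powi_q_expansion E E' Wq)
  \<comment> \<open>The constant term \<open>W 0 - W 0\<close> vanishes, so the exponent rises from
    -1 to 5, which is x2.\<close>
  then obtain g where "q_expansion (0 + - 1 + 6) ?f g"
    by (rule q_expansion_unshift) (simp add: E E' eta4_unit, rule that)
  then have f: "q_expansion x2 ?f g" using x_zero(2)[OF x3] by simp
  have f1: "q_expansion x1 (\<lambda>\<tau>. E \<tau> * eichler 1 \<tau>) (\<lambda>q. e q * W1 q)"
    using q_expansion_mult[OF E(2) W1] x_zero(1)[OF x3] by simp
  have h: "modular (- 1) k (\<lambda>\<tau>. E' \<tau> * eta4 \<tau> powi (- 1))"
    using modular_div_eta4[OF E'(1), of 1] by simp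
  define V where "V = (\<lambda>\<tau>. vector [E \<tau> * eichler 1 \<tau>,
     E \<tau> * eichler (- 1) \<tau> - W 0 * (E' \<tau> * eta4 \<tau> powi (- 1)), E \<tau>] :: complex^3)"
  have "restrict_vec V \<in> vvmf \<rho> k"
  proof (rule restrict_vec_in_vvmf[OF rho])
    fix \<tau> assume t: "\<tau> \<in> uhp"
    note S = modular_S[OF E(1) t] eichler_S[OF t] modular_S[OF h t]
    show "V (- 1 / \<tau>) $ 1 = \<tau> powi k * (V \<tau> $ 3 - \<sigma> * V \<tau> $ 1)"
      "V (- 1 / \<tau>) $ 2 = \<tau> powi k * (V \<tau> $ 3 - \<sigma> * V \<tau> $ 2)"
      "V (- 1 / \<tau>) $ 3 = \<tau> powi k * (\<sigma> * V \<tau> $ 3)"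
      unfolding V_def vector_3 S by (simp_all add: x3 algebra_simps)
  qed (use f f1 E(2) in \<open>simp_all add: V_def x3\<close>)
  then show ?thesis by (simp add: V_def)
qed

text \<open>Lifting generators of the ideal replaces lifting 1: a decomposition of the third
  coordinate along E4 and E6 supplies the coefficients of \<open>B1\<close> and \<open>B2\<close>.
  What remains lies on the first two axes, and its second coordinate is again reached from
  \<open>B1\<close> and \<open>B2\<close>.\<close>

lemma nonsplit_generating_weights: "has_generating_weights \<rho> {#2, 4, 6#}"
proof -
  obtain W where W: "eichler_integral (- 1) (eichler (- 1)) W" using eichler(2) by blast
  define \<kappa> where "\<kappa> = W 0"
  have \<kappa>: "\<kappa> \<noteq> 0" using W by (simp add: \<kappa>_def eichler_integral_def)
  define B1 where "B1 = (\<lambda>\<tau>. vector [E4 \<tau> * eichler 1 \<tau>,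
     E4 \<tau> * eichler (- 1) \<tau> - \<kappa> * (E6 \<tau> * eta4 \<tau> powi (- 1)), E4 \<tau>] :: complex^3)"
  define B2 where "B2 = (\<lambda>\<tau>. vector [E6 \<tau> * eichler 1 \<tau>,
     E6 \<tau> * eichler (- 1) \<tau> - \<kappa> * ((E4 \<tau> * E4 \<tau>) * eta4 \<tau> powi (- 1)), E6 \<tau>] :: complex^3)"
  have B1: "restrict_vec B1 \<in> vvmf \<rho> 4"
    unfolding B1_def \<kappa>_def
    by (rule nonsplit_generator[OF W modular_E4 E4_q_expansion _ _ E6_q_expansion]) (use modular_E6 in simp_all)
  have B2: "restrict_vec B2 \<in> vvmf \<rho> 6"
    unfolding B2_def \<kappa>_def
    by (rule nonsplit_generator[OF W modular_E6 E6_q_expansion _ _ q_expansion_mult[OF E4_q_expansion E4_q_expansion, simplified]])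
      (use modular_mult[OF modular_E4 modular_E4] in simp_all)
  define B where "B = (\<lambda>i::nat. restrict_vec (if i = 0 then (\<lambda>\<tau>. vector [eta4 \<tau> powi x1, 0, 0])
    else if i = 1 then B1 else B2))"
  let ?ks = "[2, 4, 6] :: int list"
  have B: "B i \<in> vvmf \<rho> (?ks ! i)" if "i < length ?ks" for i
    using that first_axis_in_vvmf[OF rho] B1 B2 x_zero(1)[OF x3] by (elim three_indices) (simp_all add: B_def)
  have B_eq: "B 0 \<tau> = vector [eta4 \<tau>, 0, 0]" "B 1 \<tau> = B1 \<tau>" "B 2 \<tau> = B2 \<tau>"
    if "\<tau> \<in> uhp" for \<tau>
    using that x_zero(1)[OF x3] by (simp_all add: B_def restrict_vec_def)
  have "homogeneous_basis \<rho> ?ks B"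
  proof (rule homogeneous_basisI[OF B])
    fix k F assume F: "F \<in> vvmf \<rho> k"
    have "\<exists>f1 f2. E_poly (k - 4) f1 \<and> E_poly (k - 6) f2 \<and> (\<forall>\<tau>\<in>uhp. F \<tau> $ 3 = E4 \<tau> * f1 \<tau> + E6 \<tau> * f2 \<tau>)"
    proof (cases "k = 0")
      case True
      then show ?thesis
        using weight_0_third_zero F E_poly_zero[of "k - 4"] E_poly_zero[of "k - 6"]
        by (intro exI[of _ "\<lambda>\<tau>. 0"]) auto
    next
      case False
      have "modular 0 k (\<lambda>\<tau>. F \<tau> $ 3)" using vvmf_third_modular[OF rho F] by (simp add: x3)
      then obtain f where f: "E_poly k f" "\<forall>\<tau>\<in>uhp. F \<tau> $ 3 = f \<tau>" using modular_E_poly by blast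
      show ?thesis by (rule E_poly_decompose[OF f(1) False]) (use f(2) in auto)
    qed
    then obtain f1 f2 where f: "E_poly (k - 4) f1" "E_poly (k - 6) f2"
      "\<And>\<tau>. \<tau> \<in> uhp \<Longrightarrow> F \<tau> $ 3 = E4 \<tau> * f1 \<tau> + E6 \<tau> * f2 \<tau>"
      by blast
    define G where "G = (\<lambda>\<tau>. restrict_vec (\<lambda>\<tau>. f1 \<tau> *s B1 \<tau>) \<tau> + restrict_vec (\<lambda>\<tau>. f2 \<tau> *s B2 \<tau>) \<tau>)"
    have G: "G \<in> vvmf \<rho> k"
      unfolding G_def
      using vvmf_multiple[OF rho E_poly_modular[OF f(1)] B1] vvmf_multiple[OF rho E_poly_modular[OF f(2)] B2]
      by (intro vvmf_add[OF rho]) simp_all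
    obtain p1 p2 where p: "E_poly (k - 2 * x1) p1" "E_poly (k - 2 * x2) p2"
      "\<And>\<tau>. \<tau> \<in> uhp \<Longrightarrow> F \<tau> = G \<tau> + vector [p1 \<tau> * eta4 \<tau> powi x1, p2 \<tau> * eta4 \<tau> powi x2, 0]"
      by (rule vvmf_difference[OF rho F G]) (simp_all add: f(3) G_def restrict_vec_def B1_def B2_def mult.commute)
    \<comment> \<open>E6 B1 - E4 B2 has first and third coordinate 0 and second coordinate \<kappa>
      (E4^3 - E6^2) / eta^4 = 1728 \<kappa> eta^20; \<open>s\<close> normalises it to the second
      axis form.\<close>
    define s where "s = 1 / (1728 * \<kappa>)"
    let ?c = "\<lambda>i::nat. if i = 0 then p1 else if i = 1 then (\<lambda>\<tau>. f1 \<tau> + E6 \<tau> * (s * p2 \<tau>))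
      else (\<lambda>\<tau>. f2 \<tau> + E4 \<tau> * (- s * p2 \<tau>))"
    show "\<exists>c. (\<forall>i<length ?ks. E_poly (k - ?ks ! i) (c i)) \<and>
       (\<forall>\<tau>\<in>uhp. F \<tau> = (\<Sum>i<length ?ks. c i \<tau> *s B i \<tau>))"
    proof (intro exI[of _ ?c] conjI allI impI ballI)
      have p': "E_poly (k - 2) p1" "E_poly (k - 10) p2" using p(1,2) x_zero[OF x3] by simp_all
      have e: "E_poly (k - 10 + 6) (\<lambda>\<tau>. E6 \<tau> * (s * p2 \<tau>))" "E_poly (k - 10 + 4) (\<lambda>\<tau>. E4 \<tau> * (- s * p2 \<tau>))"
        by (intro E_poly_E6 E_poly_E4 E_poly_cmult p')+
      have weights: "k - 10 + 6 = k - 4" "k - 10 + 4 = k - 6" by simp_all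
      have "E_poly (k - 4) (\<lambda>\<tau>. f1 \<tau> + E6 \<tau> * (s * p2 \<tau>))" "E_poly (k - 6) (\<lambda>\<tau>. f2 \<tau> + E4 \<tau> * (- s * p2 \<tau>))"
        using E_poly_add[OF f(1) e(1)[unfolded weights]] E_poly_add[OF f(2) e(2)[unfolded weights]] .
      moreover fix i assume "i < length ?ks"
      ultimately show "E_poly (k - ?ks ! i) (?c i)" using p' by (elim three_indices) simp_all
    next
      fix \<tau> assume t: "\<tau> \<in> uhp"
      have h: "eta4 \<tau> \<noteq> 0" using eta4_nonzero[OF t] .
      have D: "E4 \<tau> ^ 3 - E6 \<tau> ^ 2 = 1728 * eta4 \<tau> ^ 6" unfolding eta4_power_6[OF t] by (simp add: Discr_def)
      have e5: "eta4 \<tau> powi 5 = eta4 \<tau> ^ 6 * eta4 \<tau> powi (- 1)"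
        using h by (simp add: power_int_minus field_simps eval_nat_numeral)
      have "s * p2 \<tau> * (\<kappa> * ((E4 \<tau> * E4 \<tau> * E4 \<tau> - E6 \<tau> * E6 \<tau>) * eta4 \<tau> powi (- 1))) =
          s * p2 \<tau> * (\<kappa> * ((E4 \<tau> ^ 3 - E6 \<tau> ^ 2) * eta4 \<tau> powi (- 1)))"
        by (simp add: power2_eq_square power3_eq_cube)
      also have "\<dots> = p2 \<tau> * eta4 \<tau> powi 5" unfolding D e5 s_def using \<kappa> by simp
      finally have second: "p2 \<tau> * eta4 \<tau> powi 5 = s * p2 \<tau> * (\<kappa> * ((E4 \<tau> * E4 \<tau> * E4 \<tau> - E6 \<tau> * E6 \<tau>) * eta4 \<tau> powi (- 1)))" ..
      let ?h = "eta4 \<tau> powi (- 1)" and ?g = "eichler (- 1) \<tau>"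
      have "f1 \<tau> * (E4 \<tau> * ?g - \<kappa> * (E6 \<tau> * ?h)) + f2 \<tau> * (E6 \<tau> * ?g - \<kappa> * ((E4 \<tau> * E4 \<tau>) * ?h)) +
          p2 \<tau> * eta4 \<tau> powi 5 =
        (f1 \<tau> + E6 \<tau> * (s * p2 \<tau>)) * (E4 \<tau> * ?g - \<kappa> * (E6 \<tau> * ?h)) +
        (f2 \<tau> + E4 \<tau> * (- s * p2 \<tau>)) * (E6 \<tau> * ?g - \<kappa> * ((E4 \<tau> * E4 \<tau>) * ?h))" (is "?l = ?r")
        unfolding second by (simp only: algebra_simps) simp
      moreover have "(G \<tau> + vector [p1 \<tau> * eta4 \<tau> powi x1, p2 \<tau> * eta4 \<tau> powi x2, 0]) $ 2 = ?l"
        using t by (simp add: restrict_vec_def G_def B1_def B2_def x_zero[OF x3])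
      moreover have "(?c 0 \<tau> *s vector [eta4 \<tau>, 0, 0] + ?c 1 \<tau> *s B1 \<tau> + ?c 2 \<tau> *s B2 \<tau>) $ 2 = ?r"
        by (simp add: B1_def B2_def) (simp add: algebra_simps)
      ultimately have second': "(G \<tau> + vector [p1 \<tau> * eta4 \<tau> powi x1, p2 \<tau> * eta4 \<tau> powi x2, 0]) $ 2 =
          (?c 0 \<tau> *s vector [eta4 \<tau>, 0, 0] + ?c 1 \<tau> *s B1 \<tau> + ?c 2 \<tau> *s B2 \<tau>) $ 2"
        by (simp only:)
      show "F \<tau> = (\<Sum>i<length ?ks. ?c i \<tau> *s B i \<tau>)"
        unfolding sum_three B_eq[OF t] p(3)[OF t] vec_eq_iff forall_3
      proof (intro conjI second')
        show "(G \<tau> + vector [p1 \<tau> * eta4 \<tau> powi x1, p2 \<tau> * eta4 \<tau> powi x2, 0]) $ 1 =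
          (?c 0 \<tau> *s vector [eta4 \<tau>, 0, 0] + ?c 1 \<tau> *s B1 \<tau> + ?c 2 \<tau> *s B2 \<tau>) $ 1"
          using t by (simp add: restrict_vec_def G_def B1_def B2_def x_zero[OF x3])
        show "(G \<tau> + vector [p1 \<tau> * eta4 \<tau> powi x1, p2 \<tau> * eta4 \<tau> powi x2, 0]) $ 3 =
          (?c 0 \<tau> *s vector [eta4 \<tau>, 0, 0] + ?c 1 \<tau> *s B1 \<tau> + ?c 2 \<tau> *s B2 \<tau>) $ 3"
          using t by (simp add: restrict_vec_def G_def B1_def B2_def x_zero[OF x3])
      qed
    qed
  next
    fix \<tau> a i assume t: "\<tau> \<in> uhp" and 0: "(\<Sum>i<length ?ks. a i *s B i \<tau>) = 0" and i: "i < length ?ks"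
    have h: "eta4 \<tau> \<noteq> 0" using eta4_nonzero[OF t] .
    have D: "E4 \<tau> ^ 3 - E6 \<tau> ^ 2 \<noteq> 0" using Discr_nonzero[OF t] by (simp add: Discr_def)
    define h' where "h' = eta4 \<tau> powi (- 1)"
    have h': "h' \<noteq> 0" using h by (simp add: h'_def)
    have c3: "a 1 * E4 \<tau> + a 2 * E6 \<tau> = 0"
      and c2: "a 1 * (E4 \<tau> * eichler (- 1) \<tau> - \<kappa> * (E6 \<tau> * h')) +
        a 2 * (E6 \<tau> * eichler (- 1) \<tau> - \<kappa> * (E4 \<tau> * E4 \<tau> * h')) = 0"
      and c1: "a 0 * eta4 \<tau> + a 1 * (E4 \<tau> * eichler 1 \<tau>) + a 2 * (E6 \<tau> * eichler 1 \<tau>) = 0"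
      using 0 unfolding sum_three B_eq[OF t] by (simp_all add: vec_eq_iff forall_3 B1_def B2_def h'_def)
    \<comment> \<open>The relation in the third coordinate eliminates the Eichler integral from the
      second. The remaining system in \<open>a 1\<close>, \<open>a 2\<close> has determinant E4^3 -
      E6^2, which has no zero.\<close>
    have "\<kappa> * h' * (a 1 * E6 \<tau> + a 2 * (E4 \<tau> * E4 \<tau>)) = 0" using c2 c3 by algebra
    then have c2': "a 1 * E6 \<tau> + a 2 * (E4 \<tau> * E4 \<tau>) = 0" using \<kappa> h' by simp
    have "a 2 * (E4 \<tau> ^ 3 - E6 \<tau> ^ 2) = 0" "a 1 * (E4 \<tau> ^ 3 - E6 \<tau> ^ 2) = 0" using c2' c3 by algebra+
    then have "a 2 = 0" "a 1 = 0" using D by simp_all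
    moreover from this c1 h have "a 0 = 0" by simp
    ultimately show "a i = 0" using i by (elim three_indices) simp_all
  qed
  then show ?thesis unfolding has_generating_weights_def by fastforce
qed

end

end

theorem theorem4p4:
  fixes x1 x2 x3 :: int
  assumes "(x1, x2, x3) \<in> {(1,5,0), (2,0,1), (3,1,2), (4,2,3), (5,3,4), (0,4,5)}"
  shows "(\<exists>!\<rho>. is_rho x1 x2 x3 \<rho>) \<and>
    (\<forall>\<rho>. is_rho x1 x2 x3 \<rho> \<longrightarrow>
      (\<exists>\<rho>0 \<iota> p. is_extension x1 x2 x3 \<rho>0 \<iota> \<rho> p) \<and>
      ((x1, x2, x3) \<noteq> (1, 5, 0) \<longrightarrow>
        (\<forall>\<rho>0 \<iota> p. is_extension x1 x2 x3 \<rho>0 \<iota> \<rho> p \<longrightarrow> M_split \<rho> p (chi (2 * x3))) \<and>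
        has_generating_weights \<rho> {#2 * x1, 2 * x2, 2 * x3#}) \<and>
      ((x1, x2, x3) = (1, 5, 0) \<longrightarrow>
        (\<forall>\<rho>0 \<iota> p. is_extension x1 x2 x3 \<rho>0 \<iota> \<rho> p \<longrightarrow> \<not> M_split \<rho> p (chi (2 * x3))) \<and>
        has_generating_weights \<rho> {#2, 4, 6#}))"
proof -
  interpret rho_triple x1 x2 x3 using assms by unfold_locales
  have nonzero: "x3 \<noteq> 0" if "(x1, x2, x3) \<noteq> (1, 5, 0)" using assms that by auto
  have "\<exists>!\<rho>. is_rho x1 x2 x3 \<rho>" using ex_rho rho_unique by blast
  then show ?thesis
    using ex_extension rho_M_split split_generating_weights rho_not_M_split nonsplit_generating_weights nonzero
    by blast
qed

end
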